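(* Let $\Omega\in\mathbb{R}$, $L>0$ and $x,y\in\mathbb{R}^2$. In the scintillation regime ($C\to\varepsilon C$, $r_0\to r_0/\varepsilon$, $\rho_0\to\rho_0/\varepsilon$, $L\to L/\varepsilon$) with frequencies $\omega=\omega_0+\varepsilon\Omega$ and $\tilde\omega=\omega_0-\varepsilon\Omega$, the mean refocused field satisfies, as $\varepsilon\to0$, $$\begin{aligned}\mathbb{E}\Big[\hat u_{\rm tr}\big(\tfrac y\varepsilon+x;\tfrac y\varepsilon\big)\Big]\longrightarrow\;&\frac{K(L)}{(2\pi)^4}\int_{\mathbb{R}^2}\frac{r_0^2}{4\pi}\exp\Big(-\frac{r_0^2|\zeta|^2}4+iy\cdot\zeta\Big)d\zeta\\&+\frac1{(2\pi)^4}\iint_{\mathbb{R}^2\times\mathbb{R}^2}\frac{r_0^2}{4\pi}\exp\Big(-\frac{r_0^2|\zeta|^2}4+ix\cdot\xi+iy\cdot\zeta-i\frac{Lc_o}{\omega_0}\xi\cdot\zeta\Big)A(L,\xi,\zeta,\Omega)\,d\xi\,d\zeta.\end{aligned}$$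
   Context: Constants $c_o,\omega_0,r_0,\rho_0>0$. $C:\mathbb{R}^2\to\mathbb{R}$ is the covariance function of the medium: even, continuous, integrable, with Fourier transform $\hat C(k)=\int_{\mathbb{R}^2}C(x)e^{-ik\cdot x}dx$ nonnegative (Bochner) and in $L^1(\mathbb{R}^2)$, so $C(0)=(2\pi)^{-2}\int\hat C(k)dk$. Time-reversed (refocused) field: for frequencies $\omega,\tilde\omega$ and distance $L$, $$\hat u_{\rm tr}(x;y)=\iint_{\mathbb{R}^2\times\mathbb{R}^2}e^{-\frac{|x'|^2}{r_0^2}-\frac{|y'|^2}{4\rho_0^2}}\,\hat G\big(\omega,L,x,x'+\tfrac{y'}2\big)\overline{\hat G\big(\tilde\omega,L,y,x'-\tfrac{y'}2\big)}\,dx'dy',$$ where $\hat G$ is the Green's function of the Itô–Schrödinger equation $d\hat G=\frac{ic_o}{2\omega}\Delta_x\hat G\,dz+\frac{i\omega}{2c_o}\hat G\circ dB(z,x)$, $\hat G(\omega,0,x,y)=\delta(x-y)$ ($\circ$: Stratonovich; $B$ real Brownian field with $\mathbb{E}[B(z,x)B(z',x')]=\min\{z,z'\}C(x-x')$). Its mean $\mathbb{E}[\hat u_{\rm tr}(x;y)]=M_1(L,x,y)$ is characterized by (and may be defined through) $$\partial_zM_1=\frac{ic_o}2\Big(\frac1\omega\Delta_x-\frac1{\tilde\omega}\Delta_y\Big)M_1+\frac1{8c_o^2}\big(2\omega\tilde\omega C(x-y)-(\omega^2+\tilde\omega^2)C(0)\big)M_1,\quad M_1(0,x,y)=e^{-\frac{|x+y|^2}{4r_0^2}-\frac{|x-y|^2}{4\rho_0^2}}$$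 (mild sense in Fourier space, Fourier transform in $L^1$). In the scintillation regime, $C,r_0,\rho_0,L$ are replaced in these definitions by $\varepsilon C,r_0/\varepsilon,\rho_0/\varepsilon,L/\varepsilon$. $K(z)=(2\pi)^4\exp\big(-\frac{\omega_0^2}{4c_o^2}C(0)z\big)$, and $A(z,\xi,\zeta,\Omega)$ is, for fixed $\zeta,\Omega$, the ($L^1(d\xi)$-valued, mild) solution of $$\partial_zA=\frac{ic_o\Omega}{\omega_0^2}|\xi|^2A+\frac{\omega_0^2}{4(2\pi)^2c_o^2}\int_{\mathbb{R}^2}\hat C(k)\big[A(\xi-k)e^{\frac{ic_oz}{\omega_0}k\cdot\zeta}-A(\xi)\big]dk+\frac{\omega_0^2}{4(2\pi)^2c_o^2}K(z)\hat C(\xi)e^{\frac{ic_oz}{\omega_0}\xi\cdot\zeta},\qquad A(z=0)=0.$$ *)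

theory Defs
  imports "HOL-Analysis.Analysis"
begin

type_synonym plane = "real ^ 2"

definition fourier :: "('a::euclidean_space \<Rightarrow> complex) \<Rightarrow> 'a \<Rightarrow> complex" where
  "fourier f k = (LINT x|lborel. f x * exp (- \<i> * of_real (k \<bullet> x)))"

definition inverse_fourier :: "('a::euclidean_space \<Rightarrow> complex) \<Rightarrow> 'a \<Rightarrow> complex" where
  "inverse_fourier g x =
     (1 / (2 * pi) ^ DIM('a)) * (LINT k|lborel. g k * exp (\<i> * of_real (k \<bullet> x)))"

abbreviation fourier_real :: "('a::euclidean_space \<Rightarrow> real) \<Rightarrow> 'a \<Rightarrow> complex" where
  "fourier_real C \<equiv> fourier (\<lambda>x. complex_of_real (C x))"

(* Continuous curves from [0, infinity) to L^1.  The values f z are functions rather than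
   equivalence classes; joint measurability fixes representatives for which the integral
   in the evolution variable can be taken pointwise (every continuous L^1-valued curve has
   such a representative). *)
definition continuous_L1_curve :: "(real \<Rightarrow> 'a::euclidean_space \<Rightarrow> complex) \<Rightarrow> bool" where
  "continuous_L1_curve f \<longleftrightarrow>
     set_borel_measurable borel ({0..} \<times> UNIV) (\<lambda>(z, \<xi>). f z \<xi>) \<and>
     (\<forall>z\<ge>0. integrable lborel (f z)) \<and>
     (\<forall>z\<ge>0. ((\<lambda>w. LINT \<xi>|lborel. norm (f w \<xi> - f z \<xi>)) \<longlongrightarrow> 0) (at z within {0..}))"

(* L^1-valued mild solution on [0, infinity) of
     d/dz f(z) = p f(z) + N(z, f(z)),   f(0) = f0,
   where p is a multiplication operator (possibly unbounded), by Duhamel's formula. *)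
definition mild_solution ::
  "('a::euclidean_space \<Rightarrow> complex) \<Rightarrow> (real \<Rightarrow> ('a \<Rightarrow> complex) \<Rightarrow> 'a \<Rightarrow> complex) \<Rightarrow>
   ('a \<Rightarrow> complex) \<Rightarrow> (real \<Rightarrow> 'a \<Rightarrow> complex) \<Rightarrow> bool" where
  "mild_solution p N f0 f \<longleftrightarrow>
     continuous_L1_curve f \<and>
     (\<forall>z\<ge>0. AE \<xi> in lborel.
        f z \<xi> = exp (of_real z * p \<xi>) * f0 \<xi>
          + (LINT s:{0..z}|lborel. exp (of_real (z - s) * p \<xi>) * N s (f s) \<xi>))"

definition initial_mean :: "real \<Rightarrow> real \<Rightarrow> plane \<times> plane \<Rightarrow> real" where
  "initial_mean r\<^sub>0 \<rho>\<^sub>0 = (\<lambda>(x, y).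
     exp (- (norm (x + y))\<^sup>2 / (4 * r\<^sub>0\<^sup>2) - (norm (x - y))\<^sup>2 / (4 * \<rho>\<^sub>0\<^sup>2)))"

(* The equation
     d/dz M = (i c / 2) (Laplacian_x / w - Laplacian_y / w') M
              + (2 w w' C(x - y) - (w^2 + w'^2) C(0)) M / (8 c^2)
   for the mean of the refocused field, in the variables (k, l) dual to (x, y): the symbols
   of the two Laplacians are -|k|^2 and -|l|^2, and multiplication by
   C(x - y) = (2 pi)^-2 \<integral> C^(q) exp(i q . (x - y)) dq shifts (k, l) by (q, -q). *)
definition mean_symbol :: "real \<Rightarrow> real \<Rightarrow> real \<Rightarrow> plane \<times> plane \<Rightarrow> complex" where
  "mean_symbol c\<^sub>o \<omega> \<omega>' = (\<lambda>(k, l).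
     \<i> * of_real (c\<^sub>o / 2 * (1 / \<omega> * (- (norm k)\<^sup>2) - 1 / \<omega>' * (- (norm l)\<^sup>2))))"

definition mean_scattering ::
  "real \<Rightarrow> real \<Rightarrow> real \<Rightarrow> (plane \<Rightarrow> real) \<Rightarrow>
   (plane \<times> plane \<Rightarrow> complex) \<Rightarrow> plane \<times> plane \<Rightarrow> complex" where
  "mean_scattering c\<^sub>o \<omega> \<omega>' C f = (\<lambda>(k, l).
     of_real (1 / (8 * c\<^sub>o\<^sup>2)) *
       (of_real (2 * \<omega> * \<omega>') * (of_real (1 / (2 * pi)\<^sup>2)
          * (LINT q|lborel. fourier_real C q * f (k - q, l + q)))
        - of_real ((\<omega>\<^sup>2 + \<omega>'\<^sup>2) * C 0) * f (k, l)))"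

(* M z x y is the mean of the time-reversed field u_tr(x; y) at distance z, for the
   frequencies w, w', the radii r0, rho0 and a medium with covariance function C. *)
definition mean_refocused_field ::
  "real \<Rightarrow> real \<Rightarrow> real \<Rightarrow> real \<Rightarrow> real \<Rightarrow> (plane \<Rightarrow> real) \<Rightarrow>
   (real \<Rightarrow> plane \<Rightarrow> plane \<Rightarrow> complex) \<Rightarrow> bool" where
  "mean_refocused_field c\<^sub>o \<omega> \<omega>' r\<^sub>0 \<rho>\<^sub>0 C M \<longleftrightarrow>
     (\<exists>Mh. mild_solution (mean_symbol c\<^sub>o \<omega> \<omega>') (\<lambda>s. mean_scattering c\<^sub>o \<omega> \<omega>' C)
             (fourier_real (initial_mean r\<^sub>0 \<rho>\<^sub>0)) Mh \<and>
           (\<forall>z\<ge>0. \<forall>x y. M z x y = inverse_fourier (Mh z) (x, y)))"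

definition K :: "real \<Rightarrow> real \<Rightarrow> (plane \<Rightarrow> real) \<Rightarrow> real \<Rightarrow> real" where
  "K c\<^sub>o \<omega>\<^sub>0 C z = (2 * pi) ^ 4 * exp (- (\<omega>\<^sub>0\<^sup>2 / (4 * c\<^sub>o\<^sup>2)) * C 0 * z)"

definition A_symbol :: "real \<Rightarrow> real \<Rightarrow> real \<Rightarrow> plane \<Rightarrow> complex" where
  "A_symbol c\<^sub>o \<omega>\<^sub>0 \<Omega> \<xi> = \<i> * of_real (c\<^sub>o * \<Omega> / \<omega>\<^sub>0\<^sup>2 * (norm \<xi>)\<^sup>2)"

definition A_scattering ::
  "real \<Rightarrow> real \<Rightarrow> (plane \<Rightarrow> real) \<Rightarrow> plane \<Rightarrow>
   real \<Rightarrow> (plane \<Rightarrow> complex) \<Rightarrow> plane \<Rightarrow> complex" where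
  "A_scattering c\<^sub>o \<omega>\<^sub>0 C \<zeta> z f \<xi> =
     of_real (\<omega>\<^sub>0\<^sup>2 / (4 * (2 * pi)\<^sup>2 * c\<^sub>o\<^sup>2)) *
       (LINT k|lborel. fourier_real C k *
          (f (\<xi> - k) * exp (\<i> * of_real (c\<^sub>o * z / \<omega>\<^sub>0 * (k \<bullet> \<zeta>))) - f \<xi>))
     + of_real (\<omega>\<^sub>0\<^sup>2 / (4 * (2 * pi)\<^sup>2 * c\<^sub>o\<^sup>2) * K c\<^sub>o \<omega>\<^sub>0 C z) *
         fourier_real C \<xi> * exp (\<i> * of_real (c\<^sub>o * z / \<omega>\<^sub>0 * (\<xi> \<bullet> \<zeta>)))"

definition A_solution ::
  "real \<Rightarrow> real \<Rightarrow> (plane \<Rightarrow> real) \<Rightarrow> plane \<Rightarrow> real \<Rightarrow> (real \<Rightarrow> plane \<Rightarrow> complex) \<Rightarrow> bool" where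
  "A_solution c\<^sub>o \<omega>\<^sub>0 C \<zeta> \<Omega> a \<longleftrightarrow>
     mild_solution (A_symbol c\<^sub>o \<omega>\<^sub>0 \<Omega>) (A_scattering c\<^sub>o \<omega>\<^sub>0 C \<zeta>) (\<lambda>\<xi>. 0) a"

end

(* The mean field, the function A and the limit are all compared through one adjoint object.
   Let w solve the backward (adjoint) scattering equation with the plane wave exp(i x.xi) as
   data.  Duhamel's formula and Fubini give <f(L), w(0)> = <f(0), w(L)> + <sources, w> for every
   mild solution f, so no uniqueness or existence theory for f is needed.  In the variables
   xi = k, zeta = (k + l)/eps the total wave number is conserved, and after rescaling distance by
   eps the adjoint equation of the mean field depends continuously on eps down to eps = 0.
   Constructing w as a fixed point jointly in (t, eps, zeta, xi) makes it bounded and continuous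
   in eps; the initial datum is an explicit Gaussian concentrating at xi = 0, and dominated
   convergence yields the limit Gaussian average of w(L, xi = 0) at eps = 0.  The equation for A,
   conjugated by exp(-i z c xi.zeta / omega), has the same adjoint, its source being the scattering
   of the ballistic delta component, so the integral of A is w(L, 0) minus exp(-kappa L). *)

theory Submission
  imports Defs "HOL-Probability.Characteristic_Functions"
begin

section \<open>Affine substitutions and Gaussian integrals\<close>

text \<open>The obstacle is that the limit does not live in L^1. In the variables (xi, zeta) the
  transformed initial datum has width of order eps in xi and of order 1 in zeta, so the transform of
  the mean tends to a delta at xi = 0 carrying the factor exp(- kappa z), plus a diffuse part; only
  the latter is an L^1 curve. Comparing solutions in L^1 norm therefore cannot work, whereas a
  bounded continuous test function sees both parts at once. Continuity in eps can only be pointwise: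
  the symbols grow quadratically, so the phases do not converge uniformly in the wave numbers.
  Pointwise convergence with a uniform bound is just what dominated convergence against the Gaussian
  asks for. The rescaled equation has a limit because every coefficient carries a factor eps to
  balance the distance L / eps: the covariance by assumption, and the symbol because k + l = eps
  zeta and the frequencies differ by 2 eps Omega, so that the terms in |k|^2 cancel at leading
  order.\<close>

lemma
  fixes f :: "'a::euclidean_space \<Rightarrow> 'b::{banach, second_countable_topology}" and c :: real
  assumes [measurable]: "f \<in> borel_measurable borel" and c: "c \<noteq> 0"
  shows integral_lborel_affine:
      "(LINT x|lborel. f x) = \<bar>c\<bar> ^ DIM('a) *\<^sub>R (LINT x|lborel. f (t + c *\<^sub>R x))"
    and integrable_lborel_affine_iff:
      "integrable lborel (\<lambda>x. f (t + c *\<^sub>R x)) \<longleftrightarrow> integrable lborel f"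
proof -
  have eq: "lborel = density (distr lborel borel (\<lambda>x. t + c *\<^sub>R x)) (\<lambda>_. ennreal (\<bar>c\<bar> ^ DIM('a)))"
    using lborel_affine[OF c, of t] by simp
  show "(LINT x|lborel. f x) = \<bar>c\<bar> ^ DIM('a) *\<^sub>R (LINT x|lborel. f (t + c *\<^sub>R x))"
    by (subst eq) (simp add: integral_density integral_distr)
  show "integrable lborel (\<lambda>x. f (t + c *\<^sub>R x)) \<longleftrightarrow> integrable lborel f"
    (is "?L = _")
  proof -
    have "integrable lborel f \<longleftrightarrow> integrable lborel (\<lambda>x. \<bar>c\<bar> ^ DIM('a) *\<^sub>R f (t + c *\<^sub>R x))"
      by (subst eq) (simp add: integrable_density integrable_distr_eq)
    also have "\<dots> \<longleftrightarrow> ?L"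
      using integrable_scaleR_right[of "1 / \<bar>c\<bar> ^ DIM('a)" lborel "\<lambda>x. \<bar>c\<bar> ^ DIM('a) *\<^sub>R f (t + c *\<^sub>R x)"] c
      by auto
    finally show ?thesis ..
  qed
qed

text \<open>The Jacobian comes out of Tonelli and two one-variable affine substitutions: for fixed y
  the shift x = u - y, then for fixed u the substitution y = (u - v) / 2, which contributes the
  factor 1 / 2^d.\<close>

lemma distr_sum_difference:
  "distr (lborel :: ('a::euclidean_space \<times> 'a) measure) borel (\<lambda>(x, y). (x + y, x - y))
     = density lborel (\<lambda>_. ennreal (1 / 2 ^ DIM('a)))"
proof (rule measure_eqI)
  fix S :: "('a \<times> 'a) set"
  assume "S \<in> sets (distr (lborel :: ('a \<times> 'a) measure) borel (\<lambda>(x, y). (x + y, x - y)))"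
  then have S[measurable]: "S \<in> sets borel" by simp
  then have [measurable]: "S \<in> sets (borel \<Otimes>\<^sub>M borel)" by (subst borel_prod)
  have [measurable]: "(\<lambda>z::'a \<times> 'a. (fst z + snd z, fst z - snd z)) \<in> borel_measurable borel"
    by (intro borel_measurable_continuous_onI continuous_intros)
  let ?S = "\<lambda>u v. indicator S (u, v) :: ennreal"
  have m[measurable]: "(\<lambda>(u,v). ?S u v) \<in> borel_measurable (borel \<Otimes>\<^sub>M borel)"
    by (simp add: borel_prod case_prod_eta)
  have half: "(\<integral>\<^sup>+y. g y \<partial>lborel) = ennreal (1 / 2 ^ DIM('a)) * (\<integral>\<^sup>+v. g ((u - v) /\<^sub>R 2) \<partial>lborel)"
    if [measurable]: "g \<in> borel_measurable borel" for g :: "'a \<Rightarrow> ennreal" and u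
  proof -
    have eq: "lborel = density (distr lborel borel (\<lambda>x. u /\<^sub>R 2 + (-1/2) *\<^sub>R x))
        (\<lambda>_. ennreal (1 / 2 ^ DIM('a)))"
      using lborel_affine[of "-1/2 :: real" "u /\<^sub>R 2 :: 'a"] by (simp add: power_one_over)
    show ?thesis
      by (subst eq) (simp add: nn_integral_density nn_integral_distr nn_integral_cmult
          scaleR_diff_right)
  qed
  have shift: "(\<integral>\<^sup>+x. g x \<partial>lborel) = (\<integral>\<^sup>+u. g (u - y) \<partial>lborel)"
    if [measurable]: "g \<in> borel_measurable borel" for g :: "'a \<Rightarrow> ennreal" and y
  proof -
    have eq: "lborel = distr lborel borel (\<lambda>x. - y + x)"
      using lborel_affine[of 1 "- y"] by (simp add: density_1)
    show ?thesis by (subst eq) (simp add: nn_integral_distr)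
  qed
  have "emeasure (distr (lborel :: ('a \<times> 'a) measure) borel (\<lambda>(x, y). (x + y, x - y))) S
      = (\<integral>\<^sup>+(x, y). ?S (x + y) (x - y) \<partial>(lborel \<Otimes>\<^sub>M lborel))"
    by (subst nn_integral_indicator[symmetric], simp, subst nn_integral_distr)
       (auto simp: lborel_prod split_def)
  also have "\<dots> = (\<integral>\<^sup>+y. \<integral>\<^sup>+x. ?S (x + y) (x - y) \<partial>lborel \<partial>lborel)"
    by (subst lborel_pair.nn_integral_snd[symmetric]) auto
  also have "\<dots> = (\<integral>\<^sup>+y. \<integral>\<^sup>+u. ?S u (u - 2 *\<^sub>R y) \<partial>lborel \<partial>lborel)"
  proof (rule nn_integral_cong)
    fix y :: 'a
    show "(\<integral>\<^sup>+x. ?S (x + y) (x - y) \<partial>lborel) = (\<integral>\<^sup>+u. ?S u (u - 2 *\<^sub>R y) \<partial>lborel)"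
      by (subst shift[of _ y]) (simp_all add: scaleR_2 algebra_simps)
  qed
  also have "\<dots> = (\<integral>\<^sup>+u. \<integral>\<^sup>+y. ?S u (u - 2 *\<^sub>R y) \<partial>lborel \<partial>lborel)"
    by (rule lborel_pair.Fubini'[symmetric]) auto
  also have "\<dots> = (\<integral>\<^sup>+u. ennreal (1 / 2 ^ DIM('a)) * (\<integral>\<^sup>+v. ?S u v \<partial>lborel) \<partial>lborel)"
  proof (rule nn_integral_cong)
    fix u :: 'a
    show "(\<integral>\<^sup>+y. ?S u (u - 2 *\<^sub>R y) \<partial>lborel) = ennreal (1 / 2 ^ DIM('a)) * (\<integral>\<^sup>+v. ?S u v \<partial>lborel)"
      by (subst half[of _ u]) simp_all
  qed
  also have "\<dots> = ennreal (1 / 2 ^ DIM('a)) * (\<integral>\<^sup>+u. \<integral>\<^sup>+v. ?S u v \<partial>lborel \<partial>lborel)"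
    by (rule nn_integral_cmult) simp
  also have "(\<integral>\<^sup>+u. \<integral>\<^sup>+v. ?S u v \<partial>lborel \<partial>lborel) = (\<integral>\<^sup>+p. indicator S p \<partial>lborel)"
    by (subst lborel_prod[symmetric], subst lborel.nn_integral_fst[symmetric])
       (auto simp: borel_prod)
  also have "ennreal (1 / 2 ^ DIM('a)) * \<dots> = emeasure (density lborel (\<lambda>_. ennreal (1 / 2 ^ DIM('a)))) S"
    by (simp add: emeasure_density nn_integral_cmult)
  finally show "emeasure (distr (lborel :: ('a \<times> 'a) measure) borel (\<lambda>(x, y). (x + y, x - y))) S
      = emeasure (density lborel (\<lambda>_. ennreal (1 / 2 ^ DIM('a)))) S" .
qed simp

lemma
  fixes f :: "'a::euclidean_space \<times> 'a \<Rightarrow> 'b::{banach, second_countable_topology}"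
  assumes [measurable]: "f \<in> borel_measurable borel"
  shows integral_sum_difference: "(LINT z|lborel. f (fst z + snd z, fst z - snd z))
      = (1 / 2 ^ DIM('a)) *\<^sub>R (LINT z|lborel. f z)"
    and integrable_sum_difference_iff: "integrable lborel (\<lambda>z. f (fst z + snd z, fst z - snd z))
      \<longleftrightarrow> integrable lborel f"
proof -
  have d: "distr (lborel :: ('a \<times> 'a) measure) borel (\<lambda>z. (fst z + snd z, fst z - snd z))
     = density lborel (\<lambda>_. ennreal (1 / 2 ^ DIM('a)))"
    using distr_sum_difference by (simp add: split_def)
  have [measurable]: "(\<lambda>z::'a \<times> 'a. (fst z + snd z, fst z - snd z)) \<in> borel_measurable borel"
    by (intro borel_measurable_continuous_onI continuous_intros)
  show "(LINT z|lborel. f (fst z + snd z, fst z - snd z)) = (1 / 2 ^ DIM('a)) *\<^sub>R (LINT z|lborel. f z)"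
    using arg_cong[OF d, of "\<lambda>M. integral\<^sup>L M f"] by (simp add: integral_distr integral_density)
  show "integrable lborel (\<lambda>z. f (fst z + snd z, fst z - snd z)) \<longleftrightarrow> integrable lborel f"
    (is "?L \<longleftrightarrow> _")
  proof -
    have "?L \<longleftrightarrow> integrable lborel (\<lambda>z. (1 / 2 ^ DIM('a)) *\<^sub>R f z)"
      using arg_cong[OF d, of "\<lambda>M. integrable M f"] by (simp add: integrable_distr_eq integrable_density)
    also have "\<dots> \<longleftrightarrow> integrable lborel f"
      using integrable_scaleR_right[of "2 ^ DIM('a)" lborel "\<lambda>z. (1 / 2 ^ DIM('a)) *\<^sub>R f z"] by auto
    finally show ?thesis .
  qed
qed

section \<open>Gaussian integrals with a phase, in one and in several dimensions\<close>

lemma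
  fixes f :: "'a::euclidean_space \<Rightarrow> real \<Rightarrow> complex"
  assumes f: "\<And>b. b \<in> Basis \<Longrightarrow> integrable lborel (f b)"
  shows integral_lborel_prod: "(LINT x|lborel. (\<Prod>b\<in>Basis. f b (x \<bullet> b))) = (\<Prod>b\<in>Basis. (LINT s|lborel. f b s))"
    and integrable_lborel_prod: "integrable lborel (\<lambda>x. \<Prod>b\<in>Basis. f b (x \<bullet> b))"
proof -
  interpret product_sigma_finite "\<lambda>b::'a. lborel :: real measure" ..
  have [measurable]: "b \<in> Basis \<Longrightarrow> f b \<in> borel_measurable borel" for b
    using borel_measurable_integrable[OF f] by simp
  have m: "(\<lambda>x. \<Prod>b\<in>Basis. f b (x \<bullet> b)) \<in> borel_measurable borel" by measurable
  show "(LINT x|lborel. (\<Prod>b\<in>Basis. f b (x \<bullet> b))) = (\<Prod>b\<in>Basis. (LINT s|lborel. f b s))"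
    by (subst lborel_eq, subst integral_distr) (auto simp: product_integral_prod f)
  show "integrable lborel (\<lambda>x. \<Prod>b\<in>Basis. f b (x \<bullet> b))"
    by (subst lborel_eq, subst integrable_distr_eq) (auto simp: product_integrable_prod f)
qed

text \<open>Rescaling by 1 / sqrt (2 a) turns the Gaussian into sqrt (2 pi) times the standard
  normal density, whose characteristic function is known.\<close>

lemma
  fixes a k :: real
  assumes a: "0 < a"
  shows integral_gaussian_real: "(LINT x|lborel. complex_of_real (exp (- a * x\<^sup>2)) * exp (\<i> * of_real (k * x)))
      = of_real (sqrt (pi / a) * exp (- k\<^sup>2 / (4 * a)))"
    and integrable_gaussian_real: "integrable lborel
      (\<lambda>x. complex_of_real (exp (- a * x\<^sup>2)) * exp (\<i> * of_real (k * x)))"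
proof -
  define c where "c = 1 / sqrt (2 * a)"
  have c: "c > 0" "c\<^sup>2 = 1 / (2 * a)" using a by (auto simp: c_def power_divide)
  let ?f = "\<lambda>x. complex_of_real (exp (- a * x\<^sup>2)) * exp (\<i> * of_real (k * x))"
  let ?g = "\<lambda>x. complex_of_real (std_normal_density x) * iexp (k * c * x)"
  have eq: "?f (0 + c *\<^sub>R x) = of_real (sqrt (2 * pi)) * ?g x" for x
    using a by (simp add: std_normal_density_def power_mult_distrib c(2) mult_ac)
  have "integrable lborel ?g"
    by (rule Bochner_Integration.integrable_bound[OF integrable_normal_density[of 1 0]])
       (auto simp: norm_mult)
  then have "integrable lborel (\<lambda>x. ?f (0 + c *\<^sub>R x))" unfolding eq by simp
  then show "integrable lborel ?f"
    using c by (subst (asm) integrable_lborel_affine_iff) auto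
  have "(LINT x|lborel. ?g x) = of_real (exp (- (k * c)\<^sup>2 / 2))"
    using fun_cong[OF char_std_normal_distribution, of "k * c"]
    by (simp add: char_def integral_density scaleR_conv_of_real)
  then have "(LINT x|lborel. ?f x) = of_real (c * sqrt (2 * pi) * exp (- (k * c)\<^sup>2 / 2))"
    using c by (subst integral_lborel_affine[where c = c and t = 0], simp, simp, unfold eq)
       (simp add: scaleR_conv_of_real)
  also have "c * sqrt (2 * pi) * exp (- (k * c)\<^sup>2 / 2) = sqrt (pi / a) * exp (- k\<^sup>2 / (4 * a))"
    using a by (simp add: power_mult_distrib c(2) c_def real_sqrt_divide real_sqrt_mult power_divide)
  finally show "(LINT x|lborel. ?f x) = of_real (sqrt (pi / a) * exp (- k\<^sup>2 / (4 * a)))" .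
qed

lemma
  fixes k :: "'a::euclidean_space"
  assumes a: "0 < a"
  shows integral_gaussian: "(LINT x|lborel. complex_of_real (exp (- a * (norm x)\<^sup>2)) * exp (\<i> * of_real (k \<bullet> x)))
      = of_real (sqrt (pi / a) ^ DIM('a) * exp (- (norm k)\<^sup>2 / (4 * a)))"
    and integrable_gaussian: "integrable lborel
      (\<lambda>x. complex_of_real (exp (- a * (norm x)\<^sup>2)) * exp (\<i> * of_real (k \<bullet> x)))"
proof -
  let ?f = "\<lambda>b s. complex_of_real (exp (- a * s\<^sup>2)) * exp (\<i> * of_real ((k \<bullet> b) * s))"
  have nsq: "(norm x)\<^sup>2 = (\<Sum>b\<in>Basis. (x \<bullet> b)\<^sup>2)" for x :: 'a
    unfolding power2_norm_eq_inner by (subst euclidean_inner) (simp add: power2_eq_square)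
  have eq: "complex_of_real (exp (- a * (norm x)\<^sup>2)) * exp (\<i> * of_real (k \<bullet> x))
      = (\<Prod>b\<in>Basis. ?f b (x \<bullet> b))" for x
    by (simp add: nsq prod.distrib euclidean_inner[of k x] exp_sum[symmetric] sum_distrib_left
        of_real_exp[symmetric] del: of_real_exp flip: of_real_prod sum_negf)
  show "integrable lborel
      (\<lambda>x. complex_of_real (exp (- a * (norm x)\<^sup>2)) * exp (\<i> * of_real (k \<bullet> x)))"
    unfolding eq by (rule integrable_lborel_prod) (rule integrable_gaussian_real[OF a])
  have "(\<Prod>b\<in>Basis. (LINT s|lborel. ?f b s))
      = (\<Prod>b\<in>(Basis :: 'a set). of_real (sqrt (pi / a) * exp (- (k \<bullet> b)\<^sup>2 / (4 * a))))"
    by (intro prod.cong refl integral_gaussian_real a)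
  also have "\<dots> = of_real (sqrt (pi / a) ^ DIM('a) * exp (- (norm k)\<^sup>2 / (4 * a)))"
    by (simp add: nsq exp_sum prod.distrib sum_divide_distrib flip: of_real_prod sum_negf)
  finally show "(LINT x|lborel. complex_of_real (exp (- a * (norm x)\<^sup>2)) * exp (\<i> * of_real (k \<bullet> x)))
      = of_real (sqrt (pi / a) ^ DIM('a) * exp (- (norm k)\<^sup>2 / (4 * a)))"
    unfolding eq integral_lborel_prod[of ?f, OF integrable_gaussian_real[OF a]] .
qed

section \<open>The adjoint propagator\<close>

text \<open>Duhamel integrals are written over the fixed interval {0..1}, with the evolution time
  moved into the integrand. Joint continuity of the integrand then gives continuity in time and in
  all other parameters at once.\<close>

lemma continuous_on_unit_interval_integral:
  fixes k :: "'y::topological_space \<Rightarrow> real \<Rightarrow> complex"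
  assumes k: "continuous_on UNIV (case_prod k)"
  shows "continuous_on UNIV (\<lambda>y. LINT s:{0..1}|lborel. k y s)"
    and "set_integrable lborel {0..1} (k y)"
proof -
  have ky: "continuous_on S (k y)" for y S
  proof -
    have "continuous_on S (\<lambda>s. case_prod k (y, s))"
      by (rule continuous_on_compose2[OF k]) (auto intro!: continuous_intros)
    then show ?thesis by simp
  qed
  show int: "set_integrable lborel {0..1} (k y)" for y
    by (rule borel_integrable_atLeastAtMost'[OF ky])
  have "continuous_on UNIV (\<lambda>y. integral (cbox 0 1) (k y))"
    by (rule integral_continuous_on_param) (use continuous_on_subset[OF k] in \<open>auto simp: split_def\<close>)
  then show "continuous_on UNIV (\<lambda>y. LINT s:{0..1}|lborel. k y s)"
    using set_borel_integral_eq_integral(2)[OF int] by simp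
qed

text \<open>The damping exp(- \<mu> (\<tau> - r)), rescaled by r = \<tau> s, has total mass at most
  1 / \<mu> whatever the length \<tau>. This is the gain that makes the Duhamel map a contraction
  for all times together.\<close>

lemma kernel_integral_le:
  fixes \<tau> \<mu> :: real
  assumes "0 < \<mu>"
  shows "(LINT s:{0..1}|lborel. \<tau> * exp (- (\<tau> * (1 - s) * \<mu>))) \<le> 1 / \<mu>"
proof -
  let ?F = "\<lambda>s. exp (- (\<tau> * (1 - s) * \<mu>)) / \<mu>"
  have "(LINT s|lborel. \<tau> * exp (- (\<tau> * (1 - s) * \<mu>)) * indicator {0..1} s) = ?F 1 - ?F 0"
    by (rule integral_FTC_Icc_real) (use assms in \<open>auto intro!: derivative_eq_intros continuous_intros\<close>)
  also have "\<dots> \<le> 1 / \<mu>" using assms by simp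
  also have "(LINT s|lborel. \<tau> * exp (- (\<tau> * (1 - s) * \<mu>)) * indicator {0..1} s)
      = (LINT s:{0..1}|lborel. \<tau> * exp (- (\<tau> * (1 - s) * \<mu>)))"
    unfolding set_lebesgue_integral_def by (rule Bochner_Integration.integral_cong) simp_all
  finally show ?thesis .
qed

text \<open>Transpose, for the bilinear pairing without conjugation, of the operator sending f to a
  times the integral of h q * f (\<xi> - J q), minus \<kappa> f; transposition turns - J q into + J
  q. The shift J is a parameter because q moves the single variable \<xi> in one equation and (k, l)
  by (q, - q) in the other.\<close>

definition adjoint_scattering ::
  "complex \<Rightarrow> complex \<Rightarrow> ('b::euclidean_space \<Rightarrow> complex) \<Rightarrow> ('b \<Rightarrow> 'a::euclidean_space) \<Rightarrow>
   ('a \<Rightarrow> complex) \<Rightarrow> 'a \<Rightarrow> complex" where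
  "adjoint_scattering a \<kappa> h J u \<xi> = a * (LINT q|lborel. h q * u (\<xi> + J q)) - \<kappa> * u \<xi>"

section \<open>Boundedness, continuity and fixed point of the adjoint evolution\<close>

context
  fixes h :: "'b::euclidean_space \<Rightarrow> complex" and J :: "'b \<Rightarrow> 'a::euclidean_space"
  assumes h: "integrable lborel h" and J: "continuous_on UNIV J"
begin

lemma integrable_mult_shift:
  assumes u: "continuous_on UNIV u" and B: "\<And>\<xi>. norm (u \<xi>) \<le> B"
  shows "integrable lborel (\<lambda>q. h q * u (\<xi> + J q))"
proof -
  have [measurable]: "(\<lambda>q. u (\<xi> + J q)) \<in> borel_measurable borel"
    by (intro borel_measurable_continuous_onI continuous_on_compose2[OF u] continuous_intros J) auto
  have [measurable]: "h \<in> borel_measurable borel" using h by simp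
  show ?thesis
  proof (rule Bochner_Integration.integrable_bound)
    show "integrable lborel (\<lambda>q. B * norm (h q))" using h by simp
    show "AE q in lborel. norm (h q * u (\<xi> + J q)) \<le> norm (B * norm (h q))"
    proof (intro always_eventually allI)
      fix q
      have "norm (h q * u (\<xi> + J q)) \<le> norm (h q) * B"
        unfolding norm_mult by (intro mult_left_mono B norm_ge_zero)
      also have "\<dots> \<le> norm (B * norm (h q))" by (simp add: mult.commute)
      finally show "norm (h q * u (\<xi> + J q)) \<le> norm (B * norm (h q))" .
    qed
  qed measurable
qed

lemma norm_adjoint_scattering_le:
  assumes u: "continuous_on UNIV u" and B: "\<And>\<xi>. norm (u \<xi>) \<le> B"
    and "norm a \<le> A" "norm \<kappa> \<le> A"
  shows "norm (adjoint_scattering a \<kappa> h J u \<xi>) \<le> A * ((LINT q|lborel. norm (h q)) + 1) * B"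
proof -
  have A0: "0 \<le> A" using assms(3) norm_ge_zero order_trans by blast
  have "norm (LINT q|lborel. h q * u (\<xi> + J q)) \<le> (LINT q|lborel. norm (h q * u (\<xi> + J q)))"
    by (rule integral_norm_bound)
  also have "\<dots> \<le> (LINT q|lborel. norm (h q) * B)"
    using integrable_norm[OF integrable_mult_shift[OF u B]] h
    by (intro integral_mono) (auto simp: norm_mult intro!: mult_left_mono B)
  finally have I: "norm (LINT q|lborel. h q * u (\<xi> + J q)) \<le> (LINT q|lborel. norm (h q)) * B" by simp
  have "norm (adjoint_scattering a \<kappa> h J u \<xi>) \<le> norm a * norm (LINT q|lborel. h q * u (\<xi> + J q)) + norm \<kappa> * norm (u \<xi>)"
    using norm_triangle_ineq4[of "a * (LINT q|lborel. h q * u (\<xi> + J q))" "\<kappa> * u \<xi>"]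
    unfolding adjoint_scattering_def norm_mult .
  also have "\<dots> \<le> A * ((LINT q|lborel. norm (h q)) * B) + A * B"
    using assms(3,4) I B A0 by (intro add_mono mult_mono) auto
  finally show ?thesis by (simp add: algebra_simps)
qed

lemma adjoint_scattering_diff:
  assumes "continuous_on UNIV u" "\<And>\<xi>. norm (u \<xi>) \<le> B" "continuous_on UNIV v" "\<And>\<xi>. norm (v \<xi>) \<le> B'"
  shows "adjoint_scattering a \<kappa> h J u \<xi> - adjoint_scattering a \<kappa> h J v \<xi> = adjoint_scattering a \<kappa> h J (\<lambda>\<eta>. u \<eta> - v \<eta>) \<xi>"
proof -
  have "(LINT q|lborel. h q * (u (\<xi> + J q) - v (\<xi> + J q)))
      = (LINT q|lborel. h q * u (\<xi> + J q)) - (LINT q|lborel. h q * v (\<xi> + J q))"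
    unfolding right_diff_distrib
    by (rule Bochner_Integration.integral_diff)
       (rule integrable_mult_shift[OF assms(1,2)] integrable_mult_shift[OF assms(3,4)])+
  then show ?thesis by (simp add: adjoint_scattering_def right_diff_distrib)
qed

text \<open>In a metric space sequences suffice, and B * norm (h q) dominates the shifted
  integrands. Time and all parameters sit together in the first component, so one dominated
  convergence treats them jointly.\<close>

lemma continuous_adjoint_scattering:
  fixes g :: "'x::metric_space \<times> 'a \<Rightarrow> complex"
  assumes g: "continuous_on UNIV g" and B: "\<And>y. norm (g y) \<le> B"
    and a: "continuous_on UNIV a" and \<kappa>: "continuous_on UNIV \<kappa>"
  shows "continuous_on UNIV (\<lambda>(x, \<xi>). adjoint_scattering (a x) (\<kappa> x) h J (\<lambda>\<eta>. g (x, \<eta>)) \<xi>)"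
proof -
  have "continuous_on UNIV (\<lambda>y. LINT q|lborel. h q * g (fst y, snd y + J q))"
    unfolding continuous_on_eq_continuous_at[OF open_UNIV]
  proof (intro ballI)
    fix y :: "'x \<times> 'a"
    show "isCont (\<lambda>y. LINT q|lborel. h q * g (fst y, snd y + J q)) y"
      unfolding continuous_at_sequentially comp_def
    proof (intro allI impI)
      fix Y :: "nat \<Rightarrow> 'x \<times> 'a" assume Y: "Y \<longlonglongrightarrow> y"
      have [measurable]: "h \<in> borel_measurable borel" using h by simp
      have m[measurable]: "(\<lambda>q. g (fst y, snd y + J q)) \<in> borel_measurable borel" for y
        by (intro borel_measurable_continuous_onI continuous_on_compose2[OF g] continuous_intros J) auto
      show "(\<lambda>n. LINT q|lborel. h q * g (fst (Y n), snd (Y n) + J q)) \<longlonglongrightarrow> (LINT q|lborel. h q * g (fst y, snd y + J q))"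
      proof (rule integral_dominated_convergence)
        show "integrable lborel (\<lambda>q. norm (h q) * B)" using h by simp
        show "AE q in lborel. (\<lambda>n. h q * g (fst (Y n), snd (Y n) + J q)) \<longlonglongrightarrow> h q * g (fst y, snd y + J q)"
        proof (intro always_eventually allI tendsto_mult tendsto_const)
          fix q
          show "(\<lambda>n. g (fst (Y n), snd (Y n) + J q)) \<longlonglongrightarrow> g (fst y, snd y + J q)"
            by (rule isCont_tendsto_compose[of _ g])
               (use g continuous_on_eq_continuous_at[OF open_UNIV] Y in \<open>auto intro!: tendsto_intros\<close>)
        qed
        show "AE q in lborel. norm (h q * g (fst (Y n), snd (Y n) + J q)) \<le> norm (h q) * B" for n
          by (auto simp: norm_mult intro!: mult_left_mono B)
      qed measurable
    qed
  qed
  then show ?thesis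
    unfolding adjoint_scattering_def split_def
    by (intro continuous_intros continuous_on_compose2[OF a] continuous_on_compose2[OF \<kappa>]
        continuous_on_compose2[OF g]) auto
qed

text \<open>
  The fixed point is taken for \<open>exp (- \<mu> t) w\<close>: for large \<open>\<mu>\<close> this makes the Duhamel map a
  contraction on all of \<open>t \<ge> 0\<close>.  Taking it among functions of the parameter as well gives
  continuity in the parameter for free.
\<close>

lemma dual_propagator_exists:
  fixes P :: "'p::metric_space \<Rightarrow> 'a \<Rightarrow> real" and a \<kappa> :: "'p \<Rightarrow> complex" and \<phi> :: "'a \<Rightarrow> complex"
  assumes P: "continuous_on UNIV (case_prod P)" and \<phi>: "continuous_on UNIV \<phi>" and \<phi>1: "\<And>\<xi>. norm (\<phi> \<xi>) \<le> 1"
    and a: "continuous_on UNIV a" "\<And>\<theta>. norm (a \<theta>) \<le> A" and \<kappa>: "continuous_on UNIV \<kappa>" "\<And>\<theta>. norm (\<kappa> \<theta>) \<le> A"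
  obtains w :: "(real \<times> 'p) \<times> 'a \<Rightarrow> complex" where "continuous_on UNIV w"
    and "\<And>T. \<exists>B. \<forall>t\<in>{0..T}. \<forall>\<theta> \<xi>. norm (w ((t, \<theta>), \<xi>)) \<le> B"
    and "\<And>t \<theta> \<xi>. 0 \<le> t \<Longrightarrow> w ((t, \<theta>), \<xi>) = exp (\<i> * of_real (t * P \<theta> \<xi>)) * \<phi> \<xi>
       + (LINT s:{0..1}|lborel. of_real t * exp (\<i> * of_real (t * (1 - s) * P \<theta> \<xi>)) *
            adjoint_scattering (a \<theta>) (\<kappa> \<theta>) h J (\<lambda>\<eta>. w ((t * s, \<theta>), \<eta>)) \<xi>)"
proof -
  have A0: "0 \<le> A" using a(2) norm_ge_zero order_trans by blast
  define M0 where "M0 = A * ((LINT q|lborel. norm (h q)) + 1)"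
  have M0: "0 \<le> M0" using A0 by (simp add: M0_def)
  \<comment> \<open>\<open>M0\<close> bounds the operator norm of the scattering term, so with this
    rate the contraction constant \<open>M0 / \<mu>\<close> is at most 1/2; the summand 1 keeps the
    rate positive.\<close>
  define \<mu> where "\<mu> = 2 * M0 + 1"
  have \<mu>: "0 < \<mu>" "M0 / \<mu> \<le> 1/2" using M0 by (auto simp: \<mu>_def field_simps)
  define N where "N v y = adjoint_scattering (a (snd (fst y))) (\<kappa> (snd (fst y))) h J (\<lambda>\<eta>. v (fst y, \<eta>)) (snd y)"
    for v :: "(real \<times> 'p) \<times> 'a \<Rightarrow> complex" and y
  define Q where "Q y = P (snd (fst y)) (snd y)" for y :: "(real \<times> 'p) \<times> 'a"
  \<comment> \<open>Bounded continuous functions live on the whole type, so negative times are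
    folded to 0; there the integrand vanishes and only the datum remains.\<close>
  define \<tau> where "\<tau> y = max 0 (fst (fst y))" for y :: "(real \<times> 'p) \<times> 'a"
  define sh where "sh y s = ((\<tau> y * s, snd (fst y)), snd y)" for y :: "(real \<times> 'p) \<times> 'a" and s
  \<comment> \<open>Duhamel integrand for the weighted unknown, after the substitution r = \<tau> s:
    the weights at the times \<tau> and r combine to the damping exp(- \<mu> (\<tau> - r)).\<close>
  define k where "k g y s = of_real (\<tau> y) * exp (of_real (\<tau> y * (1 - s)) * (\<i> * of_real (Q y) - of_real \<mu>)) * g (sh y s)"
    for g :: "(real \<times> 'p) \<times> 'a \<Rightarrow> complex" and y s
  define D where "D g y = (LINT s:{0..1}|lborel. k g y s)" for g y
  define U where "U y = exp (of_real (\<tau> y) * (\<i> * of_real (Q y) - of_real \<mu>)) * \<phi> (snd y)" for y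
  define S where "S v y = U y + D (N v) y" for v y
  have \<tau>0: "0 \<le> \<tau> y" for y by (simp add: \<tau>_def)

  have Qc: "continuous_on UNIV Q"
  proof -
    have "continuous_on UNIV (\<lambda>y::(real \<times> 'p) \<times> 'a. case_prod P (snd (fst y), snd y))"
      by (rule continuous_on_compose2[OF P]) (auto intro!: continuous_intros)
    then show ?thesis by (simp add: Q_def)
  qed
  have \<tau>c: "continuous_on UNIV \<tau>" unfolding \<tau>_def by (intro continuous_intros)
  have Uc: "continuous_on UNIV U"
    unfolding U_def by (intro continuous_intros Qc \<tau>c continuous_on_compose2[OF \<phi>]) auto
  have kc: "continuous_on UNIV (case_prod (k g))" if g: "continuous_on UNIV g" for g
  proof -
    have c1: "continuous_on UNIV (\<lambda>p. Q (fst p))" "continuous_on UNIV (\<lambda>p. \<tau> (fst p))"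
      by (auto intro!: continuous_on_compose2[OF Qc] continuous_on_compose2[OF \<tau>c] continuous_intros)
    show ?thesis
      unfolding k_def sh_def split_def
      by (intro continuous_intros c1 continuous_on_compose2[OF g]) auto
  qed
  have Dc: "continuous_on UNIV (D g)" if g: "continuous_on UNIV g" for g
    unfolding D_def by (rule continuous_on_unit_interval_integral(1)[OF kc[OF g]])
  have ki: "set_integrable lborel {0..1} (k g y)" if g: "continuous_on UNIV g" for g y
    by (rule continuous_on_unit_interval_integral(2)[OF kc[OF g]])
  have Db: "norm (D g y) \<le> b / \<mu>" if g: "continuous_on UNIV g" and b: "\<And>y. norm (g y) \<le> b" for g b y
  proof -
    have nk: "norm (k g y s) \<le> \<tau> y * exp (- (\<tau> y * (1 - s) * \<mu>)) * b" for s
      using mult_left_mono[OF b[of "sh y s"], of "\<tau> y * exp (- (\<tau> y * (1 - s) * \<mu>))"] \<tau>0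
      by (simp add: k_def norm_mult)
    have b0: "0 \<le> b" using b norm_ge_zero order_trans by blast
    have "norm (D g y) \<le> (LINT s:{0..1}|lborel. \<tau> y * exp (- (\<tau> y * (1 - s) * \<mu>)) * b)"
      unfolding D_def
    proof (rule order_trans[OF set_integral_norm_bound[OF ki[OF g]]], rule set_integral_mono)
      show "set_integrable lborel {0..1} (\<lambda>s. norm (k g y s))" by (rule set_integrable_norm[OF ki[OF g]])
      show "set_integrable lborel {0..1} (\<lambda>s. \<tau> y * exp (- (\<tau> y * (1 - s) * \<mu>)) * b)"
        by (intro borel_integrable_atLeastAtMost' continuous_intros)
    qed (rule nk)
    also have "\<dots> \<le> 1 / \<mu> * b"
      unfolding set_integral_mult_left by (intro mult_right_mono kernel_integral_le \<mu> b0)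
    finally show ?thesis by simp
  qed
  have Nc: "continuous_on UNIV (N v)" if "continuous_on UNIV v" "\<And>y. norm (v y) \<le> b" for v b
  proof -
    have a': "continuous_on UNIV (\<lambda>x. a (snd x))" "continuous_on UNIV (\<lambda>x. \<kappa> (snd x))"
      by (auto intro!: continuous_on_compose2[OF a(1)] continuous_on_compose2[OF \<kappa>(1)] continuous_intros)
    show ?thesis using continuous_adjoint_scattering[OF that a'] by (simp add: N_def split_def)
  qed
  have slice: "continuous_on UNIV (\<lambda>\<eta>. v (x, \<eta>))" if "continuous_on UNIV v"
    for v :: "(real \<times> 'p) \<times> 'a \<Rightarrow> complex" and x
    by (rule continuous_on_compose2[OF that]) (auto intro!: continuous_intros)
  have Nb: "norm (N v y) \<le> M0 * b" if "continuous_on UNIV v" "\<And>y. norm (v y) \<le> b" for v b y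
    unfolding N_def M0_def by (rule norm_adjoint_scattering_le[OF slice]) (use that a \<kappa> in auto)
  have Ub: "norm (U y) \<le> 1" for y
  proof -
    have "norm (U y) = exp (- (\<tau> y * \<mu>)) * norm (\<phi> (snd y))" by (simp add: U_def norm_mult)
    also have "\<dots> \<le> 1 * 1" using \<tau>0[of y] \<mu> by (intro mult_mono \<phi>1) auto
    finally show ?thesis by simp
  qed

  have vb: "\<exists>b. \<forall>y. norm (apply_bcontfun v y) \<le> b" for v :: "((real \<times> 'p) \<times> 'a) \<Rightarrow>\<^sub>C complex"
    using norm_bounded by blast
  have S: "S (apply_bcontfun v) \<in> bcontfun" for v
  proof -
    obtain b where b: "\<And>y. norm (apply_bcontfun v y) \<le> b" using vb by blast
    have "continuous_on UNIV (S (apply_bcontfun v))"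
      unfolding S_def by (intro continuous_intros Uc Dc Nc[OF _ b]) simp
    moreover have "norm (S (apply_bcontfun v) y) \<le> 1 + M0 * b / \<mu>" for y
      unfolding S_def by (rule norm_triangle_le) (intro add_mono Ub Db Nc[OF _ b] Nb[OF _ b]; simp)
    ultimately show ?thesis by (rule bcontfun_normI)
  qed
  define \<Phi> where "\<Phi> v = Bcontfun (S (apply_bcontfun v))" for v
  have \<Phi>: "apply_bcontfun (\<Phi> v) = S (apply_bcontfun v)" for v
    unfolding \<Phi>_def by (rule Bcontfun_inverse[OF S])
  have contr: "dist (\<Phi> u) (\<Phi> v) \<le> 1 / 2 * dist u v" for u v
  proof (rule dist_bound)
    fix y
    let ?u = "apply_bcontfun u" and ?v = "apply_bcontfun v"
    obtain bu bv where b: "\<And>y. norm (?u y) \<le> bu" "\<And>y. norm (?v y) \<le> bv" using vb by meson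
    have dc: "continuous_on UNIV (\<lambda>y. ?u y - ?v y)" by (intro continuous_intros) auto
    have db: "norm (?u y - ?v y) \<le> dist u v" for y
      using dist_bounded[of u y v] by (simp add: dist_norm)
    have Nd: "N ?u y - N ?v y = N (\<lambda>y. ?u y - ?v y) y" for y
      unfolding N_def by (rule adjoint_scattering_diff[OF slice b(1) slice b(2)]) auto
    have "D (N ?u) y - D (N ?v) y = (LINT s:{0..1}|lborel. k (N ?u) y s - k (N ?v) y s)"
      unfolding D_def by (intro set_integral_diff(2)[symmetric] ki Nc[OF _ b(1)] Nc[OF _ b(2)]) auto
    also have "\<dots> = D (N (\<lambda>y. ?u y - ?v y)) y"
      unfolding D_def k_def Nd[symmetric] right_diff_distrib ..
    finally have "dist (\<Phi> u y) (\<Phi> v y) = norm (D (N (\<lambda>y. ?u y - ?v y)) y)"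
      unfolding \<Phi> S_def by (simp add: dist_norm)
    also have "\<dots> \<le> M0 * dist u v / \<mu>" by (intro Db Nc[OF dc db] Nb[OF dc db])
    also have "\<dots> \<le> 1 / 2 * dist u v"
      using mult_right_mono[OF \<mu>(2) zero_le_dist[of u v]] by simp
    finally show "dist (\<Phi> u y) (\<Phi> v y) \<le> 1 / 2 * dist u v" .
  qed
  obtain v where v: "\<Phi> v = v" using banach_fix_type[of "1/2" \<Phi>] contr by auto
  let ?v = "apply_bcontfun v"
  have vfix: "?v y = S ?v y" for y using \<Phi>[of v] v by simp
  obtain b where b: "\<And>y. norm (?v y) \<le> b" using vb by blast
  \<comment> \<open>Undoing the weight leaves a function bounded on each {0..T} only, with a bound
    that may grow like exp(\<mu> T).\<close>
  define w where "w y = exp (of_real (\<mu> * fst (fst y))) * ?v y" for y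
  show ?thesis
  proof (rule that[of w])
    show "continuous_on UNIV w" unfolding w_def by (intro continuous_intros) simp
    show "\<exists>B. \<forall>t\<in>{0..T}. \<forall>\<theta> \<xi>. norm (w ((t, \<theta>), \<xi>)) \<le> B" for T
    proof (intro exI ballI allI)
      fix t \<theta> \<xi> assume "t \<in> {0..T}"
      then have "exp (\<mu> * t) \<le> exp (\<mu> * T)" using \<mu> by simp
      then show "norm (w ((t, \<theta>), \<xi>)) \<le> exp (\<mu> * T) * b"
        using b by (simp add: w_def norm_mult mult_mono)
    qed
    fix t :: real and \<theta> :: 'p and \<xi> :: 'a assume t: "0 \<le> t"
    let ?y = "((t, \<theta>), \<xi>)"
    have tt: "\<tau> ?y = t" using t by (simp add: \<tau>_def)
    \<comment> \<open>Scattering is linear and acts at a fixed time, so the weight at time r factors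
      out.\<close>
    have Nw: "adjoint_scattering (a \<theta>) (\<kappa> \<theta>) h J (\<lambda>\<eta>. w ((r, \<theta>), \<eta>)) \<xi>
       = exp (of_real (\<mu> * r)) * N ?v ((r, \<theta>), \<xi>)" for r
    proof -
      have *: "(LINT q|lborel. h q * (c * g q)) = c * (LINT q|lborel. h q * g q)" for c and g :: "'b \<Rightarrow> complex"
        by (subst integral_mult_right_zero[symmetric]) (simp add: mult_ac)
      show ?thesis unfolding adjoint_scattering_def N_def w_def fst_conv snd_conv * by (simp add: algebra_simps)
    qed
    have "w ?y = exp (of_real (\<mu> * t)) * U ?y + exp (of_real (\<mu> * t)) * D (N ?v) ?y"
      by (simp add: w_def vfix[of ?y] S_def distrib_left)
    also have "exp (of_real (\<mu> * t)) * U ?y = exp (\<i> * of_real (t * P \<theta> \<xi>)) * \<phi> \<xi>"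
      unfolding U_def tt by (simp add: Q_def mult.assoc[symmetric] flip: exp_add) (simp add: algebra_simps)
    also have "exp (of_real (\<mu> * t)) * D (N ?v) ?y = (LINT s:{0..1}|lborel. exp (of_real (\<mu> * t)) * k (N ?v) ?y s)"
      by (simp add: D_def)
    also have "\<dots> = (LINT s:{0..1}|lborel. of_real t * exp (\<i> * of_real (t * (1 - s) * P \<theta> \<xi>)) *
            adjoint_scattering (a \<theta>) (\<kappa> \<theta>) h J (\<lambda>\<eta>. w ((t * s, \<theta>), \<eta>)) \<xi>)"
    proof (intro arg_cong[where f="set_lebesgue_integral lborel {0..1}"] ext)
      fix s
      have "exp (complex_of_real (\<mu> * t)) * exp (of_real (t * (1 - s)) * (\<i> * of_real (P \<theta> \<xi>) - of_real \<mu>))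
          = exp (\<i> * of_real (t * (1 - s) * P \<theta> \<xi>)) * exp (of_real (\<mu> * (t * s)))"
        unfolding exp_add[symmetric] by (rule arg_cong[where f=exp]) (simp add: algebra_simps)
      then show "exp (of_real (\<mu> * t)) * k (N ?v) ?y s = of_real t * exp (\<i> * of_real (t * (1 - s) * P \<theta> \<xi>)) *
            adjoint_scattering (a \<theta>) (\<kappa> \<theta>) h J (\<lambda>\<eta>. w ((t * s, \<theta>), \<eta>)) \<xi>"
        unfolding Nw k_def tt sh_def by (simp add: Q_def mult_ac)
    qed
    finally show "w ?y = exp (\<i> * of_real (t * P \<theta> \<xi>)) * \<phi> \<xi>
       + (LINT s:{0..1}|lborel. of_real t * exp (\<i> * of_real (t * (1 - s) * P \<theta> \<xi>)) *
            adjoint_scattering (a \<theta>) (\<kappa> \<theta>) h J (\<lambda>\<eta>. w ((t * s, \<theta>), \<eta>)) \<xi>)" .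
  qed
qed

end

section \<open>Duality for mild solutions\<close>

lemma integrable_lborel_product_bound:
  fixes F :: "'a::euclidean_space \<times> 'b::euclidean_space \<Rightarrow> complex"
  assumes [measurable]: "F \<in> borel_measurable borel"
    and u: "integrable lborel (u :: 'a \<Rightarrow> real)" and v: "integrable lborel (v :: 'b \<Rightarrow> real)"
    and le: "\<And>x y. norm (F (x, y)) \<le> u x * v y"
  shows "integrable lborel F"
proof -
  have [measurable]: "u \<in> borel_measurable borel" "v \<in> borel_measurable borel"
    using u v by auto
  have m: "(\<lambda>p. u (fst p) * v (snd p)) \<in> borel_measurable (lborel \<Otimes>\<^sub>M lborel)" by measurable
  have "integrable (lborel \<Otimes>\<^sub>M lborel) (\<lambda>p. u (fst p) * v (snd p))"
  proof (rule lborel_pair.Fubini_integrable[OF m])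
    show "integrable lborel (\<lambda>x. LINT y|lborel. norm (u (fst (x, y)) * v (snd (x, y))))"
      using u v by (simp add: abs_mult)
  qed (use v in auto)
  then have "integrable lborel (\<lambda>p. u (fst p) * v (snd p))" by (simp add: lborel_prod)
  then show ?thesis
  proof (rule Bochner_Integration.integrable_bound)
    show "AE p in lborel. norm (F p) \<le> norm (u (fst p) * v (snd p))"
    proof (intro always_eventually allI)
      fix p show "norm (F p) \<le> norm (u (fst p) * v (snd p))"
        using le[of "fst p" "snd p"] abs_ge_self[of "u (fst p) * v (snd p)"] by simp
    qed
  qed simp
qed

lemma
  fixes F :: "'a::euclidean_space \<times> 'b::euclidean_space \<Rightarrow> complex"
  assumes F: "integrable lborel F"
  shows lborel_Fubini: "(LINT y|lborel. LINT x|lborel. F (x, y)) = (LINT x|lborel. LINT y|lborel. F (x, y))"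
    and lborel_integral_fst: "(LINT x|lborel. LINT y|lborel. F (x, y)) = (LINT p|lborel. F p)"
    and lborel_integral_snd: "(LINT y|lborel. LINT x|lborel. F (x, y)) = (LINT p|lborel. F p)"
    and lborel_integrable_fst: "integrable lborel (\<lambda>x. LINT y|lborel. F (x, y))"
    and lborel_integrable_snd: "integrable lborel (\<lambda>y. LINT x|lborel. F (x, y))"
proof -
  have F': "integrable (lborel \<Otimes>\<^sub>M lborel) (case_prod (\<lambda>x y. F (x, y)))"
    using F by (simp add: lborel_prod case_prod_eta)
  show a: "(LINT y|lborel. LINT x|lborel. F (x, y)) = (LINT x|lborel. LINT y|lborel. F (x, y))"
    using lborel_pair.Fubini_integral[OF F'] .
  show b: "(LINT x|lborel. LINT y|lborel. F (x, y)) = (LINT p|lborel. F p)"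
    using lborel_pair.integral_fst[OF F'] by (simp add: lborel_prod case_prod_eta)
  show "(LINT y|lborel. LINT x|lborel. F (x, y)) = (LINT p|lborel. F p)" using a b by simp
  show "integrable lborel (\<lambda>x. LINT y|lborel. F (x, y))"
    using lborel_pair.integrable_fst[OF F'] .
  show "integrable lborel (\<lambda>y. LINT x|lborel. F (x, y))"
    using lborel_pair.integrable_snd[OF F'] .
qed

section \<open>Testing Duhamel's formula against an adjoint solution\<close>

lemma set_integral_reflect:
  fixes F :: "real \<Rightarrow> complex"
  shows "(LINT s:{0..T}|lborel. F (T - s)) = (LINT s:{0..T}|lborel. F s)"
  unfolding set_lebesgue_integral_def
  by (subst (2) lborel_integral_real_affine[of "-1" _ T])
     (auto intro!: Bochner_Integration.integral_cong split: split_indicator)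

text \<open>Duhamel's formula for f at T pairs G s with the free evolution of w 0 over the distance
  T - s; the dual formula replaces that evolution by w (T - s) minus an integral of H. In the
  resulting integral over the triangle s + r \<le> T, integrating over s first lets Duhamel's
  formula at T - r reassemble f (T - r), and \<open>pair\<close> trades G against H. Only the end
  term f0 against w T and the sources survive. Nothing is differentiated in z, so formulas valid
  almost everywhere in \<xi> are enough and P may be unbounded.\<close>

lemma duhamel_duality:
  fixes f G w H :: "real \<Rightarrow> 'a::euclidean_space \<Rightarrow> complex" and P :: "'a \<Rightarrow> real"
    and f0 :: "'a \<Rightarrow> complex" and \<sigma> :: "real \<Rightarrow> complex"
  assumes T: "0 \<le> T" and [measurable]: "P \<in> borel_measurable borel"
    and f0: "integrable lborel f0" and f: "\<And>z. z \<in> {0..T} \<Longrightarrow> integrable lborel (f z)"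
    and G: "integrable lborel (\<lambda>(s, \<xi>). indicator {0..T} s *\<^sub>R G s \<xi>)"
    and w[measurable]: "case_prod w \<in> borel_measurable borel"
    and wB: "\<And>t \<xi>. t \<in> {0..T} \<Longrightarrow> norm (w t \<xi>) \<le> B"
    and H[measurable]: "case_prod H \<in> borel_measurable borel"
    and HB: "\<And>t \<xi>. t \<in> {0..T} \<Longrightarrow> norm (H t \<xi>) \<le> B"
    and duh: "\<And>z. z \<in> {0..T} \<Longrightarrow> AE \<xi> in lborel. f z \<xi> = exp (\<i> * of_real (z * P \<xi>)) * f0 \<xi>
       + (LINT s:{0..z}|lborel. exp (\<i> * of_real ((z - s) * P \<xi>)) * G s \<xi>)"
    and dual: "\<And>t \<xi>. t \<in> {0..T} \<Longrightarrow> w t \<xi> = exp (\<i> * of_real (t * P \<xi>)) * w 0 \<xi>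
       + (LINT r:{0..t}|lborel. exp (\<i> * of_real ((t - r) * P \<xi>)) * H r \<xi>)"
    and pair: "\<And>s. s \<in> {0..T} \<Longrightarrow>
       (LINT \<xi>|lborel. G s \<xi> * w (T - s) \<xi>) = (LINT \<xi>|lborel. f s \<xi> * H (T - s) \<xi>) + \<sigma> s"
  shows "(LINT \<xi>|lborel. f T \<xi> * w 0 \<xi>) = (LINT \<xi>|lborel. f0 \<xi> * w T \<xi>) + (LINT s:{0..T}|lborel. \<sigma> s)"
proof -
  define E where "E t \<xi> = exp (\<i> * of_real (t * P \<xi>))" for t \<xi>
  \<comment> \<open>Cut-offs to {0..T}, outside of which G need not be integrable and w, H need not
    be bounded; integrals over {0..T} become integrals over the line.\<close>
  define Q where "Q s \<xi> = indicator {0..T} s *\<^sub>R G s \<xi>" for s \<xi>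
  define J where "J r \<xi> = indicator {0..T} r *\<^sub>R H r \<xi>" for r \<xi>
  define V where "V t \<xi> = indicator {0..T} t *\<^sub>R w t \<xi>" for t \<xi>
  have w'[measurable]: "case_prod w \<in> borel_measurable (borel \<Otimes>\<^sub>M borel)"
    and H'[measurable]: "case_prod H \<in> borel_measurable (borel \<Otimes>\<^sub>M borel)"
    using w H by (simp_all add: borel_prod)
  have Em[measurable]: "case_prod E \<in> borel_measurable (borel \<Otimes>\<^sub>M borel)"
    unfolding E_def by measurable
  have Jm[measurable]: "case_prod J \<in> borel_measurable (borel \<Otimes>\<^sub>M borel)"
    unfolding J_def by measurable
  have Vm[measurable]: "case_prod V \<in> borel_measurable (borel \<Otimes>\<^sub>M borel)"
    unfolding V_def by measurable
  have Q: "integrable lborel (\<lambda>p. Q (fst p) (snd p))" using G by (simp add: Q_def split_def)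
  have Qm[measurable]: "case_prod Q \<in> borel_measurable (borel \<Otimes>\<^sub>M borel)"
    using borel_measurable_integrable[OF Q] by (simp add: split_def borel_prod)
  have E1: "norm (E t \<xi>) = 1" for t \<xi> by (simp add: E_def)
  have B0: "0 \<le> B" using wB[of 0 0] T norm_ge_zero[of "w 0 0"] by (simp del: norm_ge_zero)
  have VB: "norm (V t \<xi>) \<le> B" for t \<xi> using wB[of t \<xi>] B0 by (auto simp: V_def split: split_indicator)
  have JB: "norm (J t \<xi>) \<le> B" for t \<xi> using HB[of t \<xi>] B0 by (auto simp: J_def split: split_indicator)
  have JB': "norm (J t \<xi>) \<le> B * indicator {0..T} t" for t \<xi>
    using HB[of t \<xi>] B0 by (auto simp: J_def split: split_indicator)
  have mB: "norm c * norm v \<le> B * norm c" if "norm v \<le> B" for c v :: complex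
    using mult_right_mono[OF that norm_ge_zero[of c]] by (simp add: mult.commute)
  have bnd: "integrable lborel (\<lambda>p. F (fst p) (snd p))"
    if [measurable]: "case_prod F \<in> borel_measurable (borel \<Otimes>\<^sub>M borel)"
      and le: "\<And>s \<xi>. norm (F s \<xi>) \<le> B * norm (Q s \<xi>)"
    for F :: "real \<Rightarrow> 'a \<Rightarrow> complex"
  proof (rule Bochner_Integration.integrable_bound)
    show "integrable lborel (\<lambda>p. B * norm (Q (fst p) (snd p)))" using Q by simp
    show "(\<lambda>p. F (fst p) (snd p)) \<in> borel_measurable lborel"
      using that(1) by (simp add: split_def borel_prod)
    show "AE p in lborel. norm (F (fst p) (snd p)) \<le> norm (B * norm (Q (fst p) (snd p)))"
      using le B0 by simp
  qed

  have duh': "AE \<xi> in lborel. f z \<xi> = E z \<xi> * f0 \<xi> + (LINT s|lborel. indicator {..z} s *\<^sub>R (E (z - s) \<xi> * Q s \<xi>))"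
    if "z \<in> {0..T}" for z
    using duh[OF that]
  proof eventually_elim
    case (elim \<xi>)
    show ?case unfolding elim set_lebesgue_integral_def E_def Q_def using that
      by (intro arg_cong2[where f="(+)"] refl Bochner_Integration.integral_cong) (auto split: split_indicator)
  qed
  have dual': "V t \<xi> = E t \<xi> * V 0 \<xi> + (LINT r|lborel. indicator {..t} r *\<^sub>R (E (t - r) \<xi> * J r \<xi>))"
    if "t \<in> {0..T}" for t \<xi>
  proof -
    have "V t \<xi> = w t \<xi>" "V 0 \<xi> = w 0 \<xi>" using that T by (auto simp: V_def)
    then show ?thesis
      using dual[OF that, of \<xi>] that unfolding set_lebesgue_integral_def E_def J_def
      by (auto intro!: Bochner_Integration.integral_cong split: split_indicator)
  qed

  define a where "a s = (LINT \<xi>|lborel. Q s \<xi> * V (T - s) \<xi>)" for s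
  define b where "b r = (LINT \<xi>|lborel. J r \<xi> * E (T - r) \<xi> * f0 \<xi>)" for r
  \<comment> \<open>Integrand on the triangle s + r \<le> T, where p = (s, \<xi>) collects the
    arguments of G. Fubini is applied between p and r, and once r is fixed also between s and
    \<xi>.\<close>
  define Z where "Z p r = (if r \<le> T - fst p then Q (fst p) (snd p) * E (T - fst p - r) (snd p) * J r (snd p) else 0)" for p r
  define R where "R r = (LINT p|lborel. Z p r)" for r

  have iQV: "integrable lborel (\<lambda>p. Q (fst p) (snd p) * V (T - fst p) (snd p))"
    by (rule bnd[where F = "\<lambda>s \<xi>. Q s \<xi> * V (T - s) \<xi>"]) (simp_all add: norm_mult mB VB)
  have ia: "integrable lborel a"
    using lborel_integrable_fst[OF iQV] by (simp add: a_def[abs_def])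
  have inta: "(LINT s|lborel. a s) = (LINT p|lborel. Q (fst p) (snd p) * V (T - fst p) (snd p))"
    using lborel_integral_fst[OF iQV] by (simp add: a_def[abs_def])

  have Zm: "case_prod Z \<in> borel_measurable borel"
  proof -
    have "case_prod Z \<in> borel_measurable ((borel \<Otimes>\<^sub>M borel) \<Otimes>\<^sub>M borel)"
      unfolding Z_def by measurable
    then show ?thesis by (simp add: borel_prod)
  qed
  have iZ: "integrable lborel (case_prod Z)"
  proof (rule integrable_lborel_product_bound[OF Zm integrable_norm[OF Q]])
    show "integrable lborel (\<lambda>r. B * indicator {0..T} r :: real)"
      by (intro integrable_mult_right integrable_real_indicator) (auto simp: emeasure_lborel_Icc_eq)
    show "norm (case_prod Z (p, r)) \<le> norm (Q (fst p) (snd p)) * (B * indicator {0..T} r)" for p r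
    proof -
      have "norm (Z p r) \<le> norm (Q (fst p) (snd p)) * norm (J r (snd p))"
        by (auto simp: Z_def norm_mult E1)
      also have "\<dots> \<le> norm (Q (fst p) (snd p)) * (B * indicator {0..T} r)"
        by (intro mult_left_mono JB') auto
      finally show ?thesis by simp
    qed
  qed
  have iR: "integrable lborel R" using lborel_integrable_snd[OF iZ] by (simp add: R_def[abs_def])
  have intR: "(LINT p|lborel. LINT r|lborel. Z p r) = (LINT r|lborel. R r)"
    using lborel_Fubini[OF iZ] by (simp add: R_def[abs_def])
  have iZ1: "integrable lborel (\<lambda>p. LINT r|lborel. Z p r)" using lborel_integrable_fst[OF iZ] by simp
  have Zr: "integrable lborel (\<lambda>p. Z p r)" for r
    unfolding Z_def
  proof (rule bnd[where F = "\<lambda>s \<xi>. if r \<le> T - s then Q s \<xi> * E (T - s - r) \<xi> * J r \<xi> else 0"])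
    show "norm (if r \<le> T - s then Q s \<xi> * E (T - s - r) \<xi> * J r \<xi> else 0)
        \<le> B * norm (Q s \<xi>)" for s \<xi>
      using B0 by (simp add: norm_mult E1 mB JB)
  qed measurable

  have ib2: "integrable lborel (\<lambda>p. f0 (fst p) * (E (T - snd p) (fst p) * J (snd p) (fst p)))"
  proof (rule integrable_lborel_product_bound[OF _ integrable_norm[OF f0]])
    have [measurable]: "f0 \<in> borel_measurable borel" using f0 by simp
    have "(\<lambda>p. f0 (fst p) * (E (T - snd p) (fst p) * J (snd p) (fst p))) \<in> borel_measurable (borel \<Otimes>\<^sub>M borel)"
      by measurable
    then show "(\<lambda>p. f0 (fst p) * (E (T - snd p) (fst p) * J (snd p) (fst p))) \<in> borel_measurable borel"
      by (simp add: borel_prod)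
    show "integrable lborel (\<lambda>r. B * indicator {0..T} r :: real)"
      by (intro integrable_mult_right integrable_real_indicator) (auto simp: emeasure_lborel_Icc_eq)
    show "norm (f0 (fst (x, y)) * (E (T - snd (x, y)) (fst (x, y)) * J (snd (x, y)) (fst (x, y))))
         \<le> norm (f0 x) * (B * indicator {0..T} y)" for x y
      by (auto simp: norm_mult E1 intro!: mult_left_mono JB')
  qed
  have ib: "integrable lborel b"
    using lborel_integrable_snd[OF ib2] by (simp add: b_def[abs_def] mult_ac)
  have if1: "integrable lborel (\<lambda>\<xi>. f0 \<xi> * V T \<xi>)" and if2: "integrable lborel (\<lambda>\<xi>. E T \<xi> * f0 \<xi> * V 0 \<xi>)"
  proof -
    have [measurable]: "f0 \<in> borel_measurable borel" using f0 by simp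
    have le: "norm (f0 \<xi> * V t \<xi>) \<le> norm (B *\<^sub>R f0 \<xi>)" for t \<xi>
      using B0 by (simp add: norm_mult mB VB)
    show "integrable lborel (\<lambda>\<xi>. f0 \<xi> * V T \<xi>)"
      by (rule Bochner_Integration.integrable_bound[OF integrable_scaleR_right[OF f0]]) (use le in auto)
    show "integrable lborel (\<lambda>\<xi>. E T \<xi> * f0 \<xi> * V 0 \<xi>)"
      by (rule Bochner_Integration.integrable_bound[OF integrable_scaleR_right[OF f0]])
         (use le[of _ 0] in \<open>auto simp: norm_mult E1\<close>)
  qed
  \<comment> \<open>Integrated over r, the contribution of f0 is the dual formula at T tested
    against f0.\<close>
  have intb: "(LINT r|lborel. b r) = (LINT \<xi>|lborel. f0 \<xi> * V T \<xi>) - (LINT \<xi>|lborel. E T \<xi> * f0 \<xi> * V 0 \<xi>)"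
  proof -
    have "(LINT r|lborel. b r) = (LINT \<xi>|lborel. LINT r|lborel. f0 \<xi> * (E (T - r) \<xi> * J r \<xi>))"
      using lborel_Fubini[OF ib2] by (simp add: b_def[abs_def] mult_ac)
    also have "\<dots> = (LINT \<xi>|lborel. f0 \<xi> * (LINT r|lborel. E (T - r) \<xi> * J r \<xi>))" by simp
    also have "\<dots> = (LINT \<xi>|lborel. f0 \<xi> * (V T \<xi> - E T \<xi> * V 0 \<xi>))"
    proof (intro Bochner_Integration.integral_cong refl)
      fix \<xi>
      have "(LINT r|lborel. E (T - r) \<xi> * J r \<xi>) = (LINT r|lborel. indicator {..T} r *\<^sub>R (E (T - r) \<xi> * J r \<xi>))"
        by (intro Bochner_Integration.integral_cong) (auto simp: J_def split: split_indicator)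
      then show "f0 \<xi> * (LINT r|lborel. E (T - r) \<xi> * J r \<xi>) = f0 \<xi> * (V T \<xi> - E T \<xi> * V 0 \<xi>)"
        using dual'[of T \<xi>] T by simp
    qed
    also have "\<dots> = (LINT \<xi>|lborel. f0 \<xi> * V T \<xi> - E T \<xi> * f0 \<xi> * V 0 \<xi>)"
      by (simp add: algebra_simps)
    finally show ?thesis using if1 if2 by simp
  qed

  \<comment> \<open>The heart of the argument: for fixed r the integral over s is Duhamel's formula
    for f at T - r. Hence \<open>R r\<close> is the pairing of f (T - r) with H r minus the part
    stemming from f0, and \<open>pair\<close> applies at s = T - r. Outside {0..T} every term is
    0.\<close>
  have Req: "R r = a (T - r) - b r - indicator {0..T} r *\<^sub>R \<sigma> (T - r)" for r
  proof (cases "r \<in> {0..T}")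
    case False
    then have "J r = (\<lambda>_. 0)" "V r = (\<lambda>_. 0)" by (auto simp: J_def V_def)
    then show ?thesis using False by (simp add: R_def a_def b_def Z_def cong: if_cong)
  next
    case True
    then have Tr: "T - r \<in> {0..T}" by auto
    have "R r = (LINT \<xi>|lborel. LINT s|lborel. Z (s, \<xi>) r)"
      unfolding R_def using lborel_integral_snd[OF Zr] by simp
    also have "\<dots> = (LINT \<xi>|lborel. H r \<xi> * (LINT s|lborel. indicator {..T - r} s *\<^sub>R (E (T - r - s) \<xi> * Q s \<xi>)))"
    proof (intro Bochner_Integration.integral_cong refl)
      fix \<xi>
      have "H r \<xi> * (LINT s|lborel. indicator {..T - r} s *\<^sub>R (E (T - r - s) \<xi> * Q s \<xi>))
        = (LINT s|lborel. H r \<xi> * (indicator {..T - r} s *\<^sub>R (E (T - r - s) \<xi> * Q s \<xi>)))"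
        by (rule integral_mult_right_zero[symmetric])
      also have "\<dots> = (LINT s|lborel. Z (s, \<xi>) r)"
        using True by (intro Bochner_Integration.integral_cong refl)
          (auto simp: Z_def J_def algebra_simps split: split_indicator)
      finally show "(LINT s|lborel. Z (s, \<xi>) r) = H r \<xi> * (LINT s|lborel. indicator {..T - r} s *\<^sub>R (E (T - r - s) \<xi> * Q s \<xi>))" ..
    qed
    also have "\<dots> = (LINT \<xi>|lborel. f (T - r) \<xi> * H r \<xi> - J r \<xi> * E (T - r) \<xi> * f0 \<xi>)"
    proof (rule integral_cong_AE)
      have [measurable]: "f0 \<in> borel_measurable borel" "f (T - r) \<in> borel_measurable borel"
        using f0 f[OF Tr] by simp_all
      show "(\<lambda>\<xi>. H r \<xi> * (LINT s|lborel. indicator {..T - r} s *\<^sub>R (E (T - r - s) \<xi> * Q s \<xi>))) \<in> borel_measurable lborel"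
        by measurable
      show "(\<lambda>\<xi>. f (T - r) \<xi> * H r \<xi> - J r \<xi> * E (T - r) \<xi> * f0 \<xi>) \<in> borel_measurable lborel"
        by measurable
      show "AE \<xi> in lborel. H r \<xi> * (LINT s|lborel. indicator {..T - r} s *\<^sub>R (E (T - r - s) \<xi> * Q s \<xi>))
         = f (T - r) \<xi> * H r \<xi> - J r \<xi> * E (T - r) \<xi> * f0 \<xi>"
        using duh'[OF Tr] by eventually_elim (use True in \<open>simp add: J_def algebra_simps\<close>)
    qed
    also have "\<dots> = (LINT \<xi>|lborel. f (T - r) \<xi> * H r \<xi>) - b r"
      unfolding b_def
    proof (rule Bochner_Integration.integral_diff)
      have [measurable]: "f0 \<in> borel_measurable borel" "f (T - r) \<in> borel_measurable borel"
        using f0 f[OF Tr] by simp_all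
      show "integrable lborel (\<lambda>\<xi>. f (T - r) \<xi> * H r \<xi>)"
        by (rule Bochner_Integration.integrable_bound[OF integrable_scaleR_right[OF f[OF Tr], of B]])
           (use B0 in \<open>simp_all add: norm_mult mB HB[OF True]\<close>)
      show "integrable lborel (\<lambda>\<xi>. J r \<xi> * E (T - r) \<xi> * f0 \<xi>)"
        by (rule Bochner_Integration.integrable_bound[OF integrable_scaleR_right[OF f0, of B]])
           (use B0 in \<open>simp_all add: norm_mult E1 mult_right_mono[OF JB]\<close>)
    qed
    also have "(LINT \<xi>|lborel. f (T - r) \<xi> * H r \<xi>) = a (T - r) - \<sigma> (T - r)"
      using pair[OF Tr] True by (simp add: a_def Q_def V_def)
    finally show ?thesis using True by simp
  qed

  have ia': "integrable lborel (\<lambda>r. a (T - r))" "(LINT r|lborel. a (T - r)) = (LINT r|lborel. a r)"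
    using lborel_integrable_real_affine[OF ia, of "-1" T] lborel_integral_real_affine[of "-1" a T] by simp_all
  \<comment> \<open>Solving \<open>Req\<close> for the source term exhibits it as a combination of
    integrable functions; its integrability is derived here, not assumed.\<close>
  have "(\<lambda>r. indicator {0..T} r *\<^sub>R \<sigma> (T - r)) = (\<lambda>r. a (T - r) - b r - R r)"
    by (rule ext) (simp add: Req)
  then have "(LINT r|lborel. indicator {0..T} r *\<^sub>R \<sigma> (T - r)) = (LINT r|lborel. a r) - (LINT r|lborel. b r) - (LINT r|lborel. R r)"
    using ia' ib iR by simp
  moreover have "(LINT r|lborel. indicator {0..T} r *\<^sub>R \<sigma> (T - r)) = (LINT s:{0..T}|lborel. \<sigma> s)"
    using set_integral_reflect[of T \<sigma>] by (simp add: set_lebesgue_integral_def)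
  ultimately have sig: "(LINT s:{0..T}|lborel. \<sigma> s) = (LINT r|lborel. a r) - (LINT r|lborel. b r) - (LINT r|lborel. R r)"
    by simp

  let ?F = "\<lambda>p. E (T - fst p) (snd p) * Q (fst p) (snd p) * V 0 (snd p)"
  have iF: "integrable lborel ?F"
    by (rule bnd[where F = "\<lambda>s \<xi>. E (T - s) \<xi> * Q s \<xi> * V 0 \<xi>"])
       (simp_all add: norm_mult E1 mB VB)
  \<comment> \<open>The dual formula at T - s multiplied by G s, read pointwise in p = (s, \<xi>):
    free evolution of w 0 is w (T - s) minus the scattered part.\<close>
  have Fp: "?F p = Q (fst p) (snd p) * V (T - fst p) (snd p) - (LINT r|lborel. Z p r)" for p
  proof (cases "fst p \<in> {0..T}")
    case True
    then have "T - fst p \<in> {0..T}" by auto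
    from dual'[OF this, of "snd p"] have "?F p = Q (fst p) (snd p) * (V (T - fst p) (snd p)
        - (LINT r|lborel. indicator {..T - fst p} r *\<^sub>R (E (T - fst p - r) (snd p) * J r (snd p))))"
      by (simp add: algebra_simps)
    also have "\<dots> = Q (fst p) (snd p) * V (T - fst p) (snd p)
       - (LINT r|lborel. Q (fst p) (snd p) * (indicator {..T - fst p} r *\<^sub>R (E (T - fst p - r) (snd p) * J r (snd p))))"
      by (simp only: right_diff_distrib integral_mult_right_zero)
    also have "\<dots> = Q (fst p) (snd p) * V (T - fst p) (snd p) - (LINT r|lborel. Z p r)"
      by (auto simp: Z_def mult_ac intro!: Bochner_Integration.integral_cong split: split_indicator)
    finally show ?thesis .
  qed (simp add: Q_def Z_def cong: if_cong)

  have "(LINT \<xi>|lborel. f T \<xi> * w 0 \<xi>) = (LINT \<xi>|lborel. E T \<xi> * f0 \<xi> * V 0 \<xi> + (LINT s|lborel. ?F (s, \<xi>)))"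
  proof (rule integral_cong_AE)
    have [measurable]: "f0 \<in> borel_measurable borel" "f T \<in> borel_measurable borel"
      using f0 f[of T] T by simp_all
    show "(\<lambda>\<xi>. f T \<xi> * w 0 \<xi>) \<in> borel_measurable lborel" by measurable
    show "(\<lambda>\<xi>. E T \<xi> * f0 \<xi> * V 0 \<xi> + (LINT s|lborel. ?F (s, \<xi>))) \<in> borel_measurable lborel"
      by measurable
    have "(LINT s|lborel. ?F (s, \<xi>)) = (LINT s|lborel. indicator {..T} s *\<^sub>R (E (T - s) \<xi> * Q s \<xi>)) * V 0 \<xi>" for \<xi>
    proof -
      have "(LINT s|lborel. indicator {..T} s *\<^sub>R (E (T - s) \<xi> * Q s \<xi>)) * V 0 \<xi>
        = (LINT s|lborel. (indicator {..T} s *\<^sub>R (E (T - s) \<xi> * Q s \<xi>)) * V 0 \<xi>)"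
        by (rule integral_mult_left_zero[symmetric])
      also have "\<dots> = (LINT s|lborel. ?F (s, \<xi>))"
        by (intro Bochner_Integration.integral_cong) (auto simp: Q_def split: split_indicator)
      finally show ?thesis ..
    qed
    moreover have "w 0 \<xi> = V 0 \<xi>" for \<xi> using T by (simp add: V_def)
    moreover have "T \<in> {0..T}" using T by simp
    note duh'[OF this]
    ultimately show "AE \<xi> in lborel. f T \<xi> * w 0 \<xi> = E T \<xi> * f0 \<xi> * V 0 \<xi> + (LINT s|lborel. ?F (s, \<xi>))"
      by (auto simp: algebra_simps)
  qed
  also have "\<dots> = (LINT \<xi>|lborel. E T \<xi> * f0 \<xi> * V 0 \<xi>) + (LINT p|lborel. ?F p)"
    using if2 lborel_integrable_snd[OF iF] lborel_integral_snd[OF iF] by simp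
  also have "(LINT p|lborel. ?F p) = (LINT r|lborel. a r) - (LINT r|lborel. R r)"
    unfolding Fp inta intR[symmetric] by (rule Bochner_Integration.integral_diff[OF iQV iZ1])
  also have "(LINT \<xi>|lborel. E T \<xi> * f0 \<xi> * V 0 \<xi>) + \<dots> = (LINT \<xi>|lborel. f0 \<xi> * V T \<xi>) + (LINT s:{0..T}|lborel. \<sigma> s)"
    by (simp add: sig intb)
  also have "V T = w T" using T by (auto simp: V_def)
  finally show ?thesis .
qed

section \<open>Translations and convolutions along a shift in L^1\<close>

lemma
  fixes f :: "'a::euclidean_space \<Rightarrow> 'b::{banach, second_countable_topology}"
  assumes f: "integrable lborel f"
  shows integrable_lborel_shift: "integrable lborel (\<lambda>x. f (x + t))"
    and integral_lborel_shift: "(LINT x|lborel. f (x + t)) = (LINT x|lborel. f x)"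
proof -
  have m: "f \<in> borel_measurable borel" using f by simp
  show "integrable lborel (\<lambda>x. f (x + t))"
    using integrable_lborel_affine_iff[OF m, of 1 t] f by (simp add: add.commute)
  show "(LINT x|lborel. f (x + t)) = (LINT x|lborel. f x)"
    using integral_lborel_affine[OF m, of 1 t] by (simp add: add.commute)
qed

text \<open>Young's inequality in L^1: each translate of f has the norm of f, and Tonelli does the
  rest. For the shift (q, - q), which sweeps only a plane in a four-dimensional space, this is
  convolution with a measure rather than with a function.\<close>

lemma
  fixes h :: "'b::euclidean_space \<Rightarrow> complex" and f :: "'a::euclidean_space \<Rightarrow> complex" and J :: "'b \<Rightarrow> 'a"
  assumes h: "integrable lborel h" and J: "continuous_on UNIV J" and f: "integrable lborel f"
  shows integrable_convolution_pair: "integrable lborel (\<lambda>p. h (snd p) * f (fst p - J (snd p)))"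
    and integrable_convolution: "integrable lborel (\<lambda>\<xi>. LINT q|lborel. h q * f (\<xi> - J q))"
    and integral_norm_convolution_le: "(LINT \<xi>|lborel. norm (LINT q|lborel. h q * f (\<xi> - J q)))
        \<le> (LINT q|lborel. norm (h q)) * (LINT \<xi>|lborel. norm (f \<xi>))"
proof -
  have [measurable]: "h \<in> borel_measurable borel" "f \<in> borel_measurable borel" "J \<in> borel_measurable borel"
    using h f J by (auto intro: borel_measurable_continuous_onI)
  have shiftn: "(LINT \<xi>|lborel. norm (f (\<xi> - J q))) = (LINT \<xi>|lborel. norm (f \<xi>))" for q
    using integral_lborel_shift[OF integrable_norm[OF f], of "- J q"] by simp
  have m: "(\<lambda>p. h (fst p) * f (snd p - J (fst p))) \<in> borel_measurable (lborel \<Otimes>\<^sub>M lborel)" by measurable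
  have "integrable (lborel \<Otimes>\<^sub>M lborel) (\<lambda>p. h (fst p) * f (snd p - J (fst p)))"
  proof (rule lborel_pair.Fubini_integrable[OF m])
    show "integrable lborel (\<lambda>q. LINT \<xi>|lborel. norm (h (fst (q, \<xi>)) * f (snd (q, \<xi>) - J (fst (q, \<xi>)))))"
      using h by (simp add: norm_mult shiftn)
    show "AE q in lborel. integrable lborel (\<lambda>\<xi>. h (fst (q, \<xi>)) * f (snd (q, \<xi>) - J (fst (q, \<xi>))))"
      using integrable_lborel_shift[OF f, of "- J q" for q] by simp
  qed
  from lborel_pair.integrable_product_swap[OF this]
  show i: "integrable lborel (\<lambda>p. h (snd p) * f (fst p - J (snd p)))"
    by (simp add: lborel_prod split_def)
  show i1: "integrable lborel (\<lambda>\<xi>. LINT q|lborel. h q * f (\<xi> - J q))"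
    using lborel_integrable_fst[OF i] by simp
  have n: "integrable lborel (\<lambda>p. complex_of_real (norm (h (snd p) * f (fst p - J (snd p)))))"
    using integrable_norm[OF i] by (simp only: complex_of_real_integrable_eq)
  have i2: "integrable lborel (\<lambda>\<xi>. LINT q|lborel. norm (h q * f (\<xi> - J q)))"
    using lborel_integrable_fst[OF n] unfolding integral_complex_of_real complex_of_real_integrable_eq by simp
  have "(LINT \<xi>|lborel. norm (LINT q|lborel. h q * f (\<xi> - J q)))
      \<le> (LINT \<xi>|lborel. LINT q|lborel. norm (h q * f (\<xi> - J q)))"
    using i1 i2 by (intro integral_mono integral_norm_bound) auto
  also have "\<dots> = (LINT q|lborel. LINT \<xi>|lborel. norm (h q * f (\<xi> - J q)))"
    using lborel_Fubini[OF n] unfolding integral_complex_of_real of_real_eq_iff by simp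
  also have "\<dots> = (LINT q|lborel. norm (h q)) * (LINT \<xi>|lborel. norm (f \<xi>))"
    by (simp add: norm_mult shiftn)
  finally show "(LINT \<xi>|lborel. norm (LINT q|lborel. h q * f (\<xi> - J q)))
        \<le> (LINT q|lborel. norm (h q)) * (LINT \<xi>|lborel. norm (f \<xi>))" .
qed

lemma integrable_mult_bounded:
  fixes f u :: "'a::euclidean_space \<Rightarrow> complex"
  assumes f: "integrable lborel f" and [measurable]: "u \<in> borel_measurable borel" and B: "\<And>x. norm (u x) \<le> B"
  shows "integrable lborel (\<lambda>x. f x * u x)"
proof (rule Bochner_Integration.integrable_bound)
  show "integrable lborel (\<lambda>x. norm (f x) * B)" using f by simp
  have [measurable]: "f \<in> borel_measurable borel" using f by simp
  show "(\<lambda>x. f x * u x) \<in> borel_measurable lborel" by measurable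
  show "AE x in lborel. norm (f x * u x) \<le> norm (norm (f x) * B)"
    using B by (intro always_eventually allI)
      (auto simp: norm_mult abs_mult intro!: mult_left_mono intro: order_trans[OF _ abs_ge_self])
qed

lemma convolution_duality:
  fixes h :: "'b::euclidean_space \<Rightarrow> complex" and f u :: "'a::euclidean_space \<Rightarrow> complex" and J :: "'b \<Rightarrow> 'a"
  assumes h: "integrable lborel h" and J: "continuous_on UNIV J" and f: "integrable lborel f"
    and u: "continuous_on UNIV u" and B: "\<And>x. norm (u x) \<le> B"
  shows "(LINT \<xi>|lborel. (LINT q|lborel. h q * f (\<xi> - J q)) * u \<xi>)
       = (LINT \<xi>|lborel. f \<xi> * (LINT q|lborel. h q * u (\<xi> + J q)))"
proof -
  have [measurable]: "h \<in> borel_measurable borel" "f \<in> borel_measurable borel" "J \<in> borel_measurable borel"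
    "u \<in> borel_measurable borel"
    using h f J u by (auto intro: borel_measurable_continuous_onI)
  have i1: "integrable lborel (\<lambda>p. (h (snd p) * f (fst p - J (snd p))) * u (fst p))"
  proof (rule integrable_mult_bounded[OF integrable_convolution_pair[OF h J f]])
    show "(\<lambda>p::'a \<times> 'b. u (fst p)) \<in> borel_measurable borel"
      by (intro borel_measurable_continuous_onI continuous_on_compose2[OF u] continuous_intros) auto
  qed (rule B)
  have i2: "integrable lborel (\<lambda>p. (f (fst p) * h (snd p)) * u (fst p + J (snd p)))"
  proof (rule integrable_lborel_product_bound[OF _ integrable_norm[OF f]])
    have "(\<lambda>p. (f (fst p) * h (snd p)) * u (fst p + J (snd p))) \<in> borel_measurable (borel \<Otimes>\<^sub>M borel)"
      by measurable
    then show "(\<lambda>p. (f (fst p) * h (snd p)) * u (fst p + J (snd p))) \<in> borel_measurable borel"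
      by (simp add: borel_prod)
    show "integrable lborel (\<lambda>q. norm (h q) * B)" using h by simp
    show "norm ((f (fst (x, y)) * h (snd (x, y))) * u (fst (x, y) + J (snd (x, y)))) \<le> norm (f x) * (norm (h y) * B)" for x y
      using B by (auto simp: norm_mult mult.assoc intro!: mult_left_mono)
  qed
  have shift: "(LINT \<xi>|lborel. (h q * f (\<xi> - J q)) * u \<xi>) = (LINT \<xi>|lborel. (f \<xi> * h q) * u (\<xi> + J q))" for q
  proof -
    have "integrable lborel (\<lambda>\<xi>. f (\<xi> - J q) * u \<xi>)"
      using integrable_lborel_shift[OF f, of "- J q"] by (intro integrable_mult_bounded[OF _ _ B]) auto
    from integral_lborel_shift[OF this, of "J q"]
    have "h q * (LINT \<xi>|lborel. f (\<xi> - J q) * u \<xi>) = h q * (LINT \<xi>|lborel. f \<xi> * u (\<xi> + J q))" by simp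
    then show ?thesis unfolding integral_mult_right_zero[symmetric] by (simp add: mult_ac)
  qed
  have "(LINT \<xi>|lborel. (LINT q|lborel. h q * f (\<xi> - J q)) * u \<xi>)
      = (LINT \<xi>|lborel. LINT q|lborel. (h q * f (\<xi> - J q)) * u \<xi>)" by simp
  also have "\<dots> = (LINT q|lborel. LINT \<xi>|lborel. (h q * f (\<xi> - J q)) * u \<xi>)"
    using lborel_Fubini[OF i1] by simp
  also have "\<dots> = (LINT q|lborel. LINT \<xi>|lborel. (f \<xi> * h q) * u (\<xi> + J q))" by (simp only: shift)
  also have "\<dots> = (LINT \<xi>|lborel. LINT q|lborel. (f \<xi> * h q) * u (\<xi> + J q))"
    using lborel_Fubini[OF i2] by simp
  finally show ?thesis by (simp add: mult.assoc)
qed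

text \<open>Connects the form of the fixed-point equation with Duhamel's through r = t s. At t = 0
  the substitution degenerates, but both sides vanish, the right one because {0..0} is a null
  set.\<close>

lemma unit_interval_rescale:
  fixes g :: "real \<Rightarrow> complex"
  assumes t: "0 \<le> t"
  shows "(LINT s:{0..1}|lborel. of_real t * exp (\<i> * of_real (t * (1 - s) * p)) * g (t * s))
     = (LINT r:{0..t}|lborel. exp (\<i> * of_real ((t - r) * p)) * g r)"
proof (cases "t = 0")
  case True
  have "AE r in lborel. indicator {0..t} r *\<^sub>R (exp (\<i> * of_real ((t - r) * p)) * g r) = 0"
    using AE_lborel_singleton[of "0::real"] by eventually_elim (use True in \<open>simp split: split_indicator\<close>)
  then have "(LINT r|lborel. indicator {0..t} r *\<^sub>R (exp (\<i> * of_real ((t - r) * p)) * g r)) = 0"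
    by (rule integral_eq_zero_AE)
  then show ?thesis using True by (simp add: set_lebesgue_integral_def)
next
  case False
  then show ?thesis unfolding set_lebesgue_integral_def using t
    by (subst lborel_integral_real_affine[of t _ 0])
       (auto simp: algebra_simps scaleR_conv_of_real zero_le_mult_iff
          intro!: Bochner_Integration.integral_cong split: split_indicator simp flip: integral_mult_right_zero)
qed

text \<open>\<open>duhamel_duality\<close> for a scattering term plus a source S: moving the shift
  from f to w yields the hypothesis \<open>pair\<close>, with \<sigma> s the integral of S s against
  w (T - s). Joint integrability of G comes from its joint measurability and from L^1 bounds uniform
  on {0..T}. The equation for G is asked only almost everywhere because a convolution of L^1
  functions converges only there.\<close>

lemma scattering_duality:
  fixes f G S w :: "real \<Rightarrow> 'a::euclidean_space \<Rightarrow> complex" and P :: "'a \<Rightarrow> real" and f0 :: "'a \<Rightarrow> complex"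
    and h :: "'b::euclidean_space \<Rightarrow> complex" and J :: "'b \<Rightarrow> 'a" and a \<kappa> :: complex
  assumes T: "0 \<le> T" and P: "P \<in> borel_measurable borel" and f0: "integrable lborel f0"
    and h: "integrable lborel h" and J: "continuous_on UNIV J"
    and f: "\<And>s. s \<in> {0..T} \<Longrightarrow> integrable lborel (f s)"
    and fB: "\<And>s. s \<in> {0..T} \<Longrightarrow> (LINT \<xi>|lborel. norm (f s \<xi>)) \<le> Bf"
    and S: "\<And>s. s \<in> {0..T} \<Longrightarrow> integrable lborel (S s)"
    and SB: "\<And>s. s \<in> {0..T} \<Longrightarrow> (LINT \<xi>|lborel. norm (S s \<xi>)) \<le> BS"
    and Gm: "(\<lambda>p. indicator {0..T} (fst p) *\<^sub>R G (fst p) (snd p)) \<in> borel_measurable borel"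
    and G: "\<And>s. s \<in> {0..T} \<Longrightarrow>
       AE \<xi> in lborel. G s \<xi> = a * (LINT q|lborel. h q * f s (\<xi> - J q)) - \<kappa> * f s \<xi> + S s \<xi>"
    and w: "continuous_on UNIV (case_prod w)" and wB: "\<And>t \<xi>. t \<in> {0..T} \<Longrightarrow> norm (w t \<xi>) \<le> B"
    and duh: "\<And>z. z \<in> {0..T} \<Longrightarrow> AE \<xi> in lborel. f z \<xi> = exp (\<i> * of_real (z * P \<xi>)) * f0 \<xi>
       + (LINT s:{0..z}|lborel. exp (\<i> * of_real ((z - s) * P \<xi>)) * G s \<xi>)"
    and dual: "\<And>t \<xi>. t \<in> {0..T} \<Longrightarrow> w t \<xi> = exp (\<i> * of_real (t * P \<xi>)) * w 0 \<xi>
       + (LINT s:{0..1}|lborel. of_real t * exp (\<i> * of_real (t * (1 - s) * P \<xi>)) *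
            adjoint_scattering a \<kappa> h J (w (t * s)) \<xi>)"
  shows "(LINT \<xi>|lborel. f T \<xi> * w 0 \<xi>) = (LINT \<xi>|lborel. f0 \<xi> * w T \<xi>)
       + (LINT s:{0..T}|lborel. LINT \<xi>|lborel. S s \<xi> * w (T - s) \<xi>)"
proof -
  define H where "H t = adjoint_scattering a \<kappa> h J (w t)" for t
  define A where "A = max (norm a) (norm \<kappa>)"
  define B' where "B' = max B (A * ((LINT q|lborel. norm (h q)) + 1) * B)"
  have wc: "continuous_on UNIV (w t)" for t
  proof -
    have "continuous_on UNIV (\<lambda>\<xi>. case_prod w (t, \<xi>))"
      by (rule continuous_on_compose2[OF w]) (auto intro!: continuous_intros)
    then show ?thesis by simp
  qed
  have wm: "case_prod w \<in> borel_measurable borel" by (rule borel_measurable_continuous_onI[OF w])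
  then have [measurable]: "case_prod w \<in> borel_measurable (borel \<Otimes>\<^sub>M borel)" by (simp add: borel_prod)
  have [measurable]: "h \<in> borel_measurable borel" "J \<in> borel_measurable borel" "w t \<in> borel_measurable borel" for t
    using h J wc by (auto intro: borel_measurable_continuous_onI)
  have "case_prod H \<in> borel_measurable (borel \<Otimes>\<^sub>M borel)"
    unfolding H_def adjoint_scattering_def[abs_def] by measurable
  then have Hm: "case_prod H \<in> borel_measurable borel" by (simp add: borel_prod)
  have HB: "norm (H t \<xi>) \<le> A * ((LINT q|lborel. norm (h q)) + 1) * B" if "t \<in> {0..T}" for t \<xi>
    unfolding H_def by (rule norm_adjoint_scattering_le[OF h J wc wB[OF that]]) (auto simp: A_def)
  have conv: "integrable lborel (\<lambda>\<xi>. LINT q|lborel. h q * f s (\<xi> - J q))" if "s \<in> {0..T}" for s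
    by (rule integrable_convolution[OF h J f[OF that]])
  have split: "integrable lborel (\<lambda>\<xi>. a * (LINT q|lborel. h q * f s (\<xi> - J q)) - \<kappa> * f s \<xi> + S s \<xi>)"
    if "s \<in> {0..T}" for s
    using conv[OF that] f[OF that] S[OF that] by simp
  have Gsm: "G s \<in> borel_measurable borel" if "s \<in> {0..T}" for s
  proof -
    have "(\<lambda>\<xi>. indicator {0..T} (fst (s, \<xi>)) *\<^sub>R G (fst (s, \<xi>)) (snd (s, \<xi>))) \<in> borel_measurable borel"
      by (rule measurable_compose[OF _ Gm]) (intro borel_measurable_continuous_onI continuous_intros)
    then show ?thesis using that by simp
  qed
  have Gi: "integrable lborel (G s)" if "s \<in> {0..T}" for s
    using integrable_cong_AE[THEN iffD2, OF _ _ G[OF that] split[OF that]] Gsm[OF that]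
      borel_measurable_integrable[OF split[OF that]] by simp
  have GB: "(LINT \<xi>|lborel. norm (G s \<xi>)) \<le> norm a * ((LINT q|lborel. norm (h q)) * Bf) + norm \<kappa> * Bf + BS"
    if s: "s \<in> {0..T}" for s
  proof -
    have "(LINT \<xi>|lborel. norm (G s \<xi>)) \<le> (LINT \<xi>|lborel. norm a * norm (LINT q|lborel. h q * f s (\<xi> - J q))
        + norm \<kappa> * norm (f s \<xi>) + norm (S s \<xi>))"
    proof (rule integral_mono_AE)
      show "integrable lborel (\<lambda>\<xi>. norm (G s \<xi>))" using Gi[OF s] by simp
      show "integrable lborel (\<lambda>\<xi>. norm a * norm (LINT q|lborel. h q * f s (\<xi> - J q))
        + norm \<kappa> * norm (f s \<xi>) + norm (S s \<xi>))"
        using conv[OF s] f[OF s] S[OF s] by simp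
      show "AE \<xi> in lborel. norm (G s \<xi>) \<le> norm a * norm (LINT q|lborel. h q * f s (\<xi> - J q))
        + norm \<kappa> * norm (f s \<xi>) + norm (S s \<xi>)"
        using G[OF s]
      proof eventually_elim
        case (elim \<xi>)
        show ?case unfolding elim norm_mult[symmetric]
          by (rule norm_triangle_le[OF add_right_mono[OF norm_triangle_ineq4]])
      qed
    qed
    also have "\<dots> = norm a * (LINT \<xi>|lborel. norm (LINT q|lborel. h q * f s (\<xi> - J q)))
        + norm \<kappa> * (LINT \<xi>|lborel. norm (f s \<xi>)) + (LINT \<xi>|lborel. norm (S s \<xi>))"
      using conv[OF s] f[OF s] S[OF s] by simp
    also have "\<dots> \<le> norm a * ((LINT q|lborel. norm (h q)) * Bf) + norm \<kappa> * Bf + BS"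
      by (intro add_mono mult_left_mono SB[OF s] fB[OF s] norm_ge_zero
          order_trans[OF integral_norm_convolution_le[OF h J f[OF s]]]) simp_all
    finally show ?thesis .
  qed
  have Gint: "integrable lborel (\<lambda>(s, \<xi>). indicator {0..T} s *\<^sub>R G s \<xi>)"
  proof -
    have m: "(\<lambda>p. indicator {0..T} (fst p) *\<^sub>R G (fst p) (snd p)) \<in> borel_measurable (lborel \<Otimes>\<^sub>M lborel)"
      using Gm by (simp add: lborel_prod)
    have "integrable (lborel \<Otimes>\<^sub>M lborel) (\<lambda>p. indicator {0..T} (fst p) *\<^sub>R G (fst p) (snd p))"
    proof (rule lborel_pair.Fubini_integrable[OF m])
      show "AE s in lborel. integrable lborel (\<lambda>\<xi>. indicator {0..T} (fst (s, \<xi>)) *\<^sub>R G (fst (s, \<xi>)) (snd (s, \<xi>)))"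
        using Gi by (intro always_eventually) (auto split: split_indicator)
      let ?K = "norm a * ((LINT q|lborel. norm (h q)) * Bf) + norm \<kappa> * Bf + BS"
      show "integrable lborel (\<lambda>s. LINT \<xi>|lborel. norm (indicator {0..T} (fst (s, \<xi>)) *\<^sub>R G (fst (s, \<xi>)) (snd (s, \<xi>))))"
      proof (rule Bochner_Integration.integrable_bound)
        show "integrable lborel (\<lambda>s. ?K * indicator {0..T} s)"
          by (intro integrable_mult_right integrable_real_indicator) (auto simp: emeasure_lborel_Icc_eq)
        show "(\<lambda>s. LINT \<xi>|lborel. norm (indicator {0..T} (fst (s, \<xi>)) *\<^sub>R G (fst (s, \<xi>)) (snd (s, \<xi>)))) \<in> borel_measurable lborel"
          using measurable_compose[OF m borel_measurable_norm]
          by (intro lborel.borel_measurable_lebesgue_integral) (simp add: split_def del: norm_scaleR)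
        show "AE s in lborel. norm (LINT \<xi>|lborel. norm (indicator {0..T} (fst (s, \<xi>)) *\<^sub>R G (fst (s, \<xi>)) (snd (s, \<xi>))))
           \<le> norm (?K * indicator {0..T} s)"
        proof (intro always_eventually allI)
          fix s
          show "norm (LINT \<xi>|lborel. norm (indicator {0..T} (fst (s, \<xi>)) *\<^sub>R G (fst (s, \<xi>)) (snd (s, \<xi>))))
             \<le> norm (?K * indicator {0..T} s)"
          proof (cases "s \<in> {0..T}")
            case True
            have "0 \<le> (LINT \<xi>|lborel. norm (G s \<xi>))" by simp
            with GB[OF True] True show ?thesis by simp
          qed simp
        qed
      qed
    qed
    then show ?thesis by (simp add: lborel_prod split_def)
  qed
  show ?thesis
  proof (rule duhamel_duality[where f = f and G = G and H = H and P = P and B = B', OF T P f0 f Gint wm _ Hm _ duh])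
    show "norm (w t \<xi>) \<le> B'" "norm (H t \<xi>) \<le> B'" if "t \<in> {0..T}" for t \<xi>
      using wB[OF that] HB[OF that] by (auto simp: B'_def le_max_iff_disj)
    show "w t \<xi> = exp (\<i> * of_real (t * P \<xi>)) * w 0 \<xi> + (LINT r:{0..t}|lborel. exp (\<i> * of_real ((t - r) * P \<xi>)) * H r \<xi>)"
      if "t \<in> {0..T}" for t \<xi>
      using dual[OF that, of \<xi>] unit_interval_rescale[of t "P \<xi>" "\<lambda>r. H r \<xi>"] that by (simp add: H_def)
    fix s assume s: "s \<in> {0..T}"
    then have Ts: "T - s \<in> {0..T}" by auto
    let ?u = "w (T - s)"
    note ub = integrable_mult_bounded[OF _ _ wB[OF Ts]]
    have i: "integrable lborel (\<lambda>\<xi>. (LINT q|lborel. h q * f s (\<xi> - J q)) * ?u \<xi>)"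
        "integrable lborel (\<lambda>\<xi>. f s \<xi> * ?u \<xi>)" "integrable lborel (\<lambda>\<xi>. S s \<xi> * ?u \<xi>)"
      by (auto intro!: ub conv f S s)
    have i2: "integrable lborel (\<lambda>\<xi>. f s \<xi> * (LINT q|lborel. h q * ?u (\<xi> + J q)))"
    proof (rule integrable_mult_bounded[OF f[OF s]])
      show "(\<lambda>\<xi>. LINT q|lborel. h q * ?u (\<xi> + J q)) \<in> borel_measurable borel" by measurable
      \<comment> \<open>With a = 1 and \<kappa> = 0 the adjoint scattering is the bare integral, so
        its bound can be reused.\<close>
      show "norm (LINT q|lborel. h q * ?u (\<xi> + J q)) \<le> 1 * ((LINT q|lborel. norm (h q)) + 1) * B" for \<xi>
        using norm_adjoint_scattering_le[OF h J wc wB[OF Ts], of 1 1 0 \<xi>] by (simp add: adjoint_scattering_def)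
    qed
    have "(LINT \<xi>|lborel. G s \<xi> * ?u \<xi>) = (LINT \<xi>|lborel. (a * (LINT q|lborel. h q * f s (\<xi> - J q)) - \<kappa> * f s \<xi> + S s \<xi>) * ?u \<xi>)"
      using G[OF s] Gsm[OF s] borel_measurable_integrable[OF split[OF s]]
      by (intro integral_cong_AE) auto
    also have "\<dots> = (LINT \<xi>|lborel. a * ((LINT q|lborel. h q * f s (\<xi> - J q)) * ?u \<xi>) - \<kappa> * (f s \<xi> * ?u \<xi>) + S s \<xi> * ?u \<xi>)"
      by (simp only: distrib_right left_diff_distrib mult.assoc)
    also have "\<dots> = a * (LINT \<xi>|lborel. (LINT q|lborel. h q * f s (\<xi> - J q)) * ?u \<xi>) - \<kappa> * (LINT \<xi>|lborel. f s \<xi> * ?u \<xi>)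
        + (LINT \<xi>|lborel. S s \<xi> * ?u \<xi>)"
      using i by simp
    also have "(LINT \<xi>|lborel. (LINT q|lborel. h q * f s (\<xi> - J q)) * ?u \<xi>) = (LINT \<xi>|lborel. f s \<xi> * (LINT q|lborel. h q * ?u (\<xi> + J q)))"
      by (rule convolution_duality[OF h J f[OF s] wc wB[OF Ts]])
    also have "a * \<dots> - \<kappa> * (LINT \<xi>|lborel. f s \<xi> * ?u \<xi>)
       = (LINT \<xi>|lborel. a * (f s \<xi> * (LINT q|lborel. h q * ?u (\<xi> + J q))) - \<kappa> * (f s \<xi> * ?u \<xi>))"
      using i(2) i2 by simp
    also have "\<dots> = (LINT \<xi>|lborel. f s \<xi> * H (T - s) \<xi>)"
      unfolding H_def adjoint_scattering_def
      by (intro Bochner_Integration.integral_cong refl) (simp add: right_diff_distrib mult_ac)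
    finally show "(LINT \<xi>|lborel. G s \<xi> * w (T - s) \<xi>) = (LINT \<xi>|lborel. f s \<xi> * H (T - s) \<xi>)
       + (LINT \<xi>|lborel. S s \<xi> * w (T - s) \<xi>)" .
  qed
qed

section \<open>Curves in L^1: bounds and measurability on compact intervals\<close>

lemma continuous_L1_curve_bounded:
  assumes "continuous_L1_curve f"
  obtains B where "\<And>s. s \<in> {0..T} \<Longrightarrow> (LINT \<xi>|lborel. norm (f s \<xi>)) \<le> B"
proof -
  let ?n = "\<lambda>s. LINT \<xi>|lborel. norm (f s \<xi>)"
  have int: "integrable lborel (f z)" if "0 \<le> z" for z
    using assms that by (auto simp: continuous_L1_curve_def)
  have lim: "((\<lambda>w. LINT \<xi>|lborel. norm (f w \<xi> - f z \<xi>)) \<longlongrightarrow> 0) (at z within {0..})" if "0 \<le> z" for z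
    using assms that by (auto simp: continuous_L1_curve_def)
  have "continuous_on {0..} ?n"
    unfolding continuous_on_def
  proof
    fix z :: real assume z: "z \<in> {0..}"
    have "((\<lambda>w. ?n w - ?n z) \<longlongrightarrow> 0) (at z within {0..})"
    proof (rule Lim_null_comparison[OF _ lim])
      show "\<forall>\<^sub>F w in at z within {0..}. norm (?n w - ?n z) \<le> (LINT \<xi>|lborel. norm (f w \<xi> - f z \<xi>))"
        unfolding eventually_at_filter
      proof (intro always_eventually allI impI)
        fix w :: real assume w: "w \<in> {0..}"
        have "?n w - ?n z = (LINT \<xi>|lborel. norm (f w \<xi>) - norm (f z \<xi>))"
          using int[of w] int[of z] w z by simp
        also have "norm \<dots> \<le> (LINT \<xi>|lborel. norm (norm (f w \<xi>) - norm (f z \<xi>)))"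
          by (rule integral_norm_bound)
        also have "\<dots> \<le> (LINT \<xi>|lborel. norm (f w \<xi> - f z \<xi>))"
          using int[of w] int[of z] w z by (intro integral_mono) (auto intro: norm_triangle_ineq3)
        finally show "norm (?n w - ?n z) \<le> (LINT \<xi>|lborel. norm (f w \<xi> - f z \<xi>))" .
      qed
    qed (use z in auto)
    then show "(?n \<longlongrightarrow> ?n z) (at z within {0..})" by (rule LIM_zero_cancel)
  qed
  then have "compact (?n ` {0..T})"
    by (intro compact_continuous_image) (auto elim: continuous_on_subset)
  then have "bounded (?n ` {0..T})" by (rule compact_imp_bounded)
  then obtain B where "\<forall>c\<in>?n ` {0..T}. norm c \<le> B" unfolding bounded_iff by blast
  then show ?thesis using that[of B] by force
qed

lemma continuous_L1_curve_measurable: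
  fixes f :: "real \<Rightarrow> 'a::euclidean_space \<Rightarrow> complex"
  assumes "continuous_L1_curve f"
  shows "(\<lambda>p. indicator {0..T} (fst p) *\<^sub>R f (fst p) (snd p)) \<in> borel_measurable borel"
proof -
  let ?i = "\<lambda>p::real \<times> 'a. indicator ({0..} \<times> UNIV) p *\<^sub>R f (fst p) (snd p)"
  have m: "?i \<in> borel_measurable borel"
    using assms by (simp add: continuous_L1_curve_def set_borel_measurable_def split_def)
  have "(\<lambda>p::real \<times> 'a. indicator {0..T} (fst p) :: real) \<in> borel_measurable (borel \<Otimes>\<^sub>M borel)" by measurable
  then have "(\<lambda>p::real \<times> 'a. indicator {0..T} (fst p) :: real) \<in> borel_measurable borel" by (simp add: borel_prod)
  from borel_measurable_scaleR[OF this m]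
  show ?thesis by (rule measurable_cong[THEN iffD1, rotated]) (auto split: split_indicator)
qed

section \<open>Fourier transforms of the initial datum and the covariance\<close>

lemma
  fixes g :: "'a::euclidean_space \<Rightarrow> complex" and h :: "'b::euclidean_space \<Rightarrow> complex"
  assumes g: "integrable lborel g" and h: "integrable lborel h"
  shows integrable_lborel_times: "integrable lborel (\<lambda>p. g (fst p) * h (snd p))"
    and integral_lborel_times: "(LINT p|lborel. g (fst p) * h (snd p)) = (LINT x|lborel. g x) * (LINT y|lborel. h y)"
proof -
  have [measurable]: "g \<in> borel_measurable borel" "h \<in> borel_measurable borel" using g h by auto
  have "(\<lambda>p. g (fst p) * h (snd p)) \<in> borel_measurable (borel \<Otimes>\<^sub>M borel)" by measurable
  then have "(\<lambda>p. g (fst p) * h (snd p)) \<in> borel_measurable borel" by (simp add: borel_prod)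
  then show i: "integrable lborel (\<lambda>p. g (fst p) * h (snd p))"
    by (rule integrable_lborel_product_bound[OF _ integrable_norm[OF g] integrable_norm[OF h]])
       (simp add: norm_mult)
  show "(LINT p|lborel. g (fst p) * h (snd p)) = (LINT x|lborel. g x) * (LINT y|lborel. h y)"
    using lborel_integral_fst[OF i] by simp
qed

text \<open>In u = x + y and v = x - y the datum is a product of two Gaussians, and the phase splits
  as (k + l) / 2 against u plus (k - l) / 2 against v. The factors 4 pi r^2 and 4 pi \<rho>^2 of the
  two planar integrals meet the Jacobian 1 / 4.\<close>

lemma fourier_initial_mean:
  assumes r: "0 < r" and \<rho>: "0 < \<rho>"
  shows "fourier_real (initial_mean r \<rho>) (k, l) = of_real (4 * pi\<^sup>2 * r\<^sup>2 * \<rho>\<^sup>2 *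
     exp (- (r\<^sup>2 * (norm (k + l))\<^sup>2 / 4)) * exp (- (\<rho>\<^sup>2 * (norm (k - l))\<^sup>2 / 4)))"
proof -
  define g :: "real \<Rightarrow> plane \<Rightarrow> plane \<Rightarrow> complex" where
    "g s m u = of_real (exp (- (1 / (4 * s\<^sup>2)) * (norm u)\<^sup>2)) * exp (\<i> * of_real ((- (m /\<^sub>R 2)) \<bullet> u))" for s m u
  have g: "integrable lborel (g s m)" "(LINT u|lborel. g s m u) = of_real (4 * pi * s\<^sup>2 * exp (- (s\<^sup>2 * (norm m)\<^sup>2 / 4)))"
    if "0 < s" for s m
  proof -
    have a: "0 < 1 / (4 * s\<^sup>2)" using that by simp
    show "integrable lborel (g s m)"
      unfolding g_def by (rule integrable_gaussian[OF a])
    show "(LINT u|lborel. g s m u) = of_real (4 * pi * s\<^sup>2 * exp (- (s\<^sup>2 * (norm m)\<^sup>2 / 4)))"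
      unfolding g_def integral_gaussian[OF a] using that
      by (simp add: power_mult_distrib power_divide power2_eq_square field_simps)
  qed
  let ?F = "\<lambda>p. g r (k + l) (fst p) * g \<rho> (k - l) (snd p)"
  have F: "?F \<in> borel_measurable borel"
    using integrable_lborel_times[OF g(1)[OF r] g(1)[OF \<rho>]] by (auto dest: borel_measurable_integrable)
  have "fourier_real (initial_mean r \<rho>) (k, l) = (LINT z|lborel. ?F (fst z + snd z, fst z - snd z))"
    unfolding fourier_def
  proof (intro Bochner_Integration.integral_cong refl)
    fix z :: "plane \<times> plane"
    have ph: "(- ((k + l) /\<^sub>R 2)) \<bullet> (fst z + snd z) + (- ((k - l) /\<^sub>R 2)) \<bullet> (fst z - snd z) = - ((k, l) \<bullet> z)"
      by (cases z) (simp add: inner_simps algebra_simps)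
    have "?F (fst z + snd z, fst z - snd z)
       = of_real (exp (- (1 / (4 * r\<^sup>2)) * (norm (fst z + snd z))\<^sup>2) * exp (- (1 / (4 * \<rho>\<^sup>2)) * (norm (fst z - snd z))\<^sup>2))
         * (exp (\<i> * of_real ((- ((k + l) /\<^sub>R 2)) \<bullet> (fst z + snd z))) * exp (\<i> * of_real ((- ((k - l) /\<^sub>R 2)) \<bullet> (fst z - snd z))))"
      unfolding g_def by simp
    also have "\<dots> = of_real (initial_mean r \<rho> z) * exp (\<i> * of_real (- ((k, l) \<bullet> z)))"
      unfolding ph[symmetric] of_real_add distrib_left exp_add
      by (simp add: initial_mean_def split_def flip: exp_add)
    finally show "complex_of_real (initial_mean r \<rho> z) * exp (- \<i> * of_real ((k, l) \<bullet> z)) = ?F (fst z + snd z, fst z - snd z)"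
      by simp
  qed
  also have "\<dots> = (1 / 2 ^ DIM(plane)) *\<^sub>R (LINT p|lborel. ?F p)"
    by (rule integral_sum_difference[OF F])
  also have "(LINT p|lborel. ?F p) = of_real (4 * pi * r\<^sup>2 * exp (- (r\<^sup>2 * (norm (k + l))\<^sup>2 / 4)))
      * of_real (4 * pi * \<rho>\<^sup>2 * exp (- (\<rho>\<^sup>2 * (norm (k - l))\<^sup>2 / 4)))"
    by (simp only: integral_lborel_times[OF g(1)[OF r] g(1)[OF \<rho>]] g(2)[OF r] g(2)[OF \<rho>])
  finally show ?thesis by (simp add: scaleR_conv_of_real power2_eq_square)
qed

text \<open>Damping by a wide Gaussian in k and Fubini turn the integral into C averaged against a
  narrow Gaussian. A bound on C is not at hand on the whole space, so C is split at the unit sphere: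
  inside, continuity on a compact ball gives a bound and dominated convergence applies; outside,
  integrability of C meets an exponentially small weight. The identity serves to rewrite the loss
  term of the equation for A, an integral of the transform, through C 0.\<close>

lemma fourier_inversion_at_zero:
  fixes C :: "'a::euclidean_space \<Rightarrow> real"
  assumes cont: "continuous_on UNIV C" and C: "integrable lborel C"
    and Ch: "integrable lborel (fourier_real C)"
  shows "(LINT k|lborel. fourier_real C k) = of_real ((2 * pi) ^ DIM('a) * C 0)"
proof -
  define d where "d n = 1 / real (Suc n)" for n
  have d0: "0 < d n" for n by (simp add: d_def)
  have d: "d \<longlonglongrightarrow> 0" unfolding d_def using LIMSEQ_inverse_real_of_nat by (simp add: inverse_eq_divide)
  have [measurable]: "C \<in> borel_measurable borel" "fourier_real C \<in> borel_measurable borel"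
    using C Ch by auto
  define I where "I n = (LINT k|lborel. fourier_real C k * of_real (exp (- (d n)\<^sup>2 * (norm k)\<^sup>2)))" for n
  define C1 where "C1 x = indicator (cball 0 1) x * C x" for x
  define C2 where "C2 x = indicator (- cball 0 1) x * C x" for x
  \<comment> \<open>Fourier transform of the damping factor; its total mass is
    \<open>(2 * pi) ^ DIM('a)\<close> for every n.\<close>
  define m where "m n x = (sqrt pi / d n) ^ DIM('a) * exp (- (norm x)\<^sup>2 / (4 * (d n)\<^sup>2))" for n and x :: 'a
  have mm[measurable]: "m n \<in> borel_measurable borel" for n unfolding m_def by measurable
  have m0: "0 \<le> m n x" for n x using d0[of n] by (simp add: m_def)

  have lim1: "I \<longlonglongrightarrow> (LINT k|lborel. fourier_real C k)"
    unfolding I_def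
  proof (rule integral_dominated_convergence)
    show "integrable lborel (\<lambda>k. norm (fourier_real C k))" using Ch by simp
    show "AE k in lborel. (\<lambda>n. fourier_real C k * of_real (exp (- (d n)\<^sup>2 * (norm k)\<^sup>2))) \<longlonglongrightarrow> fourier_real C k"
    proof (intro always_eventually allI)
      fix k :: 'a
      have "(\<lambda>n. fourier_real C k * of_real (exp (- (d n)\<^sup>2 * (norm k)\<^sup>2))) \<longlonglongrightarrow> fourier_real C k * of_real (exp (- 0\<^sup>2 * (norm k)\<^sup>2))"
        by (intro tendsto_intros d)
      then show "(\<lambda>n. fourier_real C k * of_real (exp (- (d n)\<^sup>2 * (norm k)\<^sup>2))) \<longlonglongrightarrow> fourier_real C k" by simp
    qed
    show "AE k in lborel. norm (fourier_real C k * of_real (exp (- (d n)\<^sup>2 * (norm k)\<^sup>2))) \<le> norm (fourier_real C k)" for n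
      by (auto simp: norm_mult intro!: mult_left_le)
  qed measurable

  have Ieq: "I n = of_real (LINT x|lborel. C x * m n x)" for n
  proof -
    let ?G = "\<lambda>k. complex_of_real (exp (- (d n)\<^sup>2 * (norm (k::'a))\<^sup>2))"
    let ?F = "\<lambda>p. of_real (C (snd p)) * exp (- \<i> * of_real (fst p \<bullet> snd p)) * ?G (fst p)"
    have a: "0 < (d n)\<^sup>2" using d0[of n] by simp
    have gi: "integrable lborel (\<lambda>k. exp (- (d n)\<^sup>2 * (norm (k::'a))\<^sup>2))"
    proof -
      have "integrable lborel (\<lambda>k::'a. norm (?G k * exp (\<i> * of_real (0 \<bullet> k))))"
        by (rule integrable_norm[OF integrable_gaussian[OF a]])
      then show ?thesis by (simp add: norm_mult)
    qed
    have "?F \<in> borel_measurable (borel \<Otimes>\<^sub>M borel)" by measurable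
    then have "?F \<in> borel_measurable borel" by (simp add: borel_prod)
    then have iF: "integrable lborel ?F"
      by (rule integrable_lborel_product_bound[OF _ gi integrable_norm[OF C]])
         (simp add: norm_mult mult.commute)
    have "I n = (LINT k|lborel. LINT x|lborel. ?F (k, x))"
      by (simp add: I_def fourier_def)
    also have "\<dots> = (LINT x|lborel. LINT k|lborel. ?F (k, x))"
      using lborel_Fubini[OF iF] by simp
    also have "\<dots> = (LINT x|lborel. of_real (C x * m n x))"
    proof (intro Bochner_Integration.integral_cong refl)
      fix x
      have "(LINT k|lborel. ?F (k, x)) = (LINT k|lborel. of_real (C x) * (?G k * exp (\<i> * of_real ((- x) \<bullet> k))))"
        by (simp add: mult_ac inner_commute)
      also have "\<dots> = of_real (C x) * (LINT k|lborel. ?G k * exp (\<i> * of_real ((- x) \<bullet> k)))"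
        by (rule integral_mult_right_zero)
      also have "\<dots> = of_real (C x * m n x)"
        unfolding integral_gaussian[OF a] using d0[of n] by (simp add: m_def real_sqrt_divide)
      finally show "(LINT k|lborel. ?F (k, x)) = of_real (C x * m n x)" .
    qed
    also have "\<dots> = of_real (LINT x|lborel. C x * m n x)" by (rule integral_complex_of_real)
    finally show ?thesis .
  qed

  have mb: "m n x \<le> (sqrt pi / d n) ^ DIM('a)" for n x
    using d0[of n] by (auto simp: m_def intro!: mult_left_le)
  have im: "integrable lborel (\<lambda>x. B x * m n x)" if B: "integrable lborel B" for B n
  proof (rule Bochner_Integration.integrable_bound)
    show "integrable lborel (\<lambda>x. B x * (sqrt pi / d n) ^ DIM('a))" using B by simp
    have [measurable]: "B \<in> borel_measurable borel" using B by simp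
    show "(\<lambda>x. B x * m n x) \<in> borel_measurable lborel" by measurable
    show "AE x in lborel. norm (B x * m n x) \<le> norm (B x * (sqrt pi / d n) ^ DIM('a))"
      using mb m0 d0[of n] by (auto simp: abs_mult intro!: mult_left_mono)
  qed
  have i1: "integrable lborel C1" and i2: "integrable lborel C2"
    unfolding C1_def C2_def
    using integrable_mult_indicator[of "cball 0 1" lborel C] integrable_mult_indicator[of "- cball 0 1" lborel C] C
    by simp_all
  have split: "(LINT x|lborel. C x * m n x) = (LINT x|lborel. C1 x * m n x) + (LINT x|lborel. C2 x * m n x)" for n
  proof -
    have "C x * m n x = C1 x * m n x + C2 x * m n x" for x
      by (auto simp: C1_def C2_def split: split_indicator)
    then show ?thesis using im[OF i1] im[OF i2] by simp
  qed

  have l2: "(\<lambda>n. LINT x|lborel. C2 x * m n x) \<longlonglongrightarrow> 0"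
  proof (rule Lim_null_comparison)
    let ?K = "sqrt pi ^ DIM('a) * exp 1 * (LINT x|lborel. norm (C x))"
    have "((\<lambda>y::real. y ^ DIM('a) / exp y) \<longlongrightarrow> 0) at_top" by (rule tendsto_power_div_exp_0)
    from filterlim_compose[OF this filterlim_compose[OF filterlim_real_sequentially filterlim_Suc]]
    have "(\<lambda>n. real (Suc n) ^ DIM('a) / exp (real (Suc n))) \<longlonglongrightarrow> 0" .
    from tendsto_mult_left[OF this, of ?K]
    show "(\<lambda>n. ?K * (real (Suc n) ^ DIM('a) / exp (real (Suc n)))) \<longlonglongrightarrow> 0" by simp
    show "\<forall>\<^sub>F n in sequentially. norm (LINT x|lborel. C2 x * m n x) \<le> ?K * (real (Suc n) ^ DIM('a) / exp (real (Suc n)))"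
    proof (intro always_eventually allI)
      fix n
      define y where "y = real (Suc n)"
      have le: "norm (C2 x * m n x) \<le> norm (C x) * (sqrt pi ^ DIM('a) * exp 1 * (y ^ DIM('a) / exp y))" for x
      proof (cases "x \<in> cball 0 1")
        case False
        then have "1 \<le> (norm x)\<^sup>2" by simp
        then have "y\<^sup>2 * 1 \<le> y\<^sup>2 * (norm x)\<^sup>2" by (intro mult_left_mono) auto
        \<comment> \<open>This square is the inequality - y^2 / 4 \<le> 1 - y, which weakens the
          Gaussian to an exponential in y, small enough against the power of y in the
          prefactor.\<close>
        moreover have "0 \<le> (y / 2 - 1)\<^sup>2" by simp
        moreover have "- (norm x)\<^sup>2 / (4 * (d n)\<^sup>2) = - (y\<^sup>2 * (norm x)\<^sup>2) / 4"
          by (simp add: d_def y_def power_divide)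
        ultimately have "- (norm x)\<^sup>2 / (4 * (d n)\<^sup>2) \<le> 1 - y"
          by (simp add: power_divide power2_diff)
        then have "exp (- (norm x)\<^sup>2 / (4 * (d n)\<^sup>2)) \<le> exp 1 / exp y" by (simp flip: exp_diff)
        then have "m n x \<le> (sqrt pi / d n) ^ DIM('a) * (exp 1 / exp y)"
          using d0[of n] unfolding m_def by (intro mult_left_mono) auto
        also have "\<dots> = sqrt pi ^ DIM('a) * exp 1 * (y ^ DIM('a) / exp y)"
          by (simp add: d_def y_def power_mult_distrib)
        finally have "norm (C x) * m n x \<le> norm (C x) * (sqrt pi ^ DIM('a) * exp 1 * (y ^ DIM('a) / exp y))"
          by (rule mult_left_mono) simp
        then show ?thesis using m0[of n x] False by (simp add: C2_def abs_mult)
      qed (simp add: C2_def y_def)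
      have "norm (LINT x|lborel. C2 x * m n x) \<le> (LINT x|lborel. norm (C2 x * m n x))"
        by (rule integral_norm_bound)
      also have "\<dots> \<le> (LINT x|lborel. norm (C x) * (sqrt pi ^ DIM('a) * exp 1 * (y ^ DIM('a) / exp y)))"
        using C by (intro integral_mono integrable_norm[OF im[OF i2]] le) auto
      also have "\<dots> = ?K * (y ^ DIM('a) / exp y)" by simp
      finally show "norm (LINT x|lborel. C2 x * m n x) \<le> ?K * (real (Suc n) ^ DIM('a) / exp (real (Suc n)))"
        by (simp only: y_def)
    qed
  qed

  have a4: "0 < (1/4 :: real)" by simp
  have g4: "integrable lborel (\<lambda>u::'a. exp (- (1/4) * (norm u)\<^sup>2))"
     "(LINT u|lborel. exp (- (1/4) * (norm (u::'a))\<^sup>2)) = (2 * sqrt pi) ^ DIM('a)"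
  proof -
    have "integrable lborel (\<lambda>u::'a. complex_of_real (exp (- (1/4) * (norm u)\<^sup>2)))"
      using integrable_gaussian[OF a4, of "0::'a"] by simp
    then show "integrable lborel (\<lambda>u::'a. exp (- (1/4) * (norm u)\<^sup>2))" by (simp only: complex_of_real_integrable_eq)
    have "complex_of_real (LINT u|lborel. exp (- (1/4) * (norm (u::'a))\<^sup>2)) = of_real ((2 * sqrt pi) ^ DIM('a))"
      using integral_gaussian[OF a4, of "0::'a"] by (simp add: real_sqrt_mult real_sqrt_divide mult.commute)
    then show "(LINT u|lborel. exp (- (1/4) * (norm (u::'a))\<^sup>2)) = (2 * sqrt pi) ^ DIM('a)"
      by (simp only: of_real_eq_iff)
  qed
  have "compact (C ` cball 0 1)"
    by (intro compact_continuous_image continuous_on_subset[OF cont]) auto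
  then have "bounded (C ` cball 0 1)" by (rule compact_imp_bounded)
  then obtain B where "\<forall>c\<in>C ` cball 0 1. norm c \<le> B" unfolding bounded_iff by blast
  then have C1B: "norm (C1 x) \<le> max B 0" for x
    by (auto simp: C1_def le_max_iff_disj split: split_indicator)
  have [measurable]: "C1 \<in> borel_measurable borel" using i1 by simp
  have l1: "(\<lambda>n. LINT x|lborel. C1 x * m n x) \<longlonglongrightarrow> (LINT u|lborel. C 0 * (sqrt pi ^ DIM('a) * exp (- (1/4) * (norm (u::'a))\<^sup>2)))"
  proof -
    have "(LINT x|lborel. C1 x * m n x) = (LINT u|lborel. C1 (d n *\<^sub>R u) * (sqrt pi ^ DIM('a) * exp (- (1/4) * (norm u)\<^sup>2)))" for n
    proof -
      have "(LINT x|lborel. C1 x * m n x) = \<bar>d n\<bar> ^ DIM('a) *\<^sub>R (LINT u|lborel. C1 (0 + d n *\<^sub>R u) * m n (0 + d n *\<^sub>R u))"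
        by (rule integral_lborel_affine) (use d0[of n] in auto)
      also have "\<dots> = (LINT u|lborel. \<bar>d n\<bar> ^ DIM('a) *\<^sub>R (C1 (0 + d n *\<^sub>R u) * m n (0 + d n *\<^sub>R u)))"
        by simp
      also have "\<dots> = (LINT u|lborel. C1 (d n *\<^sub>R u) * (sqrt pi ^ DIM('a) * exp (- (1/4) * (norm u)\<^sup>2)))"
        using d0[of n] by (intro Bochner_Integration.integral_cong refl)
          (simp add: m_def power_divide power_mult_distrib)
      finally show ?thesis .
    qed
    moreover have "(\<lambda>n. LINT u|lborel. C1 (d n *\<^sub>R u) * (sqrt pi ^ DIM('a) * exp (- (1/4) * (norm (u::'a))\<^sup>2)))
      \<longlonglongrightarrow> (LINT u|lborel. C 0 * (sqrt pi ^ DIM('a) * exp (- (1/4) * (norm (u::'a))\<^sup>2)))"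
    proof (rule integral_dominated_convergence)
      show "integrable lborel (\<lambda>u::'a. max B 0 * (sqrt pi ^ DIM('a) * exp (- (1/4) * (norm u)\<^sup>2)))"
        using g4(1) by (intro integrable_mult_right)
      show "AE u in lborel. norm (C1 (d n *\<^sub>R u) * (sqrt pi ^ DIM('a) * exp (- (1/4) * (norm (u::'a))\<^sup>2)))
          \<le> max B 0 * (sqrt pi ^ DIM('a) * exp (- (1/4) * (norm u)\<^sup>2))" for n
      proof (intro always_eventually allI)
        fix u :: 'a
        have "norm (C1 (d n *\<^sub>R u)) * (sqrt pi ^ DIM('a) * exp (- (1/4) * (norm u)\<^sup>2))
            \<le> max B 0 * (sqrt pi ^ DIM('a) * exp (- (1/4) * (norm u)\<^sup>2))"
          by (intro mult_right_mono C1B) auto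
        then show "norm (C1 (d n *\<^sub>R u) * (sqrt pi ^ DIM('a) * exp (- (1/4) * (norm u)\<^sup>2)))
          \<le> max B 0 * (sqrt pi ^ DIM('a) * exp (- (1/4) * (norm u)\<^sup>2))" by (simp add: abs_mult)
      qed
      show "AE u in lborel. (\<lambda>n. C1 (d n *\<^sub>R u) * (sqrt pi ^ DIM('a) * exp (- (1/4) * (norm (u::'a))\<^sup>2)))
         \<longlonglongrightarrow> C 0 * (sqrt pi ^ DIM('a) * exp (- (1/4) * (norm u)\<^sup>2))"
      proof (intro always_eventually allI tendsto_mult tendsto_const)
        fix u :: 'a
        have du: "(\<lambda>n. d n *\<^sub>R u) \<longlonglongrightarrow> 0" using tendsto_scaleR[OF d tendsto_const, of u] by simp
        have "isCont C 0" using cont by (simp add: continuous_on_eq_continuous_at)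
        then have "(\<lambda>n. C (d n *\<^sub>R u)) \<longlonglongrightarrow> C 0" by (rule isCont_tendsto_compose[OF _ du])
        moreover have "\<forall>\<^sub>F n in sequentially. C (d n *\<^sub>R u) = C1 (d n *\<^sub>R u)"
          using tendstoD[OF du zero_less_one] by eventually_elim (simp add: C1_def)
        ultimately show "(\<lambda>n. C1 (d n *\<^sub>R u)) \<longlonglongrightarrow> C 0" by (rule Lim_transform_eventually)
      qed
    qed measurable
    ultimately show ?thesis by simp
  qed
  have "I \<longlonglongrightarrow> of_real ((LINT u|lborel. C 0 * (sqrt pi ^ DIM('a) * exp (- (1/4) * (norm (u::'a))\<^sup>2))) + 0)"
    unfolding Ieq[abs_def] split by (intro tendsto_of_real tendsto_add l1 l2)
  from LIMSEQ_unique[OF lim1 this] have "(LINT k|lborel. fourier_real C k)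
     = of_real (LINT u|lborel. C 0 * (sqrt pi ^ DIM('a) * exp (- (1/4) * (norm (u::'a))\<^sup>2)))"
    by simp
  also have "(LINT u|lborel. C 0 * (sqrt pi ^ DIM('a) * exp (- (1/4) * (norm (u::'a))\<^sup>2))) = (2 * pi) ^ DIM('a) * C 0"
  proof -
    have "sqrt pi ^ DIM('a) * (2 * sqrt pi) ^ DIM('a) = (2 * pi) ^ DIM('a)"
    proof -
      have "sqrt pi ^ DIM('a) * (2 * sqrt pi) ^ DIM('a) = (sqrt pi * (2 * sqrt pi)) ^ DIM('a)"
        by (rule power_mult_distrib[symmetric])
      also have "sqrt pi * (2 * sqrt pi) = 2 * pi" by simp
      finally show ?thesis .
    qed
    then show ?thesis unfolding integral_mult_right_zero g4(2) by simp
  qed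
  finally show ?thesis .
qed

section \<open>The limit of the mean refocused field\<close>

text \<open>Integrating factor: exp(\<kappa> t) y has derivative exp(\<kappa> t) g. It isolates the
  ballistic decay of the adjoint solution at \<xi> = 0, where the phase vanishes.\<close>

lemma scalar_duhamel:
  fixes y g :: "real \<Rightarrow> complex" and \<kappa> :: complex
  assumes T: "0 \<le> T" and g: "continuous_on {0..T} g" and y: "continuous_on {0..T} y"
    and eq: "\<And>t. t \<in> {0..T} \<Longrightarrow> y t = y 0 + (LINT s:{0..t}|lborel. g s - \<kappa> * y s)"
  shows "y T = exp (- \<kappa> * of_real T) * y 0 + (LINT s:{0..T}|lborel. exp (- \<kappa> * of_real s) * g (T - s))"
proof -
  let ?z = "\<lambda>t. exp (\<kappa> * of_real t) * y t"
  have cont: "continuous_on {0..T} (\<lambda>s. g s - \<kappa> * y s)" by (intro continuous_intros g y)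
  have eq': "y t = y 0 + integral {0..t} (\<lambda>s. g s - \<kappa> * y s)" if "t \<in> {0..T}" for t
  proof -
    have "set_integrable lborel {0..t} (\<lambda>s. g s - \<kappa> * y s)"
      by (rule borel_integrable_atLeastAtMost'[OF continuous_on_subset[OF cont]]) (use that in auto)
    from set_borel_integral_eq_integral(2)[OF this] eq[OF that] show ?thesis by simp
  qed
  have dy: "(y has_vector_derivative g t - \<kappa> * y t) (at t within {0..T})" if t: "t \<in> {0..T}" for t
  proof -
    have d: "((\<lambda>u. y 0 + integral {0..u} (\<lambda>s. g s - \<kappa> * y s)) has_vector_derivative 0 + (g t - \<kappa> * y t)) (at t within {0..T})"
      by (intro has_vector_derivative_add has_vector_derivative_const integral_has_vector_derivative[OF cont t])
    have "(y has_vector_derivative 0 + (g t - \<kappa> * y t)) (at t within {0..T})"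
      by (rule has_vector_derivative_transform[OF t _ d]) (rule eq')
    then show ?thesis by simp
  qed
  have dz: "(?z has_vector_derivative exp (\<kappa> * of_real t) * g t) (at t within {0..T})" if t: "t \<in> {0..T}" for t
  proof -
    have "((\<lambda>t. exp (\<kappa> * of_real t)) has_vector_derivative \<kappa> * exp (\<kappa> * of_real t)) (at t within {0..T})"
      by (rule has_vector_derivative_real_field)
         (auto intro!: derivative_eq_intros)
    from has_vector_derivative_mult[OF this dy[OF t]] show ?thesis by (simp add: algebra_simps)
  qed
  have hi: "((\<lambda>t. exp (\<kappa> * of_real t) * g t) has_integral ?z T - ?z 0) {0..T}"
    by (rule fundamental_theorem_of_calculus[OF T dz])
  have "set_integrable lborel {0..T} (\<lambda>t. exp (\<kappa> * of_real t) * g t)"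
    by (intro borel_integrable_atLeastAtMost' continuous_intros g)
  from set_borel_integral_eq_integral(2)[OF this] integral_unique[OF hi]
  have I: "(LINT t:{0..T}|lborel. exp (\<kappa> * of_real t) * g t) = ?z T - ?z 0" by (rule trans)
  have "(LINT s:{0..T}|lborel. exp (- \<kappa> * of_real s) * g (T - s))
      = (LINT t:{0..T}|lborel. exp (- \<kappa> * of_real T) * (exp (\<kappa> * of_real t) * g t))"
  proof -
    have *: "exp (- \<kappa> * of_real T) * (exp (\<kappa> * of_real (T - s)) * g (T - s)) = exp (- \<kappa> * of_real s) * g (T - s)" for s
    proof -
      have "exp (- \<kappa> * of_real T) * exp (\<kappa> * of_real (T - s)) = exp (- \<kappa> * of_real s)"
        unfolding exp_add[symmetric] by (rule arg_cong[where f = exp]) (simp add: right_diff_distrib)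
      then show ?thesis by (simp only: mult.assoc[symmetric])
    qed
    show ?thesis
      using set_integral_reflect[of T "\<lambda>t. exp (- \<kappa> * of_real T) * (exp (\<kappa> * of_real t) * g t)"]
      unfolding * .
  qed
  also have "\<dots> = exp (- \<kappa> * of_real T) * (?z T - ?z 0)" by (simp add: I)
  also have "\<dots> = y T - exp (- \<kappa> * of_real T) * y 0"
  proof -
    have "exp (- \<kappa> * of_real T) * exp (\<kappa> * of_real T) = 1" unfolding exp_add[symmetric] by simp
    then show ?thesis by (simp add: right_diff_distrib mult.assoc[symmetric])
  qed
  finally show ?thesis by simp
qed

text \<open>P vanishes at \<xi> = 0, so w at 0 solves a scalar equation with decay rate \<kappa>,
  forced by \<alpha> times the integral of the transform of C against w. The source of a has the
  weight (2 pi)^4 exp(- \<kappa> s) and is tested against w (T - s), which produces the same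
  integral. Duality and variation of constants for w at 0 thus express one quantity in two
  ways.\<close>

lemma A_solution_pairing:
  fixes a w :: "real \<Rightarrow> plane \<Rightarrow> complex" and C :: "plane \<Rightarrow> real" and \<zeta> :: plane
  assumes c: "0 < c" and \<omega>: "0 < \<omega>" and T: "0 \<le> T"
    and h: "integrable lborel (fourier_real C)"
    and hC: "(LINT k|lborel. fourier_real C k) = of_real ((2 * pi)\<^sup>2 * C 0)"
    and sol: "A_solution c \<omega> C \<zeta> \<Omega> a"
    and w: "continuous_on UNIV (case_prod w)" and wB: "\<And>t \<xi>. t \<in> {0..T} \<Longrightarrow> norm (w t \<xi>) \<le> B"
    and \<alpha>_def: "\<alpha> = \<omega>\<^sup>2 / (4 * (2 * pi)\<^sup>2 * c\<^sup>2)" and \<kappa>_def: "\<kappa> = \<omega>\<^sup>2 / (4 * c\<^sup>2) * C 0"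
    and P_def: "\<And>\<xi>. P \<xi> = c * \<Omega> / \<omega>\<^sup>2 * (norm \<xi>)\<^sup>2 - c / \<omega> * (\<xi> \<bullet> \<zeta>)"
    and dual: "\<And>t \<xi>. t \<in> {0..T} \<Longrightarrow> w t \<xi> = exp (\<i> * of_real (t * P \<xi>)) * w 0 \<xi>
       + (LINT s:{0..1}|lborel. of_real t * exp (\<i> * of_real (t * (1 - s) * P \<xi>)) *
            adjoint_scattering (of_real \<alpha>) (of_real \<kappa>) (fourier_real C) (\<lambda>q. q) (w (t * s)) \<xi>)"
  shows "(LINT \<xi>|lborel. exp (- \<i> * of_real (T * c / \<omega> * (\<xi> \<bullet> \<zeta>))) * a T \<xi> * w 0 \<xi>)
     = of_real ((2 * pi) ^ 4) * (w T 0 - of_real (exp (- \<kappa> * T)) * w 0 0)"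
proof -
  let ?h = "fourier_real C"
  have curve: "continuous_L1_curve a"
    and mild: "\<And>z. 0 \<le> z \<Longrightarrow> AE \<xi> in lborel. a z \<xi> = (LINT s:{0..z}|lborel.
       exp (of_real (z - s) * A_symbol c \<omega> \<Omega> \<xi>) * A_scattering c \<omega> C \<zeta> s (a s) \<xi>)"
    using sol by (auto simp: A_solution_def mild_solution_def)
  have ai: "integrable lborel (a z)" if "0 \<le> z" for z
    using curve that by (auto simp: continuous_L1_curve_def)
  obtain Ba where Ba: "\<And>s. s \<in> {0..T} \<Longrightarrow> (LINT \<xi>|lborel. norm (a s \<xi>)) \<le> Ba"
    using continuous_L1_curve_bounded[OF curve] by blast
  \<comment> \<open>Multiplication by this phase absorbs the z-dependent phase inside the scattering
    integral, which becomes a plain convolution; in return P acquires the term - c / \<omega> *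
    (\<xi> \<bullet> \<zeta>).\<close>
  define e where "e z \<xi> = exp (- \<i> * of_real (z * c / \<omega> * (\<xi> \<bullet> \<zeta>)))" for z and \<xi> :: plane
  define f where "f z \<xi> = e z \<xi> * a z \<xi>" for z \<xi>
  define G where "G s \<xi> = e s \<xi> * A_scattering c \<omega> C \<zeta> s (a s) \<xi>" for s \<xi>
  define S where "S s \<xi> = of_real (\<alpha> * K c \<omega> C s) * ?h \<xi>" for s \<xi>
  have e1: "norm (e z \<xi>) = 1" for z \<xi> by (simp add: e_def)
  have em[measurable]: "(\<lambda>p. e (fst p) (snd p)) \<in> borel_measurable (borel \<Otimes>\<^sub>M borel)" "e z \<in> borel_measurable borel" for z
    unfolding e_def by measurable
  have hm[measurable]: "?h \<in> borel_measurable borel" using h by simp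
  have fi: "integrable lborel (f s)" if "s \<in> {0..T}" for s
    unfolding f_def
    by (rule Bochner_Integration.integrable_bound[OF ai[of s]])
       (use that ai[of s] in \<open>auto simp: norm_mult e1\<close>)
  have fB: "(LINT \<xi>|lborel. norm (f s \<xi>)) \<le> Ba" if "s \<in> {0..T}" for s
    using Ba[OF that] by (simp add: f_def norm_mult e1)
  have KB: "\<bar>\<alpha> * K c \<omega> C s\<bar> \<le> \<bar>\<alpha>\<bar> * ((2 * pi) ^ 4 * exp (\<bar>\<kappa>\<bar> * T))" if "s \<in> {0..T}" for s
  proof -
    have "- \<kappa> * s \<le> \<bar>\<kappa>\<bar> * s" using that by (intro mult_right_mono) auto
    also have "\<dots> \<le> \<bar>\<kappa>\<bar> * T" using that by (intro mult_left_mono) auto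
    finally show ?thesis by (simp add: abs_mult K_def \<kappa>_def mult_left_mono)
  qed
  have SB: "(LINT \<xi>|lborel. norm (S s \<xi>)) \<le> \<bar>\<alpha>\<bar> * ((2 * pi) ^ 4 * exp (\<bar>\<kappa>\<bar> * T)) * (LINT \<xi>|lborel. norm (?h \<xi>))"
    if "s \<in> {0..T}" for s
  proof -
    have "(LINT \<xi>|lborel. norm (S s \<xi>)) = \<bar>\<alpha> * K c \<omega> C s\<bar> * (LINT \<xi>|lborel. norm (?h \<xi>))"
      by (simp add: S_def norm_mult abs_mult)
    also have "\<dots> \<le> \<bar>\<alpha>\<bar> * ((2 * pi) ^ 4 * exp (\<bar>\<kappa>\<bar> * T)) * (LINT \<xi>|lborel. norm (?h \<xi>))"
      by (intro mult_right_mono KB[OF that]) simp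
    finally show ?thesis .
  qed
  have Gm: "(\<lambda>p. indicator {0..T} (fst p) *\<^sub>R G (fst p) (snd p)) \<in> borel_measurable borel"
  proof -
    \<comment> \<open>Joint measurability of a is known for nonnegative z only, so the measurability
      argument runs on the cut-off curve, which agrees with a on {0..T}.\<close>
    define a' where "a' s \<xi> = indicator {0..T} s *\<^sub>R a s \<xi>" for s \<xi>
    have "(\<lambda>p. a' (fst p) (snd p)) \<in> borel_measurable borel"
      unfolding a'_def by (rule continuous_L1_curve_measurable[OF curve])
    then have [measurable]: "(\<lambda>p. a' (fst p) (snd p)) \<in> borel_measurable (borel \<Otimes>\<^sub>M borel)" by (simp add: borel_prod)
    then have [measurable]: "case_prod a' \<in> borel_measurable (borel \<Otimes>\<^sub>M borel)" by (simp add: split_def)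
    have [measurable]: "K c \<omega> C \<in> borel_measurable borel" unfolding K_def by measurable
    have "(\<lambda>p. indicator {0..T} (fst p) *\<^sub>R (e (fst p) (snd p) * A_scattering c \<omega> C \<zeta> (fst p) (a' (fst p)) (snd p)))
       \<in> borel_measurable (borel \<Otimes>\<^sub>M borel)"
      unfolding A_scattering_def by measurable
    also have "(\<lambda>p. indicator {0..T} (fst p) *\<^sub>R (e (fst p) (snd p) * A_scattering c \<omega> C \<zeta> (fst p) (a' (fst p)) (snd p)))
       = (\<lambda>p. indicator {0..T} (fst p) *\<^sub>R G (fst p) (snd p))"
      by (rule ext) (auto simp: G_def a'_def[abs_def] split: split_indicator)
    finally show ?thesis by (simp add: borel_prod)
  qed
  have GAE: "AE \<xi> in lborel. G s \<xi> = of_real \<alpha> * (LINT q|lborel. ?h q * f s (\<xi> - q)) - of_real \<kappa> * f s \<xi> + S s \<xi>"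
    if s: "s \<in> {0..T}" for s
  proof -
    have "integrable (lborel \<Otimes>\<^sub>M lborel) (\<lambda>p. ?h (snd p) * f s (fst p - snd p))"
      using integrable_convolution_pair[OF h _ fi[OF s], of "\<lambda>q. q"] by (simp add: lborel_prod)
    \<comment> \<open>The integral of gain minus loss may be split only where the convolution
      converges.\<close>
    then have "AE \<xi> in lborel. integrable lborel (\<lambda>q. ?h q * f s (\<xi> - q))"
      using lborel_pair.AE_integrable_fst' by fastforce
    then show ?thesis
    proof eventually_elim
      case (elim \<xi>)
      have ex: "e s \<xi> * (?h k * (a s (\<xi> - k) * exp (\<i> * of_real (c * s / \<omega> * (k \<bullet> \<zeta>))) - a s \<xi>))
          = ?h k * f s (\<xi> - k) - ?h k * f s \<xi>" for k
      proof -
        have "e s (\<xi> - k) = e s \<xi> * exp (\<i> * of_real (c * s / \<omega> * (k \<bullet> \<zeta>)))"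
          unfolding e_def exp_add[symmetric] by (rule arg_cong[where f = exp]) (simp add: inner_diff_left algebra_simps diff_divide_distrib)
        then show ?thesis by (simp add: f_def algebra_simps)
      qed
      have ee: "e s \<xi> * exp (\<i> * of_real (c * s / \<omega> * (\<xi> \<bullet> \<zeta>))) = 1"
        unfolding e_def exp_add[symmetric] by (simp add: mult_ac)
      have "e s \<xi> * (LINT k|lborel. ?h k * (a s (\<xi> - k) * exp (\<i> * of_real (c * s / \<omega> * (k \<bullet> \<zeta>))) - a s \<xi>))
          = (LINT k|lborel. ?h k * f s (\<xi> - k) - ?h k * f s \<xi>)"
        unfolding integral_mult_right_zero[symmetric] ex ..
      also have "\<dots> = (LINT k|lborel. ?h k * f s (\<xi> - k)) - (LINT k|lborel. ?h k) * f s \<xi>"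
        using elim h by simp
      finally have I: "e s \<xi> * (LINT k|lborel. ?h k * (a s (\<xi> - k) * exp (\<i> * of_real (c * s / \<omega> * (k \<bullet> \<zeta>))) - a s \<xi>))
          = (LINT k|lborel. ?h k * f s (\<xi> - k)) - of_real ((2 * pi)\<^sup>2 * C 0) * f s \<xi>" unfolding hC .
      have "G s \<xi> = of_real \<alpha> * (e s \<xi> * (LINT k|lborel. ?h k * (a s (\<xi> - k) * exp (\<i> * of_real (c * s / \<omega> * (k \<bullet> \<zeta>))) - a s \<xi>)))
          + of_real (\<alpha> * K c \<omega> C s) * ?h \<xi> * (e s \<xi> * exp (\<i> * of_real (c * s / \<omega> * (\<xi> \<bullet> \<zeta>))))"
        unfolding G_def A_scattering_def \<alpha>_def by (simp only: distrib_left mult_ac)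
      also have "\<dots> = of_real \<alpha> * (LINT k|lborel. ?h k * f s (\<xi> - k)) - of_real (\<alpha> * ((2 * pi)\<^sup>2 * C 0)) * f s \<xi> + S s \<xi>"
        unfolding I ee S_def by (simp add: right_diff_distrib)
      \<comment> \<open>The total scattering rate, evaluated through \<open>hC\<close>, equals the
        decay rate in \<open>K\<close>.\<close>
      also have "\<alpha> * ((2 * pi)\<^sup>2 * C 0) = \<kappa>" using c by (simp add: \<alpha>_def \<kappa>_def field_simps)
      finally show ?case .
    qed
  qed
  have duh: "AE \<xi> in lborel. f z \<xi> = exp (\<i> * of_real (z * P \<xi>)) * 0
       + (LINT s:{0..z}|lborel. exp (\<i> * of_real ((z - s) * P \<xi>)) * G s \<xi>)" if z: "z \<in> {0..T}" for z
  proof -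
    have "0 \<le> z" using z by simp
    from mild[OF this] show ?thesis
    proof eventually_elim
      case (elim \<xi>)
      have ph: "e z \<xi> * exp (of_real (z - s) * A_symbol c \<omega> \<Omega> \<xi>) = exp (\<i> * of_real ((z - s) * P \<xi>)) * e s \<xi>" for s
        unfolding e_def exp_add[symmetric] A_symbol_def P_def
        by (rule arg_cong[where f = exp]) (simp add: algebra_simps diff_divide_distrib)
      have "f z \<xi> = (LINT s:{0..z}|lborel. e z \<xi> * (exp (of_real (z - s) * A_symbol c \<omega> \<Omega> \<xi>) * A_scattering c \<omega> C \<zeta> s (a s) \<xi>))"
        unfolding f_def by (subst elim) simp
      also have "\<dots> = (LINT s:{0..z}|lborel. exp (\<i> * of_real ((z - s) * P \<xi>)) * G s \<xi>)"
        unfolding mult.assoc[symmetric] ph G_def ..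
      finally show ?case by simp
    qed
  qed
  have Pm: "P \<in> borel_measurable borel" unfolding P_def[abs_def] by measurable
  have id: "continuous_on UNIV (\<lambda>q::plane. q)" by (rule continuous_on_id)
  have Si: "integrable lborel (S s)" for s using h by (simp add: S_def[abs_def])
  have "(LINT \<xi>|lborel. f T \<xi> * w 0 \<xi>) = (LINT \<xi>|lborel. 0 * w T \<xi>) + (LINT s:{0..T}|lborel. LINT \<xi>|lborel. S s \<xi> * w (T - s) \<xi>)"
    by (rule scattering_duality[OF T Pm _ h id fi fB Si SB Gm GAE w wB duh dual]) simp_all
  also have "\<dots> = (LINT s:{0..T}|lborel. LINT \<xi>|lborel. S s \<xi> * w (T - s) \<xi>)" by simp
  also have "\<dots> = (LINT s:{0..T}|lborel. of_real ((2 * pi) ^ 4) *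
      (exp (- of_real \<kappa> * of_real s) * (of_real \<alpha> * (LINT q|lborel. ?h q * w (T - s) q))))"
  proof (intro arg_cong[where f = "set_lebesgue_integral lborel {0..T}"] ext)
    fix s
    have "(LINT \<xi>|lborel. S s \<xi> * w (T - s) \<xi>) = of_real (\<alpha> * K c \<omega> C s) * (LINT q|lborel. ?h q * w (T - s) q)"
      unfolding S_def mult.assoc by simp
    also have "complex_of_real (\<alpha> * K c \<omega> C s) = of_real ((2 * pi) ^ 4) * exp (- of_real \<kappa> * of_real s) * of_real \<alpha>"
      by (simp add: K_def \<kappa>_def flip: exp_of_real)
    finally show "(LINT \<xi>|lborel. S s \<xi> * w (T - s) \<xi>) = of_real ((2 * pi) ^ 4) *
      (exp (- of_real \<kappa> * of_real s) * (of_real \<alpha> * (LINT q|lborel. ?h q * w (T - s) q)))"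
      by (simp add: mult_ac)
  qed
  also have "\<dots> = of_real ((2 * pi) ^ 4) * (LINT s:{0..T}|lborel. exp (- of_real \<kappa> * of_real s) *
      (of_real \<alpha> * (LINT q|lborel. ?h q * w (T - s) q)))"
    by (rule set_integral_mult_right)
  also have "(LINT s:{0..T}|lborel. exp (- of_real \<kappa> * of_real s) * (of_real \<alpha> * (LINT q|lborel. ?h q * w (T - s) q)))
      = w T 0 - of_real (exp (- \<kappa> * T)) * w 0 0"
  proof -
    let ?g = "\<lambda>s. of_real \<alpha> * (LINT q|lborel. ?h q * w s q)"
    \<comment> \<open>\<open>continuous_adjoint_scattering\<close> asks for a globally bounded
      function, while B bounds w only for times in {0..T}; clamping the time changes nothing there.
      It is applied with loss coefficient 0 to keep the gain term alone.\<close>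
    define w' where "w' p = w (max 0 (min T (fst p))) (snd p)" for p
    have w'c: "continuous_on UNIV w'"
    proof -
      have "continuous_on UNIV (\<lambda>p::real \<times> plane. case_prod w (max 0 (min T (fst p)), snd p))"
        by (rule continuous_on_compose2[OF w]) (auto intro!: continuous_intros)
      then show ?thesis by (simp add: w'_def[abs_def])
    qed
    have w'B: "norm (w' p) \<le> B" for p unfolding w'_def by (rule wB) (use T in auto)
    have "continuous_on UNIV (\<lambda>(x, \<xi>). adjoint_scattering (of_real \<alpha>) 0 ?h (\<lambda>q. q) (\<lambda>\<eta>. w' (x, \<eta>)) \<xi>)"
      by (rule continuous_adjoint_scattering[OF h id w'c w'B]) (auto intro: continuous_intros)
    then have "continuous_on {0..T} (\<lambda>s. (\<lambda>(x, \<xi>). adjoint_scattering (of_real \<alpha>) 0 ?h (\<lambda>q. q) (\<lambda>\<eta>. w' (x, \<eta>)) \<xi>) (s, 0))"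
      by (rule continuous_on_compose2) (auto intro!: continuous_intros)
    then have gc: "continuous_on {0..T} ?g"
      by (rule continuous_on_cong[THEN iffD1, rotated 2]) (auto simp: adjoint_scattering_def w'_def)
    have "continuous_on {0..T} (\<lambda>s. case_prod w (s, 0))"
      by (rule continuous_on_compose2[OF w]) (auto intro!: continuous_intros)
    then have yc: "continuous_on {0..T} (\<lambda>s. w s 0)" by simp
    have "w T 0 = exp (- of_real \<kappa> * of_real T) * w 0 0 + (LINT s:{0..T}|lborel. exp (- of_real \<kappa> * of_real s) * ?g (T - s))"
    proof (rule scalar_duhamel[OF T gc yc])
      fix t assume t: "t \<in> {0..T}"
      let ?H = "\<lambda>r. adjoint_scattering (of_real \<alpha>) (of_real \<kappa>) ?h (\<lambda>q. q) (w r) 0"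
      have "w t 0 = w 0 0 + (LINT s:{0..1}|lborel. of_real t * exp (\<i> * of_real (t * (1 - s) * 0)) * ?H (t * s))"
        using dual[OF t, of 0] by (simp add: P_def)
      also have "(LINT s:{0..1}|lborel. of_real t * exp (\<i> * of_real (t * (1 - s) * 0)) * ?H (t * s))
          = (LINT r:{0..t}|lborel. exp (\<i> * of_real ((t - r) * 0)) * ?H r)"
        by (rule unit_interval_rescale) (use t in simp)
      finally show "w t 0 = w 0 0 + (LINT s:{0..t}|lborel. ?g s - of_real \<kappa> * w s 0)"
        by (simp add: adjoint_scattering_def)
    qed
    moreover have "exp (- of_real \<kappa> * of_real T) = complex_of_real (exp (- \<kappa> * T))"
      by (simp flip: exp_of_real)
    ultimately show ?thesis by simp
  qed
  finally show ?thesis by (simp only: f_def e_def)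
qed

text \<open>There is no source here, so the pairing is conserved. The shift (q, - q) preserves the
  sum of the two wave numbers; this is what later allows w to be built from a function of the first
  wave number alone, with the sum as a parameter.\<close>

lemma mean_field_pairing:
  fixes Mh w :: "real \<Rightarrow> plane \<times> plane \<Rightarrow> complex" and C :: "plane \<Rightarrow> real"
  assumes T: "0 \<le> T" and h: "integrable lborel (fourier_real C)" and f0: "integrable lborel f0"
    and sol: "mild_solution (mean_symbol c \<omega> \<omega>') (\<lambda>s. mean_scattering c \<omega> \<omega>' C) f0 Mh"
    and w: "continuous_on UNIV (case_prod w)" and wB: "\<And>t p. t \<in> {0..T} \<Longrightarrow> norm (w t p) \<le> B"
    and \<alpha>_def: "\<alpha> = 2 * \<omega> * \<omega>' / (8 * c\<^sup>2 * (2 * pi)\<^sup>2)" and \<kappa>_def: "\<kappa> = (\<omega>\<^sup>2 + \<omega>'\<^sup>2) * C 0 / (8 * c\<^sup>2)"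
    and P_def: "\<And>p. P p = c / 2 * (1 / \<omega>' * (norm (snd p))\<^sup>2 - 1 / \<omega> * (norm (fst p))\<^sup>2)"
    and dual: "\<And>t p. t \<in> {0..T} \<Longrightarrow> w t p = exp (\<i> * of_real (t * P p)) * w 0 p
       + (LINT s:{0..1}|lborel. of_real t * exp (\<i> * of_real (t * (1 - s) * P p)) *
            adjoint_scattering (of_real \<alpha>) (of_real \<kappa>) (fourier_real C) (\<lambda>q. (q, - q)) (w (t * s)) p)"
  shows "(LINT p|lborel. Mh T p * w 0 p) = (LINT p|lborel. f0 p * w T p)"
proof -
  let ?h = "fourier_real C"
  have curve: "continuous_L1_curve Mh"
    and mild: "\<And>z. 0 \<le> z \<Longrightarrow> AE p in lborel. Mh z p = exp (of_real z * mean_symbol c \<omega> \<omega>' p) * f0 p + (LINT s:{0..z}|lborel.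
       exp (of_real (z - s) * mean_symbol c \<omega> \<omega>' p) * mean_scattering c \<omega> \<omega>' C (Mh s) p)"
    using sol by (auto simp: mild_solution_def)
  have Mi: "integrable lborel (Mh z)" if "z \<in> {0..T}" for z
    using curve that by (auto simp: continuous_L1_curve_def)
  obtain Ba where Ba: "\<And>s. s \<in> {0..T} \<Longrightarrow> (LINT p|lborel. norm (Mh s p)) \<le> Ba"
    using continuous_L1_curve_bounded[OF curve] by blast
  have hm[measurable]: "?h \<in> borel_measurable borel" using h by simp
  have Geq: "mean_scattering c \<omega> \<omega>' C f p = of_real \<alpha> * (LINT q|lborel. ?h q * f (p - (q, - q))) - of_real \<kappa> * f p" for f p
  proof -
    have eqs: "\<alpha> = 1 / (8 * c\<^sup>2) * (2 * \<omega> * \<omega>') * (1 / (2 * pi)\<^sup>2)"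
      "\<kappa> = 1 / (8 * c\<^sup>2) * ((\<omega>\<^sup>2 + \<omega>'\<^sup>2) * C 0)"
      by (simp_all add: \<alpha>_def \<kappa>_def)
    show ?thesis
      unfolding eqs by (cases p) (simp only: mean_scattering_def prod.case of_real_mult right_diff_distrib mult.assoc diff_Pair minus_minus diff_minus_eq_add)
  qed
  have Gm: "(\<lambda>p. indicator {0..T} (fst p) *\<^sub>R mean_scattering c \<omega> \<omega>' C (Mh (fst p)) (snd p)) \<in> borel_measurable borel"
  proof -
    define a' where "a' s \<xi> = indicator {0..T} s *\<^sub>R Mh s \<xi>" for s \<xi>
    have "(\<lambda>p. a' (fst p) (snd p)) \<in> borel_measurable borel"
      unfolding a'_def by (rule continuous_L1_curve_measurable[OF curve])
    then have [measurable]: "case_prod a' \<in> borel_measurable (borel \<Otimes>\<^sub>M borel)" by (simp add: split_def borel_prod)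
    have [measurable]: "(\<lambda>q::plane. (q, - q)) \<in> borel_measurable borel"
      by (intro borel_measurable_continuous_onI continuous_intros)
    have "(\<lambda>p. indicator {0..T} (fst p) *\<^sub>R (of_real \<alpha> * (LINT q|lborel. ?h q * a' (fst p) (snd p - (q, - q))) - of_real \<kappa> * a' (fst p) (snd p)))
       \<in> borel_measurable (borel \<Otimes>\<^sub>M borel)"
      by measurable
    also have "(\<lambda>p. indicator {0..T} (fst p) *\<^sub>R (of_real \<alpha> * (LINT q|lborel. ?h q * a' (fst p) (snd p - (q, - q))) - of_real \<kappa> * a' (fst p) (snd p)))
       = (\<lambda>p. indicator {0..T} (fst p) *\<^sub>R mean_scattering c \<omega> \<omega>' C (Mh (fst p)) (snd p))"
      by (rule ext) (auto simp: Geq a'_def[abs_def] split: split_indicator)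
    finally show ?thesis by (simp add: borel_prod)
  qed
  have ph: "of_real z * mean_symbol c \<omega> \<omega>' p = \<i> * of_real (z * P p)" for z p
    by (cases p) (simp add: mean_symbol_def P_def algebra_simps)
  have Pm: "P \<in> borel_measurable borel"
    unfolding P_def[abs_def] by (intro borel_measurable_continuous_onI continuous_intros)
  have J: "continuous_on UNIV (\<lambda>q::plane. (q, - q))" by (intro continuous_intros)
  have duh: "AE p in lborel. Mh z p = exp (\<i> * of_real (z * P p)) * f0 p + (LINT s:{0..z}|lborel.
       exp (\<i> * of_real ((z - s) * P p)) * mean_scattering c \<omega> \<omega>' C (Mh s) p)" if "z \<in> {0..T}" for z
    using mild[of z] that unfolding ph by simp
  have "(LINT p|lborel. Mh T p * w 0 p) = (LINT p|lborel. f0 p * w T p) + (LINT s:{0..T}|lborel. LINT p|lborel. 0 * w (T - s) p)"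
    by (rule scattering_duality[where f = Mh and S = "\<lambda>_ _. 0" and BS = 0, OF T Pm f0 h J Mi Ba _ _ Gm _ w wB duh dual])
       (simp_all add: Geq)
  then show ?thesis by (simp add: set_lebesgue_integral_def)
qed

section \<open>The rescaled propagator and the passage to the limit\<close>

lemma exp_gaussian_pair_integrable:
  fixes r \<rho> :: real
  assumes "0 < r" "0 < \<rho>"
  shows "integrable lborel (\<lambda>p::plane \<times> plane. complex_of_real
     (exp (- (r\<^sup>2 * (norm (fst p + snd p))\<^sup>2 / 4)) * exp (- (\<rho>\<^sup>2 * (norm (fst p - snd p))\<^sup>2 / 4))))"
proof -
  have g: "integrable lborel (\<lambda>u::plane. complex_of_real (exp (- (s\<^sup>2 * (norm u)\<^sup>2 / 4))))" if "0 < s" for s :: real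
    using integrable_gaussian[of "s\<^sup>2 / 4" "0::plane"] that by simp
  note i = integrable_lborel_times[OF g[OF assms(1)] g[OF assms(2)]]
  have "integrable lborel (\<lambda>z::plane \<times> plane. (\<lambda>p. complex_of_real (exp (- (r\<^sup>2 * (norm (fst p))\<^sup>2 / 4)))
     * complex_of_real (exp (- (\<rho>\<^sup>2 * (norm (snd p))\<^sup>2 / 4)))) (fst z + snd z, fst z - snd z))"
    by (subst integrable_sum_difference_iff) (use i borel_measurable_integrable[OF i] in auto)
  then show ?thesis by simp
qed

theorem proposition6p1:
  fixes c\<^sub>o \<omega>\<^sub>0 r\<^sub>0 \<rho>\<^sub>0 \<Omega> L :: real and x y :: plane
    and C :: "plane \<Rightarrow> real"
    and M :: "real \<Rightarrow> real \<Rightarrow> plane \<Rightarrow> plane \<Rightarrow> complex"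
    and A :: "real \<Rightarrow> plane \<Rightarrow> plane \<Rightarrow> real \<Rightarrow> complex"
  assumes "c\<^sub>o > 0" and "\<omega>\<^sub>0 > 0" and "r\<^sub>0 > 0" and "\<rho>\<^sub>0 > 0" and "L > 0"
    and "\<And>x. C (- x) = C x"
    and "continuous_on UNIV C"
    and "integrable lborel C"
    and "\<And>k. fourier_real C k \<in> \<real>\<^sub>\<ge>\<^sub>0"
    and "integrable lborel (fourier_real C)"
    and mean: "\<And>\<epsilon>. 0 < \<epsilon> \<Longrightarrow> \<epsilon> * \<bar>\<Omega>\<bar> < \<omega>\<^sub>0 \<Longrightarrow>
      mean_refocused_field c\<^sub>o (\<omega>\<^sub>0 + \<epsilon> * \<Omega>) (\<omega>\<^sub>0 - \<epsilon> * \<Omega>) (r\<^sub>0 / \<epsilon>) (\<rho>\<^sub>0 / \<epsilon>)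
        (\<lambda>x. \<epsilon> * C x) (M \<epsilon>)"
    and A: "\<And>\<zeta>. A_solution c\<^sub>o \<omega>\<^sub>0 C \<zeta> \<Omega> (\<lambda>z \<xi>. A z \<xi> \<zeta> \<Omega>)"
  shows "((\<lambda>\<epsilon>. M \<epsilon> (L / \<epsilon>) (y /\<^sub>R \<epsilon> + x) (y /\<^sub>R \<epsilon>)) \<longlongrightarrow>
      of_real (K c\<^sub>o \<omega>\<^sub>0 C L / (2 * pi) ^ 4) *
        (LINT \<zeta>|lborel. of_real (r\<^sub>0\<^sup>2 / (4 * pi)) *
           exp (- of_real (r\<^sub>0\<^sup>2 * (norm \<zeta>)\<^sup>2 / 4) + \<i> * of_real (y \<bullet> \<zeta>)))
      + of_real (1 / (2 * pi) ^ 4) *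
        (LINT \<zeta>|lborel. LINT \<xi>|lborel. of_real (r\<^sub>0\<^sup>2 / (4 * pi)) *
           exp (- of_real (r\<^sub>0\<^sup>2 * (norm \<zeta>)\<^sup>2 / 4) + \<i> * of_real (x \<bullet> \<xi>) + \<i> * of_real (y \<bullet> \<zeta>)
                - \<i> * of_real (L * c\<^sub>o / \<omega>\<^sub>0 * (\<xi> \<bullet> \<zeta>))) * A L \<xi> \<zeta> \<Omega>))
    (at_right 0)"
proof -
  note c = \<open>c\<^sub>o > 0\<close> and \<omega> = \<open>\<omega>\<^sub>0 > 0\<close> and r = \<open>r\<^sub>0 > 0\<close> and \<rho> = \<open>\<rho>\<^sub>0 > 0\<close> and L = \<open>L > 0\<close>
  let ?h = "fourier_real C"
  have h: "integrable lborel ?h" by fact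
  have hC: "(LINT k|lborel. ?h k) = of_real ((2 * pi)\<^sup>2 * C 0)"
    using fourier_inversion_at_zero[of C] assms by simp

  \<comment> \<open>Keeps both frequencies strictly between half and three halves of
    \<open>\<omega>\<^sub>0\<close>; the summand 1 covers \<Omega> = 0.\<close>
  define \<epsilon>\<^sub>1 where "\<epsilon>\<^sub>1 = \<omega>\<^sub>0 / (2 * (\<bar>\<Omega>\<bar> + 1))"
  have \<epsilon>\<^sub>1: "0 < \<epsilon>\<^sub>1" "\<epsilon>\<^sub>1 * \<bar>\<Omega>\<bar> < \<omega>\<^sub>0 / 2"
    using \<omega> by (auto simp: \<epsilon>\<^sub>1_def field_simps intro: add_pos_nonneg)
  \<comment> \<open>Clamping keeps both frequencies away from 0, so the propagator is defined for every real parameter.\<close>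
  define cl where "cl e = max 0 (min \<epsilon>\<^sub>1 e)" for e
  define W where "W e = \<omega>\<^sub>0 + cl e * \<Omega>" for e
  define W' where "W' e = \<omega>\<^sub>0 - cl e * \<Omega>" for e
  have clc: "continuous_on UNIV cl" unfolding cl_def by (intro continuous_intros)
  have cl\<Omega>: "\<bar>cl e * \<Omega>\<bar> < \<omega>\<^sub>0 / 2" for e
  proof -
    have "\<bar>cl e\<bar> \<le> \<epsilon>\<^sub>1" using \<epsilon>\<^sub>1 by (auto simp: cl_def)
    then have "\<bar>cl e\<bar> * \<bar>\<Omega>\<bar> \<le> \<epsilon>\<^sub>1 * \<bar>\<Omega>\<bar>" by (rule mult_right_mono) simp
    then show ?thesis using \<epsilon>\<^sub>1 by (simp add: abs_mult)
  qed
  have W: "0 < W e" "W e \<le> 2 * \<omega>\<^sub>0" and W': "0 < W' e" "W' e \<le> 2 * \<omega>\<^sub>0" for e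
    using cl\<Omega>[of e] \<omega> unfolding W_def W'_def abs_less_iff by linarith+
  have Wc: "continuous_on UNIV W" "continuous_on UNIV W'"
    unfolding W_def W'_def by (intro continuous_intros clc)+
  define \<alpha> where "\<alpha> \<theta> = 2 * W (fst \<theta>) * W' (fst \<theta>) / (8 * c\<^sub>o\<^sup>2 * (2 * pi)\<^sup>2)" for \<theta> :: "real \<times> plane"
  define \<kappa> where "\<kappa> \<theta> = ((W (fst \<theta>))\<^sup>2 + (W' (fst \<theta>))\<^sup>2) * C 0 / (8 * c\<^sub>o\<^sup>2)" for \<theta> :: "real \<times> plane"
  \<comment> \<open>For 0 \<le> e \<le> \<open>\<epsilon>\<^sub>1\<close>, with k = \<xi> and l = e
    \<zeta> - \<xi>, the symbol of the mean equation is \<i> times e P: the coefficient of |\<xi>|^2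
    is 1 / W' - 1 / W = 2 e \<Omega> / (W W'), and the other terms carry e as well. Dividing by e
    leaves a formula continuous down to e = 0, where it is the symbol of the conjugated equation for
    A.\<close>
  define P where "P \<theta> \<xi> = c\<^sub>o / 2 * (2 * \<Omega> / (W (fst \<theta>) * W' (fst \<theta>)) * (norm \<xi>)\<^sup>2
      - 2 / W' (fst \<theta>) * (\<xi> \<bullet> snd \<theta>) + cl (fst \<theta>) / W' (fst \<theta>) * (norm (snd \<theta>))\<^sup>2)"
    for \<theta> :: "real \<times> plane" and \<xi> :: plane
  \<comment> \<open>Both frequencies are at most twice \<open>\<omega>\<^sub>0\<close>, so 2 W W'
    and W^2 + W'^2 are at most \<open>8 * \<omega>\<^sub>0\<^sup>2\<close>.\<close>
  define B\<alpha> where "B\<alpha> = max (8 * \<omega>\<^sub>0\<^sup>2 / (8 * c\<^sub>o\<^sup>2 * (2 * pi)\<^sup>2)) (8 * \<omega>\<^sub>0\<^sup>2 * \<bar>C 0\<bar> / (8 * c\<^sub>o\<^sup>2))"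
  have \<alpha>c: "continuous_on UNIV (\<lambda>\<theta>. complex_of_real (\<alpha> \<theta>))"
    unfolding \<alpha>_def using c
    by (intro continuous_intros continuous_on_compose2[OF Wc(1)] continuous_on_compose2[OF Wc(2)]) auto
  have \<kappa>c: "continuous_on UNIV (\<lambda>\<theta>. complex_of_real (\<kappa> \<theta>))"
    unfolding \<kappa>_def using c
    by (intro continuous_intros continuous_on_compose2[OF Wc(1)] continuous_on_compose2[OF Wc(2)]) auto
  have Pc: "continuous_on UNIV (case_prod P)"
    unfolding P_def split_def
    by (intro continuous_intros continuous_on_compose2[OF Wc(1)] continuous_on_compose2[OF Wc(2)]
        continuous_on_compose2[OF clc]) (auto simp: less_imp_neq[OF W(1), symmetric] less_imp_neq[OF W'(1), symmetric])
  have \<alpha>B: "norm (complex_of_real (\<alpha> \<theta>)) \<le> B\<alpha>" for \<theta>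
  proof -
    have "W (fst \<theta>) * W' (fst \<theta>) \<le> (2 * \<omega>\<^sub>0) * (2 * \<omega>\<^sub>0)"
      using W[of "fst \<theta>"] W'[of "fst \<theta>"] \<omega> by (intro mult_mono) auto
    then have "2 * W (fst \<theta>) * W' (fst \<theta>) \<le> 8 * \<omega>\<^sub>0\<^sup>2"
      unfolding power2_eq_square by linarith
    then have "\<alpha> \<theta> \<le> 8 * \<omega>\<^sub>0\<^sup>2 / (8 * c\<^sub>o\<^sup>2 * (2 * pi)\<^sup>2)"
      unfolding \<alpha>_def by (rule divide_right_mono) simp
    moreover have "0 \<le> \<alpha> \<theta>" using W(1)[of "fst \<theta>"] W'(1)[of "fst \<theta>"] by (simp add: \<alpha>_def)
    ultimately have "\<bar>\<alpha> \<theta>\<bar> \<le> 8 * \<omega>\<^sub>0\<^sup>2 / (8 * c\<^sub>o\<^sup>2 * (2 * pi)\<^sup>2)" by simp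
    then show ?thesis by (simp add: B\<alpha>_def)
  qed
  have \<kappa>B: "norm (complex_of_real (\<kappa> \<theta>)) \<le> B\<alpha>" for \<theta>
  proof -
    have "(W (fst \<theta>))\<^sup>2 \<le> (2 * \<omega>\<^sub>0)\<^sup>2" "(W' (fst \<theta>))\<^sup>2 \<le> (2 * \<omega>\<^sub>0)\<^sup>2"
      by (rule power_mono; use W[of "fst \<theta>"] W'[of "fst \<theta>"] in simp)+
    then have "(W (fst \<theta>))\<^sup>2 + (W' (fst \<theta>))\<^sup>2 \<le> 8 * \<omega>\<^sub>0\<^sup>2" by (simp add: power2_eq_square)
    then have "((W (fst \<theta>))\<^sup>2 + (W' (fst \<theta>))\<^sup>2) * \<bar>C 0\<bar> \<le> 8 * \<omega>\<^sub>0\<^sup>2 * \<bar>C 0\<bar>" by (rule mult_right_mono) simp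
    then have "((W (fst \<theta>))\<^sup>2 + (W' (fst \<theta>))\<^sup>2) * \<bar>C 0\<bar> / (8 * c\<^sub>o\<^sup>2) \<le> 8 * \<omega>\<^sub>0\<^sup>2 * \<bar>C 0\<bar> / (8 * c\<^sub>o\<^sup>2)"
      by (rule divide_right_mono) simp
    then have "\<bar>\<kappa> \<theta>\<bar> \<le> 8 * \<omega>\<^sub>0\<^sup>2 * \<bar>C 0\<bar> / (8 * c\<^sub>o\<^sup>2)"
      by (simp add: \<kappa>_def abs_mult)
    then show ?thesis by (simp add: B\<alpha>_def)
  qed
  define \<phi> where "\<phi> \<xi> = exp (\<i> * of_real (x \<bullet> \<xi>))" for \<xi>
  have \<phi>c: "continuous_on UNIV \<phi>" unfolding \<phi>_def by (intro continuous_intros)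
  have \<phi>1: "norm (\<phi> \<xi>) \<le> 1" for \<xi> by (simp add: \<phi>_def)
  \<comment> \<open>A single v, with parameter \<theta> = (e, \<zeta>), is paired with the mean
    field for e > 0 and with A at e = 0; its continuity in e links the two.\<close>
  obtain v :: "(real \<times> (real \<times> plane)) \<times> plane \<Rightarrow> complex" where vc: "continuous_on UNIV v"
    and vB: "\<And>T. \<exists>B. \<forall>t\<in>{0..T}. \<forall>\<theta> \<xi>. norm (v ((t, \<theta>), \<xi>)) \<le> B"
    and veq: "\<And>t \<theta> \<xi>. 0 \<le> t \<Longrightarrow> v ((t, \<theta>), \<xi>) = exp (\<i> * of_real (t * P \<theta> \<xi>)) * \<phi> \<xi>
       + (LINT s:{0..1}|lborel. of_real t * exp (\<i> * of_real (t * (1 - s) * P \<theta> \<xi>)) *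
            adjoint_scattering (of_real (\<alpha> \<theta>)) (of_real (\<kappa> \<theta>)) ?h (\<lambda>q. q) (\<lambda>\<eta>. v ((t * s, \<theta>), \<eta>)) \<xi>)"
    using dual_propagator_exists[OF h continuous_on_id Pc \<phi>c \<phi>1 \<alpha>c \<alpha>B \<kappa>c \<kappa>B] by blast
  obtain B where B: "\<And>t \<theta> \<xi>. t \<in> {0..L} \<Longrightarrow> norm (v ((t, \<theta>), \<xi>)) \<le> B" using vB[of L] by blast
  have v0: "v ((0, \<theta>), \<xi>) = \<phi> \<xi>" for \<theta> \<xi> using veq[of 0 \<theta> \<xi>] by (simp add: set_lebesgue_integral_def)

  \<comment> \<open>Up to a constant, the transformed initial datum in the scaled wave numbers p =
    (k, l) / e, where it no longer depends on e.\<close>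
  define E where "E p = complex_of_real (exp (- (r\<^sub>0\<^sup>2 * (norm (fst p + snd p))\<^sup>2 / 4))
      * exp (- (\<rho>\<^sub>0\<^sup>2 * (norm (fst p - snd p))\<^sup>2 / 4)))" for p :: "plane \<times> plane"
  \<comment> \<open>In these variables \<zeta> is the sum of the components of p and stays of order
    1, while the wave number \<xi> is \<open>e *\<^sub>R fst p\<close>, which tends to 0.\<close>
  define F where "F e p = E p * exp (\<i> * of_real ((fst p + snd p) \<bullet> y)) * v ((L, (e, fst p + snd p)), e *\<^sub>R fst p)"
    for e and p :: "plane \<times> plane"
  define \<Phi> where "\<Phi> e = (LINT p|lborel. F e p)" for e
  have Ei: "integrable lborel E"
    unfolding E_def by (rule exp_gaussian_pair_integrable[OF r \<rho>])
  have Ec: "continuous_on UNIV E" unfolding E_def by (intro continuous_intros) simp_all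
  have vcomp: "continuous_on UNIV (\<lambda>z. v ((f1 z, (f2 z, f3 z)), f4 z))"
    if "continuous_on UNIV f1" "continuous_on UNIV f2" "continuous_on UNIV f3" "continuous_on UNIV f4"
    for f1 f2 f3 f4
    by (rule continuous_on_compose2[OF vc]) (auto intro!: continuous_intros that)

  have meanL: "M e (L / e) (y /\<^sub>R e + x) (y /\<^sub>R e) = of_real (r\<^sub>0\<^sup>2 * \<rho>\<^sub>0\<^sup>2 / (4 * pi\<^sup>2)) * \<Phi> e"
    if e: "0 < e" "e < \<epsilon>\<^sub>1" for e
  proof -
    have cle: "cl e = e" using e by (simp add: cl_def)
    have "e * \<bar>\<Omega>\<bar> < \<omega>\<^sub>0" using cl\<Omega>[of e] \<omega> e by (simp add: cle abs_mult)
    from mean[OF e(1) this] obtain Mh where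
      sol: "mild_solution (mean_symbol c\<^sub>o (W e) (W' e)) (\<lambda>s. mean_scattering c\<^sub>o (W e) (W' e) (\<lambda>x. e * C x))
             (fourier_real (initial_mean (r\<^sub>0 / e) (\<rho>\<^sub>0 / e))) Mh"
      and M: "\<And>z x y. 0 \<le> z \<Longrightarrow> M e z x y = inverse_fourier (Mh z) (x, y)"
      unfolding mean_refocused_field_def W_def W'_def cle by blast
    have he: "fourier_real (\<lambda>x. e * C x) = (\<lambda>q. of_real e * ?h q)"
      unfolding fourier_def by (simp add: mult.assoc)
    define f0 where "f0 = fourier_real (initial_mean (r\<^sub>0 / e) (\<rho>\<^sub>0 / e))"
    have f0: "f0 p = of_real (4 * pi\<^sup>2 * r\<^sub>0\<^sup>2 * \<rho>\<^sub>0\<^sup>2 / e ^ 4) * E ((1 / e) *\<^sub>R p)" for p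
    proof -
      let ?q = "(1 / e) *\<^sub>R p"
      have "fst ?q + snd ?q = (1 / e) *\<^sub>R (fst p + snd p)" "fst ?q - snd ?q = (1 / e) *\<^sub>R (fst p - snd p)"
        by (simp_all add: scaleR_add_right scaleR_diff_right)
      then have "E ?q = of_real (exp (- ((r\<^sub>0 / e)\<^sup>2 * (norm (fst p + snd p))\<^sup>2 / 4))
          * exp (- ((\<rho>\<^sub>0 / e)\<^sup>2 * (norm (fst p - snd p))\<^sup>2 / 4)))"
        using e by (simp add: E_def power_divide power_mult_distrib)
      moreover have "4 * pi\<^sup>2 * (r\<^sub>0 / e)\<^sup>2 * (\<rho>\<^sub>0 / e)\<^sup>2 = 4 * pi\<^sup>2 * r\<^sub>0\<^sup>2 * \<rho>\<^sub>0\<^sup>2 / e ^ 4"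
        by (simp add: power_divide power2_eq_square power4_eq_xxxx)
      moreover have "f0 p = of_real (4 * pi\<^sup>2 * (r\<^sub>0 / e)\<^sup>2 * (\<rho>\<^sub>0 / e)\<^sup>2 *
          exp (- ((r\<^sub>0 / e)\<^sup>2 * (norm (fst p + snd p))\<^sup>2 / 4)) * exp (- ((\<rho>\<^sub>0 / e)\<^sup>2 * (norm (fst p - snd p))\<^sup>2 / 4)))"
        using fourier_initial_mean[of "r\<^sub>0 / e" "\<rho>\<^sub>0 / e" "fst p" "snd p"] e r \<rho> by (simp add: f0_def)
      ultimately show ?thesis by (simp only: of_real_mult mult.assoc)
    qed
    have f0i: "integrable lborel f0"
    proof -
      have "integrable lborel (\<lambda>p. E (0 + (1 / e) *\<^sub>R p))"
        using e Ei by (subst integrable_lborel_affine_iff) (auto dest: borel_measurable_integrable)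
      then show ?thesis unfolding f0[abs_def] by simp
    qed
    \<comment> \<open>Adjoint solution of the unscaled mean equation whose datum is the plane wave
      of the evaluation point (y / e + x, y / e). Its factor in k + l is constant along the
      evolution and stays in front, so the rapid oscillation due to y / e never enters the
      scattering.\<close>
    define w where "w t p = exp (\<i> * of_real ((fst p + snd p) \<bullet> (y /\<^sub>R e))) *
        v ((e * t, (e, (fst p + snd p) /\<^sub>R e)), fst p)" for t and p :: "plane \<times> plane"
    have wc: "continuous_on UNIV (case_prod w)"
      unfolding w_def split_def by (intro continuous_intros vcomp)
    have wB: "norm (w t p) \<le> B" if "t \<in> {0..L / e}" for t p
      using B[of "e * t" "(e, (fst p + snd p) /\<^sub>R e)" "fst p"] that e by (simp add: w_def norm_mult field_simps)
    have dual: "w t p = exp (\<i> * of_real (t * (c\<^sub>o / 2 * (1 / W' e * (norm (snd p))\<^sup>2 - 1 / W e * (norm (fst p))\<^sup>2)))) * w 0 p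
       + (LINT s:{0..1}|lborel. of_real t * exp (\<i> * of_real (t * (1 - s) * (c\<^sub>o / 2 * (1 / W' e * (norm (snd p))\<^sup>2 - 1 / W e * (norm (fst p))\<^sup>2)))) *
            adjoint_scattering (of_real (\<alpha> (e, 0))) (of_real (e * \<kappa> (e, 0))) (fourier_real (\<lambda>x. e * C x)) (\<lambda>q. (q, - q)) (w (t * s)) p)"
      if t: "t \<in> {0..L / e}" for t p
    proof -
      define \<zeta> where "\<zeta> = (fst p + snd p) /\<^sub>R e"
      define u where "u = exp (\<i> * of_real ((fst p + snd p) \<bullet> (y /\<^sub>R e)))"
      let ?P = "c\<^sub>o / 2 * (1 / W' e * (norm (snd p))\<^sup>2 - 1 / W e * (norm (fst p))\<^sup>2)"
      have Pe: "e * P (e, \<zeta>) (fst p) = ?P"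
      proof -
        have sp: "snd p = e *\<^sub>R \<zeta> - fst p" using e by (simp add: \<zeta>_def)
        have n: "(norm (snd p))\<^sup>2 = e\<^sup>2 * (norm \<zeta>)\<^sup>2 - 2 * e * (fst p \<bullet> \<zeta>) + (norm (fst p))\<^sup>2"
          unfolding sp power2_norm_eq_inner
          by (simp add: inner_diff_left inner_diff_right inner_commute power2_eq_square algebra_simps)
        \<comment> \<open>The frequencies differ by W e - W' e = 2 e \<Omega>; this is how the
          offset \<Omega> survives in the limit.\<close>
        have d: "2 * e * \<Omega> / (W e * W' e) = 1 / W' e - 1 / W e"
          using W(1)[of e] W'(1)[of e] by (simp add: field_simps W_def W'_def cle)
        have "e * P (e, \<zeta>) (fst p) = c\<^sub>o / 2 * ((2 * e * \<Omega> / (W e * W' e)) * (norm (fst p))\<^sup>2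
            - 2 * e / W' e * (fst p \<bullet> \<zeta>) + e\<^sup>2 / W' e * (norm \<zeta>)\<^sup>2)"
          by (simp add: P_def cle power2_eq_square algebra_simps)
        also have "\<dots> = ?P" unfolding d n by (simp add: algebra_simps diff_divide_distrib add_divide_distrib)
        finally show ?thesis .
      qed
      \<comment> \<open>The shift (q, - q) leaves fst p + snd p, hence u and \<zeta>, unchanged. The
        factor e is that of the covariance and will be absorbed by the change of time from t to e
        t.\<close>
      have adj: "adjoint_scattering (of_real (\<alpha> (e, 0))) (of_real (e * \<kappa> (e, 0))) (fourier_real (\<lambda>x. e * C x)) (\<lambda>q. (q, - q)) (w r) p
        = u * of_real e * adjoint_scattering (of_real (\<alpha> (e, \<zeta>))) (of_real (\<kappa> (e, \<zeta>))) ?h (\<lambda>q. q) (\<lambda>\<eta>. v ((e * r, (e, \<zeta>)), \<eta>)) (fst p)" for r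
      proof -
        have wq: "w r (p + (q, - q)) = u * v ((e * r, (e, \<zeta>)), fst p + q)" for q
          by (simp add: w_def u_def \<zeta>_def)
        have wp: "w r p = u * v ((e * r, (e, \<zeta>)), fst p)"
          by (simp add: w_def u_def \<zeta>_def)
        have "(LINT q|lborel. of_real e * ?h q * (u * v ((e * r, (e, \<zeta>)), fst p + q)))
          = (LINT q|lborel. (u * of_real e) * (?h q * v ((e * r, (e, \<zeta>)), fst p + q)))"
          by (simp only: mult_ac)
        also have "\<dots> = (u * of_real e) * (LINT q|lborel. ?h q * v ((e * r, (e, \<zeta>)), fst p + q))"
          by (rule integral_mult_right_zero)
        finally show ?thesis
          unfolding adjoint_scattering_def he wq wp by (simp add: \<alpha>_def \<kappa>_def algebra_simps)
      qed
      have "w t p = u * v ((e * t, (e, \<zeta>)), fst p)" by (simp add: w_def u_def \<zeta>_def)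
      also have "v ((e * t, (e, \<zeta>)), fst p) = exp (\<i> * of_real (t * ?P)) * \<phi> (fst p)
       + (LINT s:{0..1}|lborel. of_real (e * t) * exp (\<i> * of_real (t * (1 - s) * ?P)) *
            adjoint_scattering (of_real (\<alpha> (e, \<zeta>))) (of_real (\<kappa> (e, \<zeta>))) ?h (\<lambda>q. q) (\<lambda>\<eta>. v ((e * (t * s), (e, \<zeta>)), \<eta>)) (fst p))"
      proof -
        have "e * t * P (e, \<zeta>) (fst p) = t * ?P" "e * t * (1 - s) * P (e, \<zeta>) (fst p) = t * (1 - s) * ?P"
          "e * t * s = e * (t * s)" for s
          unfolding Pe[symmetric] by (simp_all only: mult_ac)
        moreover have "0 \<le> e * t" using e t by simp
        ultimately show ?thesis using veq[of "e * t" "(e, \<zeta>)" "fst p"] by (simp only:)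
      qed
      also have "u * \<dots> = exp (\<i> * of_real (t * ?P)) * (u * \<phi> (fst p))
       + (LINT s:{0..1}|lborel. u * (of_real (e * t) * exp (\<i> * of_real (t * (1 - s) * ?P)) *
            adjoint_scattering (of_real (\<alpha> (e, \<zeta>))) (of_real (\<kappa> (e, \<zeta>))) ?h (\<lambda>q. q) (\<lambda>\<eta>. v ((e * (t * s), (e, \<zeta>)), \<eta>)) (fst p)))"
        by (simp only: distrib_left set_integral_mult_right mult.left_commute)
      also have "u * \<phi> (fst p) = w 0 p" by (simp add: w_def u_def v0)
      finally show ?thesis unfolding adj by (simp add: mult_ac)
    qed
    have hei: "integrable lborel (fourier_real (\<lambda>x. e * C x))" unfolding he using h by simp
    have pairing: "(LINT p|lborel. Mh (L / e) p * w 0 p) = (LINT p|lborel. f0 p * w (L / e) p)"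
    proof (rule mean_field_pairing[OF _ hei f0i sol[folded f0_def] wc wB _ _ refl dual])
      show "\<alpha> (e, 0) = 2 * W e * W' e / (8 * c\<^sub>o\<^sup>2 * (2 * pi)\<^sup>2)" by (simp add: \<alpha>_def)
      show "e * \<kappa> (e, 0) = ((W e)\<^sup>2 + (W' e)\<^sup>2) * (e * C 0) / (8 * c\<^sub>o\<^sup>2)" by (simp add: \<kappa>_def)
    qed (use L e in auto)
    have w0: "w 0 p = exp (\<i> * of_real (p \<bullet> (y /\<^sub>R e + x, y /\<^sub>R e)))" for p
      by (cases p) (simp add: w_def v0 \<phi>_def inner_commute[of x] inner_simps algebra_simps flip: exp_add)
    have "M e (L / e) (y /\<^sub>R e + x) (y /\<^sub>R e) = 1 / (2 * pi) ^ 4 * (LINT p|lborel. Mh (L / e) p * w 0 p)"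
      using L e by (simp add: M inverse_fourier_def w0)
    also have "\<dots> = 1 / (2 * pi) ^ 4 * (LINT p|lborel. f0 p * w (L / e) p)" by (simp only: pairing)
    also have "(LINT p|lborel. f0 p * w (L / e) p) = \<bar>e\<bar> ^ DIM(plane \<times> plane) *\<^sub>R (LINT p|lborel. f0 (0 + e *\<^sub>R p) * w (L / e) (0 + e *\<^sub>R p))"
    proof (rule integral_lborel_affine)
      have "continuous_on UNIV (w (L / e))" unfolding w_def by (intro continuous_intros vcomp)
      then have [measurable]: "w (L / e) \<in> borel_measurable borel" by (rule borel_measurable_continuous_onI)
      have [measurable]: "f0 \<in> borel_measurable borel" using f0i by simp
      show "(\<lambda>p. f0 p * w (L / e) p) \<in> borel_measurable borel" by measurable
    qed (use e in simp)
    also have "(LINT p|lborel. f0 (0 + e *\<^sub>R p) * w (L / e) (0 + e *\<^sub>R p)) = (LINT p|lborel. of_real (4 * pi\<^sup>2 * r\<^sub>0\<^sup>2 * \<rho>\<^sub>0\<^sup>2 / e ^ 4) * F e p)"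
    proof (rule Bochner_Integration.integral_cong[OF refl])
      fix p :: "plane \<times> plane"
      have s: "fst (e *\<^sub>R p) + snd (e *\<^sub>R p) = e *\<^sub>R (fst p + snd p)" by (simp add: scaleR_add_right)
      have "w (L / e) (e *\<^sub>R p) = exp (\<i> * of_real ((fst p + snd p) \<bullet> y)) * v ((L, (e, fst p + snd p)), e *\<^sub>R fst p)"
      proof -
        have i: "(e *\<^sub>R q) \<bullet> (y /\<^sub>R e) = q \<bullet> y" "e * (L / e) = L" "(e *\<^sub>R q) /\<^sub>R e = q" for q
          using e by simp_all
        show ?thesis unfolding w_def s i by simp
      qed
      moreover have "f0 (e *\<^sub>R p) = of_real (4 * pi\<^sup>2 * r\<^sub>0\<^sup>2 * \<rho>\<^sub>0\<^sup>2 / e ^ 4) * E p"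
        using e by (simp add: f0)
      ultimately show "f0 (0 + e *\<^sub>R p) * w (L / e) (0 + e *\<^sub>R p) = of_real (4 * pi\<^sup>2 * r\<^sub>0\<^sup>2 * \<rho>\<^sub>0\<^sup>2 / e ^ 4) * F e p"
        by (simp add: F_def mult.assoc)
    qed
    also have "\<dots> = of_real (4 * pi\<^sup>2 * r\<^sub>0\<^sup>2 * \<rho>\<^sub>0\<^sup>2 / e ^ 4) * \<Phi> e"
      unfolding \<Phi>_def by (rule integral_mult_right_zero)
    \<comment> \<open>The Jacobian e^4 of the four-dimensional scaling cancels the e^4 in the
      denominator of the initial datum.\<close>
    also have "1 / (2 * pi) ^ 4 * (\<bar>e\<bar> ^ DIM(plane \<times> plane) *\<^sub>R \<dots>) = of_real (1 / (2 * pi) ^ 4 * e ^ 4 * (4 * pi\<^sup>2 * r\<^sub>0\<^sup>2 * \<rho>\<^sub>0\<^sup>2 / e ^ 4)) * \<Phi> e"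
      using e by (simp add: scaleR_conv_of_real)
    also have "1 / (2 * pi) ^ 4 * e ^ 4 * (4 * pi\<^sup>2 * r\<^sub>0\<^sup>2 * \<rho>\<^sub>0\<^sup>2 / e ^ 4) = r\<^sub>0\<^sup>2 * \<rho>\<^sub>0\<^sup>2 / (4 * pi\<^sup>2)"
      using e by (simp add: field_simps power4_eq_xxxx power2_eq_square)
    finally show ?thesis .
  qed

  have Fc: "continuous_on UNIV (\<lambda>e. F e p)" "continuous_on UNIV (F e)" for e p
    unfolding F_def by (intro continuous_intros vcomp continuous_on_compose2[OF Ec]; simp)+
  \<comment> \<open>Since the coefficients are clamped, F makes sense for every real e, and
    two-sided continuity holds with the dominating function B * norm (E p).\<close>
  have "isCont \<Phi> 0"
    unfolding continuous_at_sequentially comp_def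
  proof (intro allI impI)
    fix X :: "nat \<Rightarrow> real" assume X: "X \<longlonglongrightarrow> 0"
    have [measurable]: "F e \<in> borel_measurable borel" for e by (rule borel_measurable_continuous_onI[OF Fc(2)])
    show "(\<lambda>n. \<Phi> (X n)) \<longlonglongrightarrow> \<Phi> 0"
      unfolding \<Phi>_def
    proof (rule integral_dominated_convergence)
      show "integrable lborel (\<lambda>p. norm (E p) * B)" using Ei by simp
      show "AE p in lborel. (\<lambda>n. F (X n) p) \<longlonglongrightarrow> F 0 p"
        using Fc(1) by (intro always_eventually allI isCont_tendsto_compose[OF _ X])
          (simp add: continuous_on_eq_continuous_at)
      show "AE p in lborel. norm (F (X n) p) \<le> norm (E p) * B" for n
        using B L by (intro always_eventually allI) (auto simp: F_def norm_mult intro!: mult_left_mono)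
    qed measurable
  qed
  then have "(\<Phi> \<longlongrightarrow> \<Phi> 0) (at_right 0)"
    by (auto simp: isCont_def intro: tendsto_within_subset)
  then have "((\<lambda>e. of_real (r\<^sub>0\<^sup>2 * \<rho>\<^sub>0\<^sup>2 / (4 * pi\<^sup>2)) * \<Phi> e) \<longlongrightarrow> of_real (r\<^sub>0\<^sup>2 * \<rho>\<^sub>0\<^sup>2 / (4 * pi\<^sup>2)) * \<Phi> 0) (at_right 0)"
    by (intro tendsto_intros)
  moreover have "\<forall>\<^sub>F e in at_right 0. of_real (r\<^sub>0\<^sup>2 * \<rho>\<^sub>0\<^sup>2 / (4 * pi\<^sup>2)) * \<Phi> e = M e (L / e) (y /\<^sub>R e + x) (y /\<^sub>R e)"
    using eventually_at_right_less[of 0] eventually_at_right_real[OF \<epsilon>\<^sub>1(1)]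
    by eventually_elim (simp add: meanL)
  ultimately have lim: "((\<lambda>e. M e (L / e) (y /\<^sub>R e + x) (y /\<^sub>R e)) \<longlongrightarrow> of_real (r\<^sub>0\<^sup>2 * \<rho>\<^sub>0\<^sup>2 / (4 * pi\<^sup>2)) * \<Phi> 0) (at_right 0)"
    by (rule Lim_transform_eventually)

  \<comment> \<open>The limit propagator at \<xi> = 0; the limiting field is its average against the
    Gaussian weight g of the claim.\<close>
  define V where "V \<zeta> = v ((L, (0, \<zeta>)), 0)" for \<zeta>
  define g where "g \<zeta> = of_real (r\<^sub>0\<^sup>2 / (4 * pi)) * exp (- of_real (r\<^sub>0\<^sup>2 * (norm \<zeta>)\<^sup>2 / 4) + \<i> * of_real (y \<bullet> \<zeta>))" for \<zeta>
  have Vc: "continuous_on UNIV V" unfolding V_def by (intro vcomp continuous_intros)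
  have VB: "norm (V \<zeta>) \<le> B" for \<zeta> unfolding V_def by (rule B) (use L in simp)
  have geq: "g \<zeta> = of_real (r\<^sub>0\<^sup>2 / (4 * pi)) * (of_real (exp (- (r\<^sub>0\<^sup>2 / 4) * (norm \<zeta>)\<^sup>2)) * exp (\<i> * of_real (y \<bullet> \<zeta>)))" for \<zeta>
    unfolding g_def exp_add by (simp flip: exp_of_real)
  have gi: "integrable lborel g"
    unfolding geq using integrable_gaussian[of "r\<^sub>0\<^sup>2 / 4" y] r by (intro integrable_mult_right) simp
  have gVi: "integrable lborel (\<lambda>\<zeta>. g \<zeta> * V \<zeta>)"
    by (rule integrable_mult_bounded[OF gi borel_measurable_continuous_onI[OF Vc] VB])

  \<comment> \<open>At e = 0 the propagator does not depend on the difference of the two wave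
    numbers. The Gaussian in that difference integrates to a constant, and
    \<open>\<rho>\<^sub>0\<close> cancels from the limit.\<close>
  have \<Phi>0: "of_real (r\<^sub>0\<^sup>2 * \<rho>\<^sub>0\<^sup>2 / (4 * pi\<^sup>2)) * \<Phi> 0 = (LINT \<zeta>|lborel. g \<zeta> * V \<zeta>)"
  proof -
    let ?k = "\<lambda>u. complex_of_real (exp (- (\<rho>\<^sub>0\<^sup>2 / 4) * (norm (u::plane))\<^sup>2))"
    have \<rho>4: "0 < \<rho>\<^sub>0\<^sup>2 / 4" using \<rho> by simp
    have ki: "integrable lborel ?k" "(LINT u|lborel. ?k u) = of_real (4 * pi / \<rho>\<^sub>0\<^sup>2)"
      using integrable_gaussian[OF \<rho>4, of "0::plane"] integral_gaussian[OF \<rho>4, of "0::plane"] \<rho> by simp_all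
    note i = integrable_lborel_times[OF gVi ki(1)]
    have Feq: "of_real (r\<^sub>0\<^sup>2 / (4 * pi)) * F 0 z = (\<lambda>p. (g (fst p) * V (fst p)) * ?k (snd p)) (fst z + snd z, fst z - snd z)" for z
      unfolding F_def E_def geq V_def by (simp add: inner_commute mult_ac)
    have "of_real (r\<^sub>0\<^sup>2 / (4 * pi)) * \<Phi> 0 = (LINT z|lborel. of_real (r\<^sub>0\<^sup>2 / (4 * pi)) * F 0 z)"
      unfolding \<Phi>_def by (rule integral_mult_right_zero[symmetric])
    also have "\<dots> = (1 / 2 ^ DIM(plane)) *\<^sub>R (LINT p|lborel. (g (fst p) * V (fst p)) * ?k (snd p))"
      unfolding Feq by (rule integral_sum_difference) (use borel_measurable_integrable[OF i] in simp)
    also have "(LINT p|lborel. (g (fst p) * V (fst p)) * ?k (snd p)) = (LINT \<zeta>|lborel. g \<zeta> * V \<zeta>) * of_real (4 * pi / \<rho>\<^sub>0\<^sup>2)"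
      by (simp only: integral_lborel_times[OF gVi ki(1)] ki(2))
    finally have "of_real (\<rho>\<^sub>0\<^sup>2 / pi) * (of_real (r\<^sub>0\<^sup>2 / (4 * pi)) * \<Phi> 0) = (LINT \<zeta>|lborel. g \<zeta> * V \<zeta>)"
      using \<rho> by (simp add: scaleR_conv_of_real)
    then show ?thesis by (simp add: power2_eq_square mult_ac)
  qed

  define D where "D = exp (- (\<omega>\<^sub>0\<^sup>2 / (4 * c\<^sub>o\<^sup>2)) * C 0 * L)"
  \<comment> \<open>Computing the inner integral for each \<zeta> gives a continuous function of
    \<zeta>, so measurability and integrability of the outer integrand are settled without studying
    how A depends on \<zeta>.\<close>
  have inner: "(LINT \<xi>|lborel. of_real (r\<^sub>0\<^sup>2 / (4 * pi)) *
           exp (- of_real (r\<^sub>0\<^sup>2 * (norm \<zeta>)\<^sup>2 / 4) + \<i> * of_real (x \<bullet> \<xi>) + \<i> * of_real (y \<bullet> \<zeta>)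
                - \<i> * of_real (L * c\<^sub>o / \<omega>\<^sub>0 * (\<xi> \<bullet> \<zeta>))) * A L \<xi> \<zeta> \<Omega>)
      = of_real ((2 * pi) ^ 4) * (g \<zeta> * V \<zeta> - of_real D * g \<zeta>)" for \<zeta>
  proof -
    define w where "w t \<xi> = v ((t, (0, \<zeta>)), \<xi>)" for t \<xi>
    have cl0: "cl 0 = 0" using \<epsilon>\<^sub>1 by (simp add: cl_def)
    have W0: "W 0 = \<omega>\<^sub>0" "W' 0 = \<omega>\<^sub>0" by (simp_all add: W_def W'_def cl0)
    have wc: "continuous_on UNIV (case_prod w)"
      unfolding w_def split_def by (intro vcomp continuous_intros)
    have "(LINT \<xi>|lborel. exp (- \<i> * of_real (L * c\<^sub>o / \<omega>\<^sub>0 * (\<xi> \<bullet> \<zeta>))) * A L \<xi> \<zeta> \<Omega> * w 0 \<xi>)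
      = of_real ((2 * pi) ^ 4) * (w L 0 - of_real (exp (- \<kappa> (0, \<zeta>) * L)) * w 0 0)"
    proof (rule A_solution_pairing[where P = "P (0, \<zeta>)" and \<alpha> = "\<alpha> (0, \<zeta>)" and w = w, OF c \<omega> _ h hC A wc])
      show "norm (w t \<xi>) \<le> B" if "t \<in> {0..L}" for t \<xi> using B[OF that] by (simp add: w_def)
      show "\<alpha> (0, \<zeta>) = \<omega>\<^sub>0\<^sup>2 / (4 * (2 * pi)\<^sup>2 * c\<^sub>o\<^sup>2)" using c by (simp add: \<alpha>_def W0 power2_eq_square field_simps)
      show "\<kappa> (0, \<zeta>) = \<omega>\<^sub>0\<^sup>2 / (4 * c\<^sub>o\<^sup>2) * C 0" using c by (simp add: \<kappa>_def W0 field_simps)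
      show "P (0, \<zeta>) \<xi> = c\<^sub>o * \<Omega> / \<omega>\<^sub>0\<^sup>2 * (norm \<xi>)\<^sup>2 - c\<^sub>o / \<omega>\<^sub>0 * (\<xi> \<bullet> \<zeta>)" for \<xi>
        using \<omega> by (simp add: P_def W0 cl0 power2_eq_square field_simps)
      show "w t \<xi> = exp (\<i> * of_real (t * P (0, \<zeta>) \<xi>)) * w 0 \<xi> + (LINT s:{0..1}|lborel. of_real t *
          exp (\<i> * of_real (t * (1 - s) * P (0, \<zeta>) \<xi>)) *
          adjoint_scattering (of_real (\<alpha> (0, \<zeta>))) (of_real (\<kappa> (0, \<zeta>))) ?h (\<lambda>q. q) (w (t * s)) \<xi>)"
        if "t \<in> {0..L}" for t \<xi>
        using veq[of t "(0, \<zeta>)" \<xi>] that by (simp add: w_def[abs_def] v0)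
    qed (use L in simp)
    also have "w L 0 = V \<zeta>" by (simp add: w_def V_def)
    also have "w 0 0 = 1" by (simp add: w_def v0 \<phi>_def)
    also have "exp (- \<kappa> (0, \<zeta>) * L) = D" using c by (simp add: \<kappa>_def D_def W0 field_simps)
    finally have I: "(LINT \<xi>|lborel. exp (- \<i> * of_real (L * c\<^sub>o / \<omega>\<^sub>0 * (\<xi> \<bullet> \<zeta>))) * A L \<xi> \<zeta> \<Omega> * w 0 \<xi>)
      = of_real ((2 * pi) ^ 4) * (V \<zeta> - of_real D * 1)" .
    have e: "of_real (r\<^sub>0\<^sup>2 / (4 * pi)) *
           exp (- of_real (r\<^sub>0\<^sup>2 * (norm \<zeta>)\<^sup>2 / 4) + \<i> * of_real (x \<bullet> \<xi>) + \<i> * of_real (y \<bullet> \<zeta>)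
                - \<i> * of_real (L * c\<^sub>o / \<omega>\<^sub>0 * (\<xi> \<bullet> \<zeta>))) * A L \<xi> \<zeta> \<Omega>
      = g \<zeta> * (exp (- \<i> * of_real (L * c\<^sub>o / \<omega>\<^sub>0 * (\<xi> \<bullet> \<zeta>))) * A L \<xi> \<zeta> \<Omega> * w 0 \<xi>)" for \<xi>
    proof -
      have "exp (- of_real (r\<^sub>0\<^sup>2 * (norm \<zeta>)\<^sup>2 / 4) + \<i> * of_real (x \<bullet> \<xi>) + \<i> * of_real (y \<bullet> \<zeta>)
                - \<i> * of_real (L * c\<^sub>o / \<omega>\<^sub>0 * (\<xi> \<bullet> \<zeta>)))
        = exp (- of_real (r\<^sub>0\<^sup>2 * (norm \<zeta>)\<^sup>2 / 4) + \<i> * of_real (y \<bullet> \<zeta>)) * exp (- \<i> * of_real (L * c\<^sub>o / \<omega>\<^sub>0 * (\<xi> \<bullet> \<zeta>))) * \<phi> \<xi>"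
        unfolding \<phi>_def exp_add[symmetric] by (rule arg_cong[where f = exp]) simp
      then show ?thesis by (simp only: g_def w_def v0 mult_ac)
    qed
    have "(LINT \<xi>|lborel. g \<zeta> * (exp (- \<i> * of_real (L * c\<^sub>o / \<omega>\<^sub>0 * (\<xi> \<bullet> \<zeta>))) * A L \<xi> \<zeta> \<Omega> * w 0 \<xi>))
      = g \<zeta> * (of_real ((2 * pi) ^ 4) * (V \<zeta> - of_real D * 1))"
      by (simp only: integral_mult_right_zero I)
    then show ?thesis unfolding e by (simp add: algebra_simps)
  qed
  \<comment> \<open>The coherent term of the claim is D times the integral of g, exactly what the
    pairing with A subtracts, so that the two terms add up to the full average of V.\<close>
  have "of_real (K c\<^sub>o \<omega>\<^sub>0 C L / (2 * pi) ^ 4) * (LINT \<zeta>|lborel. g \<zeta>)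
      + of_real (1 / (2 * pi) ^ 4) * (LINT \<zeta>|lborel. of_real ((2 * pi) ^ 4) * (g \<zeta> * V \<zeta> - of_real D * g \<zeta>))
      = (LINT \<zeta>|lborel. g \<zeta> * V \<zeta>)"
  proof -
    have "(LINT \<zeta>|lborel. of_real ((2 * pi) ^ 4) * (g \<zeta> * V \<zeta> - of_real D * g \<zeta>))
      = of_real ((2 * pi) ^ 4) * ((LINT \<zeta>|lborel. g \<zeta> * V \<zeta>) - of_real D * (LINT \<zeta>|lborel. g \<zeta>))"
      unfolding integral_mult_right_zero using gVi gi by (subst Bochner_Integration.integral_diff) simp_all
    moreover have "K c\<^sub>o \<omega>\<^sub>0 C L / (2 * pi) ^ 4 = D" by (simp add: K_def D_def)
    moreover have "of_real (1 / (2 * pi) ^ 4) * (of_real ((2 * pi) ^ 4) * z) = z" for z :: complex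
      by (simp add: mult.assoc[symmetric] flip: of_real_mult)
    ultimately show ?thesis by (simp only:) simp
  qed
  then show ?thesis
    using lim unfolding \<Phi>0 inner g_def[symmetric] by simp
qed

end
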